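(* Let $n>p>0$ be integers and let $q:\mathrm{St}_{p,n}\to\mathrm{Gr}_{p,n}$ be the Riemannian submersion from the Stiefel manifold to the Grassmann manifold. Let $\mathrm{csr}(z)$ and $\mathrm{ssr}(z)$ be the analytic continuations of $\cos z^{1/2}$ and $z^{-1/2}\sin z^{1/2}$ to entire functions. For $Y\in\mathrm{St}_{p,n}$ and $\eta$ a horizontal tangent vector at $Y$, a geodesic of $\mathrm{Gr}_{p,n}$ lifts to the horizontal geodesic $\gamma(t)$ on $\mathrm{St}_{p,n}$ with $(\gamma(0),\dot\gamma(0))=(Y,\eta)$ given by $$\gamma(t)=\mathrm{Exp}_Yt\eta=Y\,\mathrm{csr}(t^2\eta^T\eta)+t\eta\,\mathrm{ssr}(t^2\eta^T\eta).$$ The tangent component $J^{\mathcal{H}}(t)$ of the horizontal lift $\mathfrak{J}^{\mathcal{H}}(t)=(\gamma(t),J^{\mathcal{H}}(t))$ of a Jacobi field on $\mathrm{Gr}_{p,n}$ to $\mathrm{St}_{p,n}$ with initial data $\dot{\mathfrak{J}}^{\mathcal{H}}(0)=(Y,\nu_m,\eta,\nu_t)\in\mathcal{Q}\mathcal{H}\mathrm{St}_{p,n}$ is $$J^{\mathcal{H}}(t)=(I_n-\gamma(t)\gamma(t)^T)\Big\{\nu_m\,\mathrm{csr}(t^2\eta^T\eta)+t\delta_t\,\mathrm{ssr}(t^2\eta^T\eta)+t^2Y L_{\mathrm{csr}}(t^2\eta^T\eta,\eta^T\delta_t+\delta_t^T\eta)+t^3\eta L_{\mathrm{ssr}}(t^2\eta^T\eta,\eta^T\delta_t+\delta_t^T\eta)\Big\},$$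 where $\delta_t=\nu_t-Y(\nu_m^T\eta-\eta^T\nu_m)$ and, for an analytic function $f(z)=\sum_{i\ge0}f_iz^i$, $L_f(A,E)=\sum_{i\ge1}f_i\sum_{b+c=i-1}A^bEA^c$ denotes the Fréchet derivative.
   Context: $\mathrm{St}_{p,n}=\{Y\in\mathbb{R}^{n\times p}:Y^TY=I_p\}$ with the Riemannian metric induced from the trace inner product $\langle\omega_1,\omega_2\rangle=\mathrm{Tr}(\omega_1\omega_2^T)$ on $\mathbb{R}^{n\times p}$. $\mathrm{Gr}_{p,n}=\mathrm{St}_{p,n}/\mathrm{O}(p)$ is the quotient by right multiplication, with the quotient metric, so that $q$ is a Riemannian submersion. The vertical space at $Y$ is $\{Yb:b\in\mathbb{R}^{p\times p},b^T=-b\}$ and the horizontal space is $\{\eta\in\mathbb{R}^{n\times p}:Y^T\eta=0\}$, with horizontal projection $\omega\mapsto\omega-YY^T\omega$. $\mathcal{Q}\mathcal{H}\mathrm{St}_{p,n}\subset(\mathbb{R}^{n\times p})^4$ consists of the quadruples $(Y,\eta,\delta_m,\delta_t)$ with $Y^TY=I_p$, $Y^T\eta=0$, $Y^T\delta_m=0$, $\delta_m^T\eta+Y^T\delta_t=0$. The horizontal lift of a Jacobi field $J^B$ along $q\circ\gamma$ is the horizontal vector field $J^{\mathcal{H}}$ along $\gamma$ with $dq\,J^{\mathcal{H}}=J^B$; $\dot{\mathfrak{J}}^{\mathcal{H}}(0)=(\gamma(0),J^{\mathcal{H}}(0),\dot\gamma(0),\dot J^{\mathcal{H}}(0))$, with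 ordinary matrix-valued time derivatives. $\mathrm{Exp}$ is the Riemannian exponential map of $\mathrm{St}_{p,n}$; entire functions are applied to square matrices via power series. *)

theory Defs
  imports "HOL-Analysis.Analysis"
begin

section \<open>Entire functions of square matrices\<close>

text \<open>Both branches of the square root give the same values of \<open>cos (sqrt z)\<close> and of
  \<open>sin (sqrt z) / sqrt z\<close>, so these are single-valued and analytic away from 0.\<close>

definition entire_continuation :: "(complex \<Rightarrow> complex) \<Rightarrow> complex \<Rightarrow> complex" where
  "entire_continuation f = (THE g. g holomorphic_on UNIV \<and> (\<forall>z. z \<noteq> 0 \<longrightarrow> g z = f z))"

definition csr :: "complex \<Rightarrow> complex" where
  "csr = entire_continuation (\<lambda>z. cos (csqrt z))"

definition ssr :: "complex \<Rightarrow> complex" where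
  "ssr = entire_continuation (\<lambda>z. sin (csqrt z) / csqrt z)"

text \<open>The matrices are real, so the real part is taken; for functions that are real on the real
  axis, such as \<open>csr\<close> and \<open>ssr\<close>, the Taylor coefficients at 0 are real and nothing is lost.\<close>

definition taylor_coeff :: "(complex \<Rightarrow> complex) \<Rightarrow> nat \<Rightarrow> real" where
  "taylor_coeff f i = Re ((deriv ^^ i) f 0 / fact i)"

text \<open>The type class operation \<open>^\<close> is componentwise on \<open>real^'p^'p\<close>.\<close>

primrec matpow :: "real^'p^'p \<Rightarrow> nat \<Rightarrow> real^'p^'p" where
  "matpow A 0 = mat 1"
| "matpow A (Suc k) = A ** matpow A k"

definition matfun :: "(complex \<Rightarrow> complex) \<Rightarrow> real^'p^'p \<Rightarrow> real^'p^'p" where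
  "matfun f A = (\<Sum>i. taylor_coeff f i *\<^sub>R matpow A i)"

text \<open>\<open>L\<^sub>f(A,E)\<close>; the summation index below is the \<open>i - 1\<close> of the usual formula.\<close>

definition frechet_L :: "(complex \<Rightarrow> complex) \<Rightarrow> real^'p^'p \<Rightarrow> real^'p^'p \<Rightarrow> real^'p^'p" where
  "frechet_L f A E =
     (\<Sum>i. taylor_coeff f (Suc i) *\<^sub>R
            (\<Sum>(b, c) \<in> {(b, c). b + c = i}. matpow A b ** E ** matpow A c))"


section \<open>The Stiefel manifold\<close>

definition trace_inner :: "real^'p^'n \<Rightarrow> real^'p^'n \<Rightarrow> real" where
  "trace_inner \<omega>1 \<omega>2 = trace (\<omega>1 ** transpose \<omega>2)"

definition stiefel :: "(real^'p^'n) set" where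
  "stiefel = {Y. transpose Y ** Y = mat 1}"

definition stiefel_tangent :: "real^'p^'n \<Rightarrow> (real^'p^'n) set" where
  "stiefel_tangent Y = {\<omega>. transpose Y ** \<omega> + transpose \<omega> ** Y = 0}"

definition horizontal :: "real^'p^'n \<Rightarrow> (real^'p^'n) set" where
  "horizontal Y = {\<eta>. transpose Y ** \<eta> = 0}"

definition QHSt :: "((real^'p^'n) \<times> (real^'p^'n) \<times> (real^'p^'n) \<times> (real^'p^'n)) set" where
  "QHSt = {(Y, \<eta>, \<delta>m, \<delta>t). transpose Y ** Y = mat 1 \<and> transpose Y ** \<eta> = 0 \<and>
             transpose Y ** \<delta>m = 0 \<and> transpose \<delta>m ** \<eta> + transpose Y ** \<delta>t = 0}"

text \<open>The metric is the one induced from the ambient Euclidean space, hence the Levi-Civita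
  covariant derivative of a tangent field along a curve is the tangential part of its ordinary
  derivative.\<close>

definition stiefel_proj :: "real^'p^'n \<Rightarrow> real^'p^'n \<Rightarrow> real^'p^'n" where
  "stiefel_proj Y \<omega> =
     (THE \<tau>. \<tau> \<in> stiefel_tangent Y \<and> (\<forall>\<sigma>\<in>stiefel_tangent Y. trace_inner (\<omega> - \<tau>) \<sigma> = 0))"

definition velocity :: "(real \<Rightarrow> 'a::real_normed_vector) \<Rightarrow> real \<Rightarrow> 'a" where
  "velocity c t = vector_derivative c (at t)"

definition stiefel_cov_deriv ::
  "(real \<Rightarrow> real^'p^'n) \<Rightarrow> (real \<Rightarrow> real^'p^'n) \<Rightarrow> real \<Rightarrow> real^'p^'n" where
  "stiefel_cov_deriv c V t = stiefel_proj (c t) (velocity V t)"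

definition open_interval :: "real set \<Rightarrow> bool" where
  "open_interval S \<longleftrightarrow> open S \<and> is_interval S"

definition stiefel_geodesic_on :: "real set \<Rightarrow> (real \<Rightarrow> real^'p^'n) \<Rightarrow> bool" where
  "stiefel_geodesic_on S c \<longleftrightarrow>
     (\<forall>t\<in>S. c t \<in> stiefel \<and> c differentiable (at t) \<and> velocity c differentiable (at t) \<and>
             stiefel_cov_deriv c (velocity c) t = 0)"

definition stiefel_exp :: "real^'p^'n \<Rightarrow> real^'p^'n \<Rightarrow> real^'p^'n" where
  "stiefel_exp Y \<omega> =
     (THE Z. \<exists>S c. open_interval S \<and> {0..1} \<subseteq> S \<and> stiefel_geodesic_on S c \<and>
                    c 0 = Y \<and> velocity c 0 = \<omega> \<and> c 1 = Z)"


section \<open>Riemannian geometry in a coordinate domain\<close>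

text \<open>Coordinates take values in a linear subspace \<open>W\<close> of a Euclidean space (not in a type of the
  right dimension), and \<open>g x\<close> is the metric on \<open>W\<close> at the coordinate point \<open>x\<close>.  In these terms
  \<open>christoffel W g x u v\<close> is the vector with components \<open>\<Gamma>\<^sup>k\<^sub>i\<^sub>j u\<^sup>i v\<^sup>j\<close> of the Levi-Civita
  connection, \<open>curvature W g x u v w\<close> is \<open>R(u,v)w\<close> with the sign convention
  \<open>R(u,v)w = \<nabla>\<^sub>u\<nabla>\<^sub>vw - \<nabla>\<^sub>v\<nabla>\<^sub>uw - \<nabla>\<^bsub>[u,v]\<^esub>w\<close>, and \<open>cov_deriv W g x V\<close> is the covariant derivative
  \<open>DV/dt\<close> of a field \<open>V\<close> along the curve \<open>x\<close>.\<close>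

definition dir_deriv :: "('e::real_vector \<Rightarrow> 'b::real_normed_vector) \<Rightarrow> 'e \<Rightarrow> 'e \<Rightarrow> 'b" where
  "dir_deriv F x u = vector_derivative (\<lambda>s. F (x + s *\<^sub>R u)) (at 0)"

definition christoffel ::
  "'e::euclidean_space set \<Rightarrow> ('e \<Rightarrow> 'e \<Rightarrow> 'e \<Rightarrow> real) \<Rightarrow> 'e \<Rightarrow> 'e \<Rightarrow> 'e \<Rightarrow> 'e" where
  "christoffel W g x u v =
     (THE w. w \<in> W \<and>
        (\<forall>z\<in>W. g x w z = (dir_deriv (\<lambda>y. g y v z) x u + dir_deriv (\<lambda>y. g y u z) x v
                            - dir_deriv (\<lambda>y. g y u v) x z) / 2))"

definition curvature ::
  "'e::euclidean_space set \<Rightarrow> ('e \<Rightarrow> 'e \<Rightarrow> 'e \<Rightarrow> real) \<Rightarrow> 'e \<Rightarrow> 'e \<Rightarrow> 'e \<Rightarrow> 'e \<Rightarrow> 'e" where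
  "curvature W g x u v w =
     dir_deriv (\<lambda>y. christoffel W g y v w) x u - dir_deriv (\<lambda>y. christoffel W g y u w) x v
     + christoffel W g x u (christoffel W g x v w) - christoffel W g x v (christoffel W g x u w)"

definition cov_deriv ::
  "'e::euclidean_space set \<Rightarrow> ('e \<Rightarrow> 'e \<Rightarrow> 'e \<Rightarrow> real) \<Rightarrow> (real \<Rightarrow> 'e) \<Rightarrow> (real \<Rightarrow> 'e) \<Rightarrow> real \<Rightarrow> 'e" where
  "cov_deriv W g x V t = velocity V t + christoffel W g (x t) (velocity x t) (V t)"


section \<open>The Grassmann manifold as a Riemannian quotient\<close>

text \<open>The quotient map sends a matrix to its orbit under right multiplication by \<open>O(p)\<close>.  It is
  defined on all matrices so that it can be differentiated in the ambient space.\<close>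

definition gr_q :: "real^'p^'n \<Rightarrow> (real^'p^'n) set" where
  "gr_q Z = {Z ** Q | Q. orthogonal_matrix Q}"

definition grassmann :: "(real^'p^'n) set set" where
  "grassmann = gr_q ` stiefel"

text \<open>The smooth structure is given by the affine charts centred at \<open>gr_q Y\<close>, for \<open>Y\<close> in the
  Stiefel manifold: the orbit of \<open>Z\<close> with \<open>Y\<^sup>T Z\<close> invertible has the coordinate
  \<open>Z (Y\<^sup>T Z)\<^sup>-\<^sup>1 - Y\<close>, which does not depend on the representative.  Each chart maps its domain
  bijectively onto the linear space \<open>horizontal Y\<close>.\<close>

definition gr_dom :: "real^'p^'n \<Rightarrow> (real^'p^'n) set set" where
  "gr_dom Y = {gr_q Z | Z. Z \<in> stiefel \<and> invertible (transpose Y ** Z)}"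

definition gr_chart :: "real^'p^'n \<Rightarrow> (real^'p^'n) set \<Rightarrow> real^'p^'n" where
  "gr_chart Y m = (THE x. \<forall>Z\<in>m. x = Z ** matrix_inv (transpose Y ** Z) - Y)"

text \<open>A tangent vector at a point \<open>m\<close> is represented by the family of its coordinate expressions
  in all charts \<open>Y\<close> around \<open>m\<close> (and by 0 at every other index).  \<open>gr_dq Z \<omega>\<close> is the image of
  \<open>\<omega>\<close> under the differential at \<open>Z\<close> of the quotient map: since \<open>gr_chart Y \<circ> gr_q\<close> is
  smooth on an open set of matrices around \<open>Z\<close>, its differential along the Stiefel manifold is the
  restriction of the ambient one.\<close>

type_synonym ('p, 'n) gr_vector = "real^'p^'n \<Rightarrow> real^'p^'n"

definition gr_dq :: "real^'p^'n \<Rightarrow> real^'p^'n \<Rightarrow> ('p, 'n) gr_vector" where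
  "gr_dq Z \<omega> = (\<lambda>Y. if Y \<in> stiefel \<and> gr_q Z \<in> gr_dom Y
                      then frechet_derivative (\<lambda>X. gr_chart Y (gr_q X)) (at Z) \<omega> else 0)"

definition gr_tangent :: "(real^'p^'n) set \<Rightarrow> ('p, 'n) gr_vector set" where
  "gr_tangent m = {gr_dq Z \<omega> | Z \<omega>. Z \<in> stiefel \<and> gr_q Z = m \<and> \<omega> \<in> stiefel_tangent Z}"

definition gr_velocity :: "(real \<Rightarrow> (real^'p^'n) set) \<Rightarrow> real \<Rightarrow> ('p, 'n) gr_vector" where
  "gr_velocity c t = (\<lambda>Y. if Y \<in> stiefel \<and> c t \<in> gr_dom Y
                            then velocity (\<lambda>s. gr_chart Y (c s)) t else 0)"

text \<open>The quotient metric in the chart \<open>Y\<close>, at the coordinate point \<open>x\<close>: the inner product of two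
  coordinate vectors is the trace inner product of the horizontal vectors that the differential of
  the quotient map sends to them, at any point \<open>Z\<close> of the fibre.\<close>

definition gr_metric :: "real^'p^'n \<Rightarrow> real^'p^'n \<Rightarrow> real^'p^'n \<Rightarrow> real^'p^'n \<Rightarrow> real" where
  "gr_metric Y x u v =
     (THE r. \<forall>Z h k. Z \<in> stiefel \<and> gr_q Z \<in> gr_dom Y \<and> gr_chart Y (gr_q Z) = x \<and>
               h \<in> horizontal Z \<and> k \<in> horizontal Z \<and> gr_dq Z h Y = u \<and> gr_dq Z k Y = v
               \<longrightarrow> r = trace_inner h k)"

definition gr_geodesic_on :: "real set \<Rightarrow> (real \<Rightarrow> (real^'p^'n) set) \<Rightarrow> bool" where
  "gr_geodesic_on S c \<longleftrightarrow>
     c ` S \<subseteq> grassmann \<and>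
     (\<forall>Y\<in>stiefel.
        let I = {t\<in>S. c t \<in> gr_dom Y}; x = (\<lambda>t. gr_chart Y (c t))
        in open I \<and>
           (\<forall>t\<in>I. x differentiable (at t) \<and> velocity x differentiable (at t) \<and>
                   cov_deriv (horizontal Y) (gr_metric Y) x (velocity x) t = 0))"

text \<open>Jacobi fields along a geodesic: vector fields satisfying the Jacobi equation
  \<open>D\<^sup>2J/dt\<^sup>2 + R(J, c')c' = 0\<close>.\<close>

definition gr_jacobi_on ::
  "real set \<Rightarrow> (real \<Rightarrow> (real^'p^'n) set) \<Rightarrow> (real \<Rightarrow> ('p, 'n) gr_vector) \<Rightarrow> bool" where
  "gr_jacobi_on S c J \<longleftrightarrow>
     gr_geodesic_on S c \<and>
     (\<forall>t\<in>S. J t \<in> gr_tangent (c t)) \<and>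
     (\<forall>Y\<in>stiefel.
        let I = {t\<in>S. c t \<in> gr_dom Y}; x = (\<lambda>t. gr_chart Y (c t)); V = (\<lambda>t. J t Y);
            W = horizontal Y; g = gr_metric Y
        in \<forall>t\<in>I. V differentiable (at t) \<and> cov_deriv W g x V differentiable (at t) \<and>
                  cov_deriv W g x (cov_deriv W g x V) t
                    + curvature W g (x t) (V t) (velocity x t) (velocity x t) = 0)"

definition gr_horizontal_lift ::
  "real set \<Rightarrow> (real \<Rightarrow> real^'p^'n) \<Rightarrow> (real \<Rightarrow> ('p, 'n) gr_vector) \<Rightarrow> (real \<Rightarrow> real^'p^'n) \<Rightarrow> bool" where
  "gr_horizontal_lift S \<gamma> JB JH \<longleftrightarrow>
     (\<forall>t\<in>S. JH t \<in> horizontal (\<gamma> t) \<and> gr_dq (\<gamma> t) (JH t) = JB t)"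

definition has_initial_data ::
  "(real \<Rightarrow> real^'p^'n) \<Rightarrow> (real \<Rightarrow> real^'p^'n)
   \<Rightarrow> (real^'p^'n) \<times> (real^'p^'n) \<times> (real^'p^'n) \<times> (real^'p^'n) \<Rightarrow> bool" where
  "has_initial_data \<gamma> JH d \<longleftrightarrow>
     \<gamma> differentiable (at 0) \<and> JH differentiable (at 0) \<and>
     (\<gamma> 0, JH 0, velocity \<gamma> 0, velocity JH 0) = d"

end

theory Submission
  imports Defs
begin

text \<open>
  \<^bold>\<open>Stiefel manifold.\<close>  For the metric induced from the ambient space, a geodesic \<open>\<gamma>\<close> satisfies
  \<open>\<gamma>'' = - \<gamma> \<gamma>'\<^sup>T \<gamma>'\<close>.  If it starts horizontally it stays horizontal, \<open>S = \<gamma>'\<^sup>T \<gamma>' = \<eta>\<^sup>T \<eta>\<close> is constant,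
  and the equation becomes linear, \<open>\<gamma>'' = - \<gamma> S\<close>.  Its solution is \<open>Y csr (t\<^sup>2 S) + t \<eta> ssr (t\<^sup>2 S)\<close>, since
  \<open>csr (t\<^sup>2 S)\<close> and \<open>t ssr (t\<^sup>2 S)\<close> are the cosine and sine series in \<open>t\<close> with \<open>S\<close> in the role of the
  squared frequency (\<open>stiefel_exp_scaleR_horizontal\<close>, \<open>hgeo_eq_matfun\<close>).

  \<^bold>\<open>Passing to the quotient.\<close>  In an affine chart the quotient metric, its Christoffel symbols and its
  curvature have closed matrix forms (\<open>gr_metric_eq\<close>, \<open>christoffel_eq\<close>, \<open>curvature_eq\<close>).  From them one
  reads off that the covariant derivative on the quotient of a field with horizontal lift \<open>h\<close> along a
  horizontal curve is the image of the ordinary derivative \<open>h'\<close> (\<open>cov_deriv_chart_field\<close>), and that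
  \<open>R(h,k)k\<close> is the image of \<open>h k\<^sup>T k + k k\<^sup>T h - 2 k h\<^sup>T k\<close> (\<open>curvature_chart_diff\<close>).  Since \<open>\<gamma>'' = - \<gamma> S\<close> has no
  horizontal component, \<open>\<gamma>\<close> projects to a geodesic.  A geodesic of the quotient is determined by
  its initial data because its curve \<open>P\<close> of orthogonal projectors satisfies the linear equation \<open>P' = [\<Omega>, P]\<close> with the constant
  matrix \<open>\<Omega> = [P', P]\<close> (\<open>gr_geodesic_lax\<close>, \<open>gr_geodesic_unique\<close>).

  \<^bold>\<open>Jacobi fields.\<close>  Jacobi's equation lifts to a linear system for the horizontal lift
  (\<open>gr_jacobi_on_iff\<close>), which has at most one solution with given initial data
  (\<open>lifted_jacobi_unique\<close>).  A solution is the horizontal part of the variation field \<open>U\<close> of a family of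
  horizontal geodesics.  Differentiating the formula for \<open>\<gamma>\<close> in the initial data produces the Frechet
  derivatives of \<open>csr\<close> and \<open>ssr\<close>, in the direction \<open>E\<close> in which \<open>\<eta>\<^sup>T \<eta>\<close> varies; analytically, \<open>U\<close> is
  characterised by the linearised equation \<open>U'' = - U S - \<gamma> E\<close>.  That its horizontal part satisfies the
  lifted equation comes down to the linearised horizontality \<open>\<gamma>\<^sup>T U' + U\<^sup>T \<gamma>' = 0\<close>
  (\<open>variation_first_integral\<close>), which persists from time 0 together with the other linearised constraints.
\<close>

section \<open>Matrix calculus\<close>

lemma bounded_bilinear_matrix_mult:
  "bounded_bilinear ((**) :: real^'n^'m \<Rightarrow> real^'p^'n \<Rightarrow> real^'p^'m)"
  unfolding bilinear_conv_bounded_bilinear[symmetric] bilinear_def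
  by (auto intro!: linearI simp: matrix_matrix_mult_def vec_eq_iff algebra_simps sum.distrib sum_distrib_left)

lemma bounded_linear_transpose: "bounded_linear (transpose :: real^'n^'m \<Rightarrow> real^'m^'n)"
  unfolding linear_conv_bounded_linear[symmetric]
  by (auto intro!: linearI simp: transpose_def vec_eq_iff)

lemmas linear_transpose_matrix = bounded_linear.linear[OF bounded_linear_transpose]

text \<open>These rules bring a matrix expression into the normal form of a sum of right-nested products of
  atoms and their transposes; most matrix identities below are then decided by rewriting with the
  relations of the situation, such as \<open>Z\<^sup>T Z = 1\<close> and its absorbed form \<open>Z\<^sup>T (Z X) = X\<close>.\<close>

lemmas matrix_simps =
  bounded_bilinear.add_left[OF bounded_bilinear_matrix_mult]
  bounded_bilinear.add_right[OF bounded_bilinear_matrix_mult]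
  bounded_bilinear.diff_left[OF bounded_bilinear_matrix_mult]
  bounded_bilinear.diff_right[OF bounded_bilinear_matrix_mult]
  bounded_bilinear.minus_left[OF bounded_bilinear_matrix_mult]
  bounded_bilinear.minus_right[OF bounded_bilinear_matrix_mult]
  bounded_bilinear.scaleR_left[OF bounded_bilinear_matrix_mult]
  bounded_bilinear.scaleR_right[OF bounded_bilinear_matrix_mult]
  linear_add[OF linear_transpose_matrix]
  linear_diff[OF linear_transpose_matrix]
  linear_neg[OF linear_transpose_matrix]
  linear_scale[OF linear_transpose_matrix]
  matrix_mul_assoc[symmetric] matrix_transpose_mul

lemma transpose_zero [simp]: "transpose 0 = (0 :: real^'n^'m)"
  by (rule linear_0[OF linear_transpose_matrix])

lemma inner_matrix_def: "(A :: real^'p^'n) \<bullet> B = trace (transpose A ** B)"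
  by (simp add: inner_vec_def trace_def matrix_matrix_mult_def transpose_def)
     (subst sum.swap, simp)

lemma trace_inner_eq_inner: "trace_inner A B = A \<bullet> B"
  unfolding trace_inner_def
  by (simp add: inner_vec_def trace_def matrix_matrix_mult_def transpose_def)

lemma inner_transpose: "transpose A \<bullet> transpose B = (A :: real^'p^'n) \<bullet> B"
  by (simp add: inner_vec_def transpose_def) (rule sum.swap)

lemma inner_matrix_mult_left: "(A ** B) \<bullet> (C :: real^'p^'n) = B \<bullet> (transpose A ** C)"
  by (simp only: inner_matrix_def matrix_transpose_mul matrix_mul_assoc)

lemma inner_matrix_mult_right: "(A ** B) \<bullet> (C :: real^'p^'n) = A \<bullet> (C ** transpose B)"
proof -
  have "(A ** B) \<bullet> C = (transpose B ** transpose A) \<bullet> transpose C"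
    by (simp only: inner_transpose flip: matrix_transpose_mul)
  also have "\<dots> = transpose A \<bullet> transpose (C ** transpose B)"
    by (simp only: inner_matrix_mult_left matrix_transpose_mul transpose_transpose)
  finally show ?thesis by (simp only: inner_transpose)
qed

lemma transpose_mult_eq_zero_commute: "transpose A ** B = 0 \<Longrightarrow> transpose B ** A = 0"
  for A :: "real^'p^'n" and B :: "real^'q^'n"
  by (metis matrix_transpose_mul transpose_transpose transpose_zero)

text \<open>The norm of a matrix is the Frobenius norm, so this is the Cauchy--Schwarz inequality.\<close>

lemma norm_matrix_mult_le: "norm (A ** B) \<le> norm A * norm (B :: real^'p^'n)"
proof -
  have row: "norm ((A ** B) $ i) \<le> norm (A $ i) * norm B" for i
  proof -
    have "(A ** B) $ i = (\<Sum>j\<in>UNIV. A $ i $ j *\<^sub>R B $ j)"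
      by (simp add: matrix_matrix_mult_def vec_eq_iff)
    also have "norm \<dots> \<le> (\<Sum>j\<in>UNIV. \<bar>A $ i $ j\<bar> * norm (B $ j))"
      by (rule order_trans[OF norm_sum]) simp
    also have "\<dots> \<le> L2_set (\<lambda>j. A $ i $ j) UNIV * L2_set (\<lambda>j. norm (B $ j)) UNIV"
      using L2_set_mult_ineq[of "\<lambda>j. A $ i $ j" "\<lambda>j. norm (B $ j)" UNIV] by simp
    also have "\<dots> = norm (A $ i) * norm B"
      by (simp add: norm_vec_def L2_set_def)
    finally show ?thesis .
  qed
  have "norm (A ** B) = L2_set (\<lambda>i. norm ((A ** B) $ i)) UNIV" by (simp add: norm_vec_def)
  also have "\<dots> \<le> L2_set (\<lambda>i. norm (A $ i) * norm B) UNIV"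
    by (rule L2_set_mono) (auto intro: row)
  also have "\<dots> = norm A * norm B"
    by (simp add: L2_set_left_distrib norm_vec_def)
  finally show ?thesis .
qed

lemma norm_transpose: "norm (transpose A) = norm (A :: real^'p^'n)"
  by (simp add: norm_eq_sqrt_inner inner_transpose)

lemma continuous_on_det:
  fixes F :: "'a::topological_space \<Rightarrow> real^'n^'n"
  assumes "\<And>i j. continuous_on S (\<lambda>x. F x $ i $ j)"
  shows "continuous_on S (\<lambda>x. det (F x))"
  unfolding det_def by (intro continuous_intros assms)

lemma open_invertible: "open {A :: real^'n^'n. invertible A}"
proof -
  have "open {A :: real^'n^'n. det A \<noteq> 0}"
    by (intro open_Collect_neq continuous_on_det continuous_intros)
  thus ?thesis by (simp add: invertible_det_nz)
qed

lemma matrix_inv_right: "invertible A \<Longrightarrow> A ** matrix_inv A = (mat 1 :: real^'n^'n)"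
  and matrix_inv_left: "invertible A \<Longrightarrow> matrix_inv A ** A = (mat 1 :: real^'n^'n)"
  unfolding matrix_inv_def invertible_def by (drule someI_ex, blast)+

lemma matrix_inv_unique:
  fixes A B :: "real^'n^'n"
  assumes "A ** B = mat 1" shows "matrix_inv A = B" "invertible A"
proof -
  show i: "invertible A" using assms by (auto simp: invertible_right_inverse)
  have "matrix_inv A = matrix_inv A ** (A ** B)" by (simp add: assms)
  also have "\<dots> = B" by (simp only: matrix_mul_assoc matrix_inv_left[OF i] matrix_mul_lid)
  finally show "matrix_inv A = B" .
qed

text \<open>By Cramer's rule the entries of the inverse are quotients of determinants, which are continuous.\<close>

lemma continuous_matrix_inv:
  assumes "invertible (A :: real^'n^'n)"
  shows "continuous (at A) matrix_inv"
proof -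
  define F where "F = (\<lambda>A :: real^'n^'n. \<chi> k j. det (\<chi> i l. if l = k then axis j 1 $ i else A $ i $ l) / det A)"
  have "continuous_on {A :: real^'n^'n. det A \<noteq> 0} (\<lambda>A. det (\<chi> i l. if l = k then axis j 1 $ i else A $ i $ l) / det A)" for k j :: 'n
  proof (intro continuous_on_divide continuous_on_det)
    show "continuous_on {A :: real^'n^'n. det A \<noteq> 0} (\<lambda>A. (\<chi> i l. if l = k then axis j 1 $ i else A $ i $ l) $ i $ l)" for i l
      by (cases "l = k") (auto intro!: continuous_intros)
  qed (auto intro!: continuous_intros)
  hence "continuous_on {A :: real^'n^'n. det A \<noteq> 0} F"
    unfolding F_def by (intro continuous_on_vec_lambda)
  moreover have "F B = matrix_inv B" if "det B \<noteq> 0" for B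
  proof -
    have "B *v (matrix_inv B *v axis j 1) = axis j 1" for j
      using that by (simp add: matrix_vector_mul_assoc matrix_inv_right invertible_det_nz)
    hence "matrix_inv B *v axis j 1 = (\<chi> k. det (\<chi> i l. if l = k then axis j 1 $ i else B $ i $ l) / det B)" for j
      using cramer[OF that] by blast
    hence "(matrix_inv B *v axis j 1) $ k = F B $ k $ j" for j k
      by (simp add: F_def)
    thus ?thesis
      by (simp add: vec_eq_iff matrix_vector_mult_basis column_def)
  qed
  ultimately have "continuous_on {A :: real^'n^'n. det A \<noteq> 0} matrix_inv"
    by (subst (asm) continuous_on_cong[OF refl, of _ F matrix_inv]) auto
  thus ?thesis
    using assms continuous_on_eq_continuous_at[OF open_invertible[unfolded invertible_det_nz]]
    by (auto simp: invertible_det_nz)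
qed

text \<open>From \<open>(A+H)\<^sup>-\<^sup>1 - A\<^sup>-\<^sup>1 = - A\<^sup>-\<^sup>1 H (A+H)\<^sup>-\<^sup>1\<close> the remainder of the first-order expansion is
  \<open>- A\<^sup>-\<^sup>1 H ((A+H)\<^sup>-\<^sup>1 - A\<^sup>-\<^sup>1)\<close>, which is \<open>o(H)\<close> by continuity of the inverse.\<close>

lemma has_derivative_matrix_inv:
  assumes A: "invertible (A :: real^'n^'n)"
  shows "(matrix_inv has_derivative (\<lambda>H. - (matrix_inv A ** H ** matrix_inv A))) (at A)"
  unfolding has_derivative_at
proof
  let ?D = "\<lambda>H. - (matrix_inv A ** H ** matrix_inv A)"
  show "bounded_linear ?D"
    by (intro bounded_linear_minus
        bounded_linear_compose[OF bounded_bilinear.bounded_linear_left[OF bounded_bilinear_matrix_mult]]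
        bounded_bilinear.bounded_linear_right[OF bounded_bilinear_matrix_mult])
  have ev: "\<forall>\<^sub>F H in at 0. invertible (A + H)"
  proof -
    have "((\<lambda>H. A + H) \<longlongrightarrow> A + 0) (at 0)" by (intro tendsto_intros)
    with A show ?thesis using topological_tendstoD[of _ A] open_invertible by fastforce
  qed
  have lim: "((\<lambda>H. norm (matrix_inv A) * norm (matrix_inv (A + H) - matrix_inv A)) \<longlongrightarrow> 0) (at 0)"
  proof -
    have "((\<lambda>H. matrix_inv (A + H)) \<longlongrightarrow> matrix_inv A) (at 0)"
      using LIM_offset_zero[OF continuous_matrix_inv[OF A, unfolded continuous_at]] .
    from tendsto_mult_right_zero[OF tendsto_norm_zero[OF LIM_zero[OF this]]]
    show ?thesis .
  qed
  show "((\<lambda>H. norm (matrix_inv (A + H) - matrix_inv A - ?D H) / norm H) \<longlongrightarrow> 0) (at 0)"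
  proof (rule Lim_null_comparison[OF _ lim])
    show "\<forall>\<^sub>F H in at 0. norm (norm (matrix_inv (A + H) - matrix_inv A - ?D H) / norm H)
            \<le> norm (matrix_inv A) * norm (matrix_inv (A + H) - matrix_inv A)"
      using ev
    proof eventually_elim
      fix H assume i: "invertible (A + H)"
      let ?B = "matrix_inv (A + H)"
      have AA: "matrix_inv A ** A ** X = X" for X
        using matrix_inv_left[OF A] by simp
      have AB: "(A + H) ** ?B = mat 1" by (rule matrix_inv_right[OF i])
      have "?B - matrix_inv A = matrix_inv A ** (A ** ?B - mat 1)"
        using AA[of ?B] by (simp add: matrix_simps)
      also have "A ** ?B - mat 1 = - (H ** ?B)"
        using AB by (simp add: matrix_simps algebra_simps)
      finally have e: "?B - matrix_inv A = - (matrix_inv A ** H ** ?B)" by (simp add: matrix_simps)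
      have "?B - matrix_inv A - ?D H = - (matrix_inv A ** H ** (?B - matrix_inv A))"
        by (subst e) (simp add: matrix_simps)
      hence "norm (?B - matrix_inv A - ?D H) \<le> norm (matrix_inv A) * norm H * norm (?B - matrix_inv A)"
        by (simp, intro order_trans[OF norm_matrix_mult_le] mult_right_mono norm_matrix_mult_le) simp
      thus "norm (norm (?B - matrix_inv A - ?D H) / norm H) \<le> norm (matrix_inv A) * norm (?B - matrix_inv A)"
        by (cases "H = 0") (auto simp: field_simps)
    qed
  qed
qed

lemmas has_vector_derivative_mmult =
  bounded_bilinear.has_vector_derivative[OF bounded_bilinear_matrix_mult]

lemmas has_vector_derivative_transpose =
  bounded_linear.has_vector_derivative[OF bounded_linear_transpose]

lemma has_vector_derivative_matrix_inv:
  fixes f :: "real \<Rightarrow> real^'n^'n"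
  assumes "(f has_vector_derivative f') (at t)" "invertible (f t)"
  shows "((\<lambda>s. matrix_inv (f s)) has_vector_derivative
           - (matrix_inv (f t) ** f' ** matrix_inv (f t))) (at t)"
  using has_derivative_compose[OF assms(1)[unfolded has_vector_derivative_def]
      has_derivative_matrix_inv[OF assms(2)]]
  by (simp add: has_vector_derivative_def matrix_simps)

section \<open>Uniqueness for linear differential equations\<close>

lemma has_real_derivative_inner_self:
  fixes f :: "real \<Rightarrow> 'a::real_inner"
  assumes "(f has_vector_derivative f') (at t)"
  shows "((\<lambda>s. f s \<bullet> f s) has_real_derivative 2 * (f t \<bullet> f')) (at t)"
  using bounded_bilinear.has_vector_derivative[OF bounded_bilinear_inner assms assms]
  by (simp add: has_real_derivative_iff_has_vector_derivative inner_commute)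

text \<open>Gronwall's argument: \<open>|f|\<^sup>2\<close> changes at a relative rate of at most \<open>2K\<close>, so
  \<open>|f|\<^sup>2 exp (-2Ks)\<close> decreases to the right of \<open>a\<close> and \<open>|f|\<^sup>2 exp (2Ks)\<close> increases to the left of it.
  All uniqueness statements and all conserved quantities below are reduced to this lemma.\<close>

lemma gronwall_zero:
  fixes f :: "real \<Rightarrow> 'a::real_inner"
  assumes S: "is_interval S" "a \<in> S" "t \<in> S" and 0: "f a = 0"
    and der: "\<And>s. s \<in> S \<Longrightarrow> (f has_vector_derivative f' s) (at s)"
    and bound: "\<And>s. s \<in> S \<Longrightarrow> norm (f' s) \<le> K * norm (f s)"
  shows "f t = 0"
proof -
  have ip: "\<bar>f s \<bullet> f' s\<bar> \<le> K * (f s \<bullet> f s)" if "s \<in> S" for s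
  proof -
    have "\<bar>f s \<bullet> f' s\<bar> \<le> norm (f s) * norm (f' s)" by (rule Cauchy_Schwarz_ineq2)
    also have "\<dots> \<le> norm (f s) * (K * norm (f s))" by (intro mult_left_mono bound that) simp
    finally show ?thesis by (simp add: dot_square_norm power2_eq_square algebra_simps)
  qed
  \<comment> \<open>\<open>c = - 2 K\<close> serves times after \<open>a\<close>, \<open>c = 2 K\<close> times before it.\<close>
  define \<phi> where "\<phi> = (\<lambda>c s. (f s \<bullet> f s) * exp (c * s))"
  have d: "(\<phi> c has_real_derivative (2 * (f s \<bullet> f' s) + c * (f s \<bullet> f s)) * exp (c * s)) (at s)"
    if "s \<in> S" for s c
    unfolding \<phi>_def
    by (rule derivative_eq_intros has_real_derivative_inner_self der that refl)+ (simp add: algebra_simps)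
  have between: "s \<in> S" if "min a t \<le> s" "s \<le> max a t" for s
    using S that unfolding is_interval_1 by (metis (no_types, lifting) max_def min_def)
  have "\<exists>c. \<phi> c t \<le> \<phi> c a"
  proof (cases "a \<le> t")
    case True
    have "\<phi> (- 2 * K) t \<le> \<phi> (- 2 * K) a"
    proof (rule DERIV_nonpos_imp_nonincreasing[OF True])
      fix s assume "a \<le> s" "s \<le> t"
      hence s: "s \<in> S" using between by simp
      show "\<exists>y. (\<phi> (- 2 * K) has_real_derivative y) (at s) \<and> y \<le> 0"
        using d[OF s] ip[OF s] by (intro exI conjI) (auto intro!: mult_nonpos_nonneg)
    qed
    thus ?thesis ..
  next
    case False
    have "\<phi> (2 * K) t \<le> \<phi> (2 * K) a"
    proof (rule DERIV_nonneg_imp_nondecreasing[of t a])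
      fix s assume "t \<le> s" "s \<le> a"
      hence s: "s \<in> S" using between by simp
      show "\<exists>y. (\<phi> (2 * K) has_real_derivative y) (at s) \<and> 0 \<le> y"
        using d[OF s] ip[OF s] by (intro exI conjI) (auto intro!: mult_nonneg_nonneg)
    qed (use False in simp)
    thus ?thesis ..
  qed
  then obtain c where "(f t \<bullet> f t) * exp (c * t) \<le> 0" unfolding \<phi>_def using 0 by auto
  thus ?thesis by (simp add: mult_le_0_iff) (metis exp_gt_zero inner_eq_zero_iff inner_ge_zero less_le_not_le order_antisym)
qed

lemma constant_on_interval:
  fixes f :: "real \<Rightarrow> 'a::real_inner"
  assumes "is_interval S" "a \<in> S" "t \<in> S" "\<And>s. s \<in> S \<Longrightarrow> (f has_vector_derivative 0) (at s)"
  shows "f t = f a"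
proof -
  have "f t - f a = 0"
    by (rule gronwall_zero[of S a t "\<lambda>s. f s - f a" "\<lambda>_. 0" 0])
       (auto intro!: derivative_eq_intros assms)
  thus ?thesis by simp
qed

section \<open>The entire functions csr and ssr, and their matrix versions\<close>

text \<open>Two holomorphic continuations agree at 0 because both are continuous there.\<close>

lemma entire_continuation_eqI:
  assumes "g holomorphic_on UNIV" "\<And>z. z \<noteq> 0 \<Longrightarrow> g z = f z"
  shows "entire_continuation f = g"
  unfolding entire_continuation_def
proof (rule the_equality)
  fix h assume h: "h holomorphic_on UNIV \<and> (\<forall>z. z \<noteq> 0 \<longrightarrow> h z = f z)"
  have "continuous_on UNIV h" "continuous_on UNIV g"
    using h assms(1) holomorphic_on_imp_continuous_on by blast+
  hence l: "h \<midarrow>0\<rightarrow> h 0" "g \<midarrow>0\<rightarrow> g 0"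
    by (auto simp: continuous_on_eq_continuous_at continuous_at)
  have "h \<midarrow>0\<rightarrow> g 0"
    using l(2) by (rule Lim_transform_eventually) (auto simp: eventually_at_filter h assms(2))
  hence "h 0 = g 0" using l(1) LIM_unique by blast
  thus "h = g" using h assms(2) by (metis ext)
qed (use assms in auto)

lemma taylor_coeff_entire_continuation:
  assumes "\<And>z. summable (\<lambda>i. complex_of_real (c i) * z ^ i)"
    and "\<And>z. z \<noteq> 0 \<Longrightarrow> (\<lambda>i. complex_of_real (c i) * z ^ i) sums f z"
  shows "taylor_coeff (entire_continuation f) i = c i"
proof -
  define F where "F = Abs_fps (\<lambda>i. complex_of_real (c i))"
  have r: "fps_conv_radius F = \<infinity>"
    unfolding fps_conv_radius_def F_def by (intro conv_radius_inftyI'') (simp add: assms(1))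
  have "entire_continuation f = eval_fps F"
  proof (rule entire_continuation_eqI)
    show "eval_fps F holomorphic_on UNIV"
      by (rule holomorphic_on_eval_fps) (simp add: r)
    show "eval_fps F z = f z" if "z \<noteq> 0" for z
      using sums_unique[OF assms(2)[OF that]] by (simp add: eval_fps_def F_def)
  qed
  thus ?thesis
    unfolding taylor_coeff_def using fps_nth_conv_deriv[of F i, symmetric] r by (simp add: F_def)
qed

lemma strict_mono_times2: "strict_mono (\<lambda>i::nat. 2 * i + k)"
  by (auto simp: strict_mono_def)

lemma not_in_range_times2:
  assumes "n \<notin> range (\<lambda>i::nat. 2 * i + k)" shows "n < k \<or> odd (n - k)"
proof (rule ccontr)
  assume "\<not> (n < k \<or> odd (n - k))"
  hence "n = 2 * ((n - k) div 2) + k" by auto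
  thus False using assms by blast
qed

text \<open>The even terms of the cosine series at \<open>csqrt z\<close> are the powers of \<open>z\<close>; likewise the odd terms of
  the sine series after division by \<open>csqrt z\<close>.\<close>

lemma taylor_coeff_csr: "taylor_coeff csr i = cos_coeff (2 * i)"
proof -
  have "(\<lambda>i. complex_of_real (cos_coeff (2 * i)) * z ^ i) sums cos (csqrt z)" for z
  proof -
    have "(\<lambda>i. cos_coeff (2 * i + 0) *\<^sub>R csqrt z ^ (2 * i + 0)) sums cos (csqrt z)"
      by (subst sums_mono_reindex[where g = "\<lambda>i. 2 * i + 0", OF strict_mono_times2])
         (auto dest!: not_in_range_times2 simp del: One_nat_def simp: cos_coeff_def intro: cos_converges[unfolded cos_coeff_def])
    thus ?thesis by (simp add: power_mult scaleR_conv_of_real)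
  qed
  thus ?thesis
    unfolding csr_def by (intro taylor_coeff_entire_continuation) (auto intro: sums_summable)
qed

lemma taylor_coeff_ssr: "taylor_coeff ssr i = sin_coeff (2 * i + 1)"
proof -
  have s: "(\<lambda>i. complex_of_real (sin_coeff (2 * i + 1)) * z ^ i) sums (sin (csqrt z) / csqrt z)"
    if "z \<noteq> 0" for z
  proof -
    have "(\<lambda>i. sin_coeff (2 * i + 1) *\<^sub>R csqrt z ^ (2 * i + 1)) sums sin (csqrt z)"
      by (subst sums_mono_reindex[where g = "\<lambda>i. 2 * i + 1", OF strict_mono_times2])
         (auto dest!: not_in_range_times2 simp del: One_nat_def simp: sin_coeff_def intro: sin_converges[unfolded sin_coeff_def])
    from sums_divide[OF this, of "csqrt z"] show ?thesis
      using that by (simp add: power_mult scaleR_conv_of_real)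
  qed
  have "summable (\<lambda>i. complex_of_real (sin_coeff (2 * i + 1)) * z ^ i)" for z
    using s[of z] by (cases "z = 0") (auto intro: sums_summable)
  thus ?thesis
    unfolding ssr_def by (intro taylor_coeff_entire_continuation s)
qed

text \<open>All matrix series needed here have the form \<open>\<Sum> c\<^sub>n t\<^sup>n D(\<lfloor>n/2\<rfloor>)\<close> with \<open>c\<^sub>n\<close> the coefficients of the
  cosine or of the sine: with \<open>D j = S\<^sup>j\<close> they are \<open>csr (t\<^sup>2 S)\<close> and \<open>t ssr (t\<^sup>2 S)\<close>.  Indexing them by
  the exponent of \<open>t\<close> makes them power series in \<open>t\<close>, for which differentiation just exchanges
  sine and cosine and shifts \<open>D\<close>.  Geometric growth of \<open>D\<close> suffices for convergence.\<close>

definition exp_bounded :: "(nat \<Rightarrow> 'a::real_normed_vector) \<Rightarrow> bool" where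
  "exp_bounded D \<longleftrightarrow> (\<exists>c K. \<forall>j. norm (D j) \<le> c * K ^ j)"

definition cos_sum :: "(nat \<Rightarrow> 'a::euclidean_space) \<Rightarrow> real \<Rightarrow> 'a" where
  "cos_sum D t = (\<Sum>n. (cos_coeff n * t ^ n) *\<^sub>R D (n div 2))"

definition sin_sum :: "(nat \<Rightarrow> 'a::euclidean_space) \<Rightarrow> real \<Rightarrow> 'a" where
  "sin_sum D t = (\<Sum>n. (sin_coeff n * t ^ n) *\<^sub>R D (n div 2))"

lemma exp_bounded_obtain:
  assumes "exp_bounded D"
  obtains c K where "c \<ge> 0" "K \<ge> 1" "\<And>j. norm (D j) \<le> c * K ^ j"
proof -
  obtain c K where cK: "\<And>j. norm (D j) \<le> c * K ^ j" using assms unfolding exp_bounded_def by blast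
  show thesis
  proof (rule that[of "\<bar>c\<bar>" "max 1 \<bar>K\<bar>"])
    fix j
    have "c * K ^ j \<le> \<bar>c\<bar> * \<bar>K\<bar> ^ j" by (metis abs_ge_self abs_mult power_abs)
    also have "\<dots> \<le> \<bar>c\<bar> * max 1 \<bar>K\<bar> ^ j" by (intro mult_left_mono power_mono) auto
    finally show "norm (D j) \<le> \<bar>c\<bar> * max 1 \<bar>K\<bar> ^ j" using cK[of j] by linarith
  qed auto
qed

lemma exp_bounded_Suc:
  assumes "exp_bounded D" shows "exp_bounded (\<lambda>j. D (Suc j))"
proof -
  obtain c K where "\<And>j. norm (D j) \<le> c * K ^ j" using assms unfolding exp_bounded_def by blast
  hence "norm (D (Suc j)) \<le> (c * K) * K ^ j" for j by (metis mult.assoc power_Suc)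
  thus ?thesis unfolding exp_bounded_def by blast
qed

lemma summable_exp_bounded:
  fixes D :: "nat \<Rightarrow> 'a::euclidean_space"
  assumes "exp_bounded D" "\<And>n. \<bar>a n\<bar> \<le> inverse (fact n)"
  shows "summable (\<lambda>n. (a n * t ^ n) *\<^sub>R D (n div 2))"
proof -
  obtain c K where cK: "c \<ge> 0" "K \<ge> 1" "\<And>j. norm (D j) \<le> c * K ^ j"
    using exp_bounded_obtain[OF assms(1)] by blast
  show ?thesis
  proof (rule summable_comparison_test'[of "\<lambda>n. c * (inverse (fact n) * (\<bar>t\<bar> * K) ^ n)" 0])
    show "summable (\<lambda>n. c * (inverse (fact n) * (\<bar>t\<bar> * K) ^ n))"
      by (intro summable_mult summable_exp)
    fix n :: nat
    have "norm (D (n div 2)) \<le> c * K ^ (n div 2)" by (rule cK)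
    also have "\<dots> \<le> c * K ^ n" using cK by (intro mult_left_mono power_increasing) auto
    finally have "norm ((a n * t ^ n) *\<^sub>R D (n div 2)) \<le> (\<bar>a n\<bar> * \<bar>t\<bar> ^ n) * (c * K ^ n)"
      by (auto simp: abs_mult power_abs intro!: mult_left_mono)
    also have "\<dots> \<le> (inverse (fact n) * \<bar>t\<bar> ^ n) * (c * K ^ n)"
      using cK assms(2) by (intro mult_right_mono) auto
    finally show "norm ((a n * t ^ n) *\<^sub>R D (n div 2)) \<le> c * (inverse (fact n) * (\<bar>t\<bar> * K) ^ n)"
      by (simp add: power_mult_distrib algebra_simps)
  qed
qed

lemma abs_cos_coeff_le: "\<bar>cos_coeff n\<bar> \<le> inverse (fact n)"
  and abs_sin_coeff_le: "\<bar>sin_coeff n\<bar> \<le> inverse (fact n)"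
  by (auto simp: cos_coeff_def sin_coeff_def field_simps)

lemma summable_cos_sum:
  fixes D :: "nat \<Rightarrow> 'a::euclidean_space"
  shows "exp_bounded D \<Longrightarrow> summable (\<lambda>n. (cos_coeff n * t ^ n) *\<^sub>R D (n div 2))"
  by (rule summable_exp_bounded[OF _ abs_cos_coeff_le])

lemma summable_sin_sum:
  fixes D :: "nat \<Rightarrow> 'a::euclidean_space"
  shows "exp_bounded D \<Longrightarrow> summable (\<lambda>n. (sin_coeff n * t ^ n) *\<^sub>R D (n div 2))"
  by (rule summable_exp_bounded[OF _ abs_sin_coeff_le])

text \<open>Termwise differentiation, reduced to scalar power series by taking coordinates.\<close>

lemma has_vector_derivative_power_series:
  fixes a :: "nat \<Rightarrow> 'a::euclidean_space"
  assumes f: "\<And>t. (\<lambda>n. t ^ n *\<^sub>R a n) sums f t"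
    and f': "\<And>t. (\<lambda>n. t ^ n *\<^sub>R (real (Suc n) *\<^sub>R a (Suc n))) sums f' t"
  shows "(f has_vector_derivative f' t) (at t)"
proof -
  have "((\<lambda>s. f s \<bullet> b) has_real_derivative f' t \<bullet> b) (at t)" for b
  proof -
    have 1: "(\<lambda>n. (a n \<bullet> b) * s ^ n) sums (f s \<bullet> b)" for s
      using bounded_linear.sums[OF bounded_linear_inner_left f[of s]] by (simp add: mult.commute)
    have 2: "(\<lambda>n. diffs (\<lambda>n. a n \<bullet> b) n * s ^ n) sums (f' s \<bullet> b)" for s
      using bounded_linear.sums[OF bounded_linear_inner_left f'[of s]]
      by (simp add: diffs_def mult.commute mult.left_commute)
    have "((\<lambda>s. \<Sum>n. (a n \<bullet> b) * s ^ n) has_real_derivative (\<Sum>n. diffs (\<lambda>n. a n \<bullet> b) n * t ^ n)) (at t)"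
      by (rule termdiffs_strong_converges_everywhere) (rule sums_summable[OF 1])
    thus ?thesis using sums_unique[OF 1] sums_unique[OF 2] by simp
  qed
  thus ?thesis
    unfolding has_vector_derivative_def
    by (subst has_derivative_componentwise_within)
       (auto simp: has_field_derivative_def mult.commute[of _ "_ \<bullet> _"])
qed

lemma has_vector_derivative_cos_sum:
  assumes "exp_bounded D"
  shows "(cos_sum D has_vector_derivative - sin_sum (\<lambda>j. D (Suc j)) t) (at t)"
proof (rule has_vector_derivative_power_series[where a = "\<lambda>n. cos_coeff n *\<^sub>R D (n div 2)"])
  show "(\<lambda>n. s ^ n *\<^sub>R cos_coeff n *\<^sub>R D (n div 2)) sums cos_sum D s" for s
    using summable_sums[OF summable_cos_sum[OF assms, of s]]
    by (simp add: cos_sum_def mult.commute)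
  have e: "- ((sin_coeff n * s ^ n) *\<^sub>R D (Suc (n div 2)))
        = s ^ n *\<^sub>R real (Suc n) *\<^sub>R cos_coeff (Suc n) *\<^sub>R D (Suc n div 2)" for n s
  proof -
    have "real (Suc n) * cos_coeff (Suc n) = - sin_coeff n"
      by (metis diffs_cos_coeff diffs_def of_nat_eq_id id_apply of_real_eq_id)
    moreover have "sin_coeff n = 0 \<or> Suc n div 2 = Suc (n div 2)"
      by (auto simp: sin_coeff_def elim: oddE)
    ultimately show ?thesis by (auto simp: mult.commute)
  qed
  show "(\<lambda>n. s ^ n *\<^sub>R real (Suc n) *\<^sub>R cos_coeff (Suc n) *\<^sub>R D (Suc n div 2))
          sums - sin_sum (\<lambda>j. D (Suc j)) s" for s
    using sums_minus[OF summable_sums[OF summable_sin_sum[OF exp_bounded_Suc[OF assms], of s]]]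
    unfolding e by (simp add: sin_sum_def)
qed

lemma has_vector_derivative_sin_sum:
  assumes "exp_bounded D"
  shows "(sin_sum D has_vector_derivative cos_sum D t) (at t)"
proof (rule has_vector_derivative_power_series[where a = "\<lambda>n. sin_coeff n *\<^sub>R D (n div 2)"])
  show "(\<lambda>n. s ^ n *\<^sub>R sin_coeff n *\<^sub>R D (n div 2)) sums sin_sum D s" for s
    using summable_sums[OF summable_sin_sum[OF assms, of s]]
    by (simp add: sin_sum_def mult.commute)
  have e: "(cos_coeff n * s ^ n) *\<^sub>R D (n div 2)
        = s ^ n *\<^sub>R real (Suc n) *\<^sub>R sin_coeff (Suc n) *\<^sub>R D (Suc n div 2)" for n s
  proof -
    have "real (Suc n) * sin_coeff (Suc n) = cos_coeff n"
      by (metis diffs_sin_coeff diffs_def of_nat_eq_id id_apply of_real_eq_id)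
    moreover have "cos_coeff n = 0 \<or> Suc n div 2 = n div 2"
      by (auto simp: cos_coeff_def)
    ultimately show ?thesis by (auto simp: mult.commute)
  qed
  show "(\<lambda>n. s ^ n *\<^sub>R real (Suc n) *\<^sub>R sin_coeff (Suc n) *\<^sub>R D (Suc n div 2)) sums cos_sum D s" for s
    using summable_sums[OF summable_cos_sum[OF assms, of s]] by (simp only: e cos_sum_def)
qed

lemma cos_sum_0: "cos_sum D 0 = D 0"
  unfolding cos_sum_def by (subst suminf_finite[of "{0}"]) (auto simp: cos_coeff_def)

lemma sin_sum_0: "sin_sum D 0 = 0"
  unfolding sin_sum_def by (subst suminf_finite[of "{0}"]) (auto simp: sin_coeff_def)

lemma sin_sum_add:
  "exp_bounded C \<Longrightarrow> exp_bounded D \<Longrightarrow> sin_sum (\<lambda>j. C j + D j) t = sin_sum C t + sin_sum D t"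
  unfolding sin_sum_def scaleR_add_right
  by (rule suminf_add[OF summable_sin_sum summable_sin_sum, symmetric])

lemma exp_bounded_linear:
  assumes "bounded_linear L" "exp_bounded D"
  shows "exp_bounded (\<lambda>j. L (D j))"
proof -
  obtain c K where D: "\<And>j. norm (D j) \<le> c * K ^ j"
    using assms(2) unfolding exp_bounded_def by blast
  obtain B where B: "B \<ge> 0" "\<And>x. norm (L x) \<le> norm x * B"
    using bounded_linear.nonneg_bounded[OF assms(1)] by blast
  have "norm (L (D j)) \<le> (c * B) * K ^ j" for j
    using order_trans[OF B(2) mult_right_mono[OF D B(1)]] by (simp add: algebra_simps)
  thus ?thesis unfolding exp_bounded_def by blast
qed

lemma sin_sum_linear:
  assumes "bounded_linear L" "exp_bounded D"
  shows "sin_sum (\<lambda>j. L (D j)) t = L (sin_sum D t)"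
  unfolding sin_sum_def
  by (simp add: bounded_linear.suminf[OF assms(1) summable_sin_sum[OF assms(2)]]
      linear_scale[OF bounded_linear.linear[OF assms(1)]])

lemma matpow_Suc_right: "matpow S (Suc k) = matpow S k ** S"
proof (induction k)
  case (Suc k)
  have "matpow S (Suc (Suc k)) = S ** (matpow S k ** S)" by (simp only: matpow.simps(2)[of S "Suc k"] Suc)
  thus ?case by (simp add: matrix_mul_assoc)
qed simp

lemma matpow_scaleR: "matpow (c *\<^sub>R S) k = c ^ k *\<^sub>R matpow S k"
  by (induction k) (auto simp: matrix_simps)

lemma norm_matpow: "norm (matpow S k) \<le> norm (mat 1 :: real^'p^'p) * norm (S :: real^'p^'p) ^ k"
proof (induction k)
  case (Suc k)
  have "norm (matpow S (Suc k)) \<le> norm S * norm (matpow S k)" by (simp add: norm_matrix_mult_le)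
  also have "\<dots> \<le> norm S * (norm (mat 1 :: real^'p^'p) * norm S ^ k)" by (intro mult_left_mono Suc) simp
  finally show ?case by (simp add: algebra_simps)
qed simp

lemma exp_bounded_matpow: "exp_bounded (matpow S)"
  unfolding exp_bounded_def using norm_matpow by blast

text \<open>\<open>dpow S E j\<close> is the derivative of \<open>S\<^sup>j\<close> in the direction \<open>E\<close>.  The Leibniz rule
  \<open>d(S\<^sup>j\<^sup>+\<^sup>1) = d(S\<^sup>j) S + S\<^sup>j E\<close> is taken as the definition because it is what the differential equation
  of the series with these coefficients needs.\<close>

fun dpow :: "real^'p^'p \<Rightarrow> real^'p^'p \<Rightarrow> nat \<Rightarrow> real^'p^'p" where
  "dpow S E 0 = 0"
| "dpow S E (Suc j) = dpow S E j ** S + matpow S j ** E"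

lemma dpow_Suc: "dpow S E (Suc i) = (\<Sum>(b, c)\<in>{(b, c). b + c = i}. matpow S b ** E ** matpow S c)"
proof -
  have set: "{(b, c). b + c = i} = (\<lambda>b. (b, i - b)) ` {..i}" for i :: nat by auto
  have "(\<Sum>(b, c)\<in>{(b, c). b + c = i}. matpow S b ** E ** matpow S c)
      = (\<Sum>b\<le>i. matpow S b ** E ** matpow S (i - b))" for i
    unfolding set by (subst sum.reindex) (auto simp: inj_on_def)
  moreover have "dpow S E (Suc i) = (\<Sum>b\<le>i. matpow S b ** E ** matpow S (i - b))"
  proof (induction i)
    case (Suc i)
    have "(\<Sum>b\<le>i. matpow S b ** E ** matpow S (Suc i - b))
        = (\<Sum>b\<le>i. matpow S b ** E ** matpow S (i - b)) ** S"
      by (subst bounded_bilinear.sum_left[OF bounded_bilinear_matrix_mult])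
         (auto intro!: sum.cong simp del: matpow.simps(2)
           simp: Suc_diff_le matpow_Suc_right matrix_mul_assoc)
    thus ?case using Suc by simp
  qed simp
  ultimately show ?thesis by simp
qed

lemma exp_bounded_dpow:
  fixes S E :: "real^'p^'p"
  shows "exp_bounded (dpow S E)"
proof -
  define c where "c = norm (mat 1 :: real^'p^'p) * norm E"
  have "norm (dpow S E j) \<le> c * (norm S + 1) ^ j" for j
  proof (induction j)
    case (Suc j)
    have "norm (dpow S E (Suc j)) \<le> norm (dpow S E j) * norm S + norm (matpow S j) * norm E"
      by (simp, intro order_trans[OF norm_triangle_ineq] add_mono norm_matrix_mult_le)
    also have "\<dots> \<le> (c * (norm S + 1) ^ j) * norm S + (norm (mat 1 :: real^'p^'p) * norm S ^ j) * norm E"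
      by (intro add_mono mult_right_mono Suc norm_matpow norm_ge_zero)
    also have "(norm (mat 1 :: real^'p^'p) * norm S ^ j) * norm E = c * norm S ^ j"
      by (simp add: c_def)
    also have "\<dots> \<le> c * (norm S + 1) ^ j"
      unfolding c_def by (intro mult_left_mono power_mono) auto
    finally show ?case by (simp add: algebra_simps)
  qed (simp add: c_def)
  thus ?thesis unfolding exp_bounded_def by blast
qed

lemma dpow_scaleR_sum:
  "(\<Sum>(b, c)\<in>{(b, c). b + c = i}. matpow (r *\<^sub>R S) b ** E ** matpow (r *\<^sub>R S) c) = r ^ i *\<^sub>R dpow S E (Suc i)"
  unfolding dpow_Suc scaleR_sum_right
  by (rule sum.cong) (auto simp: matpow_scaleR matrix_simps power_add)

lemma matfun_csr: "matfun csr (t\<^sup>2 *\<^sub>R S) = cos_sum (matpow S) t"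
proof -
  have "(\<lambda>i. (cos_coeff (2 * i + 0) * t ^ (2 * i + 0)) *\<^sub>R matpow S ((2 * i + 0) div 2)) sums cos_sum (matpow S) t"
    by (subst sums_mono_reindex[where g = "\<lambda>i. 2 * i + 0", OF strict_mono_times2])
       (auto dest!: not_in_range_times2 simp del: One_nat_def simp: cos_coeff_def cos_sum_def
         intro: summable_sums[OF summable_cos_sum[OF exp_bounded_matpow, unfolded cos_coeff_def]])
  hence "(\<lambda>i. taylor_coeff csr i *\<^sub>R matpow (t\<^sup>2 *\<^sub>R S) i) sums cos_sum (matpow S) t"
    by (simp add: taylor_coeff_csr matpow_scaleR power_mult)
  thus ?thesis unfolding matfun_def by (rule sums_unique[symmetric])
qed

text \<open>The formulas for \<open>ssr\<close> and for the Frechet derivatives carry a power of \<open>t\<close> in front; it can be moved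
  into the series at \<open>t = 0\<close> as well, where both sides vanish.\<close>

lemma scaleR_suminf_eqI:
  fixes f :: "nat \<Rightarrow> 'a::real_normed_vector"
  assumes "(\<lambda>i. c *\<^sub>R f i) sums s" "c = 0 \<Longrightarrow> s = 0"
  shows "c *\<^sub>R (\<Sum>i. f i) = s"
proof (cases "c = 0")
  case False
  hence "f sums (inverse c *\<^sub>R s)" using sums_scaleR_right[OF assms(1), of "inverse c"] by simp
  thus ?thesis using False by (simp flip: sums_unique)
qed (simp add: assms(2))

lemma matfun_ssr: "t *\<^sub>R matfun ssr (t\<^sup>2 *\<^sub>R S) = sin_sum (matpow S) t"
  unfolding matfun_def
proof (rule scaleR_suminf_eqI)
  have "(\<lambda>i. (sin_coeff (2 * i + 1) * t ^ (2 * i + 1)) *\<^sub>R matpow S ((2 * i + 1) div 2)) sums sin_sum (matpow S) t"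
    by (subst sums_mono_reindex[where g = "\<lambda>i. 2 * i + 1", OF strict_mono_times2])
       (auto dest!: not_in_range_times2 simp del: One_nat_def simp: sin_coeff_def sin_sum_def
         intro: summable_sums[OF summable_sin_sum[OF exp_bounded_matpow, unfolded sin_coeff_def]])
  thus "(\<lambda>i. t *\<^sub>R taylor_coeff ssr i *\<^sub>R matpow (t\<^sup>2 *\<^sub>R S) i) sums sin_sum (matpow S) t"
    by (simp add: taylor_coeff_ssr matpow_scaleR power_mult mult.assoc mult.left_commute)
qed (simp add: sin_sum_0)

lemma frechet_L_csr: "t\<^sup>2 *\<^sub>R frechet_L csr (t\<^sup>2 *\<^sub>R S) E = cos_sum (dpow S E) t"
  unfolding frechet_L_def
proof (rule scaleR_suminf_eqI)
  have "(\<lambda>i. (cos_coeff (2 * i + 2) * t ^ (2 * i + 2)) *\<^sub>R dpow S E ((2 * i + 2) div 2)) sums cos_sum (dpow S E) t"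
  proof (subst sums_mono_reindex[where g = "\<lambda>i. 2 * i + 2", OF strict_mono_times2])
    fix n :: nat assume "n \<notin> range (\<lambda>i. 2 * i + 2)"
    hence "n = 0 \<or> odd n" using not_in_range_times2[of n 2] by (cases "n = 1") auto
    thus "(cos_coeff n * t ^ n) *\<^sub>R dpow S E (n div 2) = 0" by (auto simp: cos_coeff_def)
  qed (simp add: cos_sum_def summable_sums summable_cos_sum exp_bounded_dpow)
  moreover have "t\<^sup>2 *\<^sub>R taylor_coeff csr (Suc i) *\<^sub>R
      (\<Sum>(b, c)\<in>{(b, c). b + c = i}. matpow (t\<^sup>2 *\<^sub>R S) b ** E ** matpow (t\<^sup>2 *\<^sub>R S) c)
      = (cos_coeff (2 * i + 2) * t ^ (2 * i + 2)) *\<^sub>R dpow S E ((2 * i + 2) div 2)" for i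
    unfolding dpow_scaleR_sum
    by (simp add: taylor_coeff_csr power_mult power2_eq_square mult.assoc mult.left_commute
        del: dpow.simps)
  ultimately show "(\<lambda>i. t\<^sup>2 *\<^sub>R taylor_coeff csr (Suc i) *\<^sub>R
      (\<Sum>(b, c)\<in>{(b, c). b + c = i}. matpow (t\<^sup>2 *\<^sub>R S) b ** E ** matpow (t\<^sup>2 *\<^sub>R S) c))
      sums cos_sum (dpow S E) t" by simp
qed (simp add: cos_sum_0)

lemma frechet_L_ssr: "t ^ 3 *\<^sub>R frechet_L ssr (t\<^sup>2 *\<^sub>R S) E = sin_sum (dpow S E) t"
  unfolding frechet_L_def
proof (rule scaleR_suminf_eqI)
  have "(\<lambda>i. (sin_coeff (2 * i + 3) * t ^ (2 * i + 3)) *\<^sub>R dpow S E ((2 * i + 3) div 2)) sums sin_sum (dpow S E) t"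
  proof (subst sums_mono_reindex[where g = "\<lambda>i. 2 * i + 3", OF strict_mono_times2])
    fix n :: nat assume "n \<notin> range (\<lambda>i. 2 * i + 3)"
    hence "n = 1 \<or> even n" using not_in_range_times2[of n 3] by (cases "n = 0 \<or> n = 2") auto
    thus "(sin_coeff n * t ^ n) *\<^sub>R dpow S E (n div 2) = 0" by (auto simp: sin_coeff_def)
  qed (simp add: sin_sum_def summable_sums summable_sin_sum exp_bounded_dpow)
  moreover have "t ^ 3 *\<^sub>R taylor_coeff ssr (Suc i) *\<^sub>R
      (\<Sum>(b, c)\<in>{(b, c). b + c = i}. matpow (t\<^sup>2 *\<^sub>R S) b ** E ** matpow (t\<^sup>2 *\<^sub>R S) c)
      = (sin_coeff (2 * i + 3) * t ^ (2 * i + 3)) *\<^sub>R dpow S E ((2 * i + 3) div 2)" for i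
  proof -
    have "(2 * i + 3) div 2 = Suc i" "2 * Suc i + 1 = 2 * i + 3" "\<And>a. t ^ 3 * (a * (t\<^sup>2) ^ i) = a * t ^ (2 * i + 3)"
      by (auto simp: power_mult power_add)
    thus ?thesis
      unfolding dpow_scaleR_sum taylor_coeff_ssr by (simp only: scaleR_scaleR)
  qed
  ultimately show "(\<lambda>i. t ^ 3 *\<^sub>R taylor_coeff ssr (Suc i) *\<^sub>R
      (\<Sum>(b, c)\<in>{(b, c). b + c = i}. matpow (t\<^sup>2 *\<^sub>R S) b ** E ** matpow (t\<^sup>2 *\<^sub>R S) c))
      sums sin_sum (dpow S E) t" by simp
qed (simp add: sin_sum_0)

lemma sin_sum_matpow_Suc: "sin_sum (\<lambda>j. matpow S (Suc j)) t = sin_sum (matpow S) t ** S"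
  unfolding matpow_Suc_right
  by (rule sin_sum_linear[OF bounded_bilinear.bounded_linear_left[OF bounded_bilinear_matrix_mult]
        exp_bounded_matpow])

lemma sin_sum_dpow_Suc:
  "sin_sum (\<lambda>j. dpow S E (Suc j)) t = sin_sum (dpow S E) t ** S + sin_sum (matpow S) t ** E"
  unfolding dpow.simps
  by (subst sin_sum_add)
     (simp_all add: exp_bounded_linear[OF bounded_bilinear.bounded_linear_left[OF bounded_bilinear_matrix_mult]]
        sin_sum_linear[OF bounded_bilinear.bounded_linear_left[OF bounded_bilinear_matrix_mult]]
        exp_bounded_matpow exp_bounded_dpow)

text \<open>Thus \<open>C = csr (t\<^sup>2 S)\<close> satisfies \<open>C'' = - C S\<close>, and its variation \<open>F\<close> in the direction \<open>E\<close> satisfies the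
  linearised equation \<open>F'' = - F S - C E\<close>.\<close>

lemma has_vector_derivative_cos_matpow:
  "(cos_sum (matpow S) has_vector_derivative - (sin_sum (matpow S) t ** S)) (at t)"
  using has_vector_derivative_cos_sum[OF exp_bounded_matpow] by (simp only: sin_sum_matpow_Suc)

lemma has_vector_derivative_cos_dpow:
  "(cos_sum (dpow S E) has_vector_derivative
     - (sin_sum (dpow S E) t ** S + sin_sum (matpow S) t ** E)) (at t)"
  using has_vector_derivative_cos_sum[OF exp_bounded_dpow] by (simp only: sin_sum_dpow_Suc)

lemmas matpow_series_derivatives =
  has_vector_derivative_cos_matpow has_vector_derivative_sin_sum[OF exp_bounded_matpow]
  has_vector_derivative_cos_dpow has_vector_derivative_sin_sum[OF exp_bounded_dpow]

section \<open>Horizontal geodesics of the Stiefel manifold\<close>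

lemma has_vector_derivative_unique_open:
  assumes "open T" "t \<in> T" "\<And>s. s \<in> T \<Longrightarrow> f s = g s"
    and "(f has_vector_derivative f') (at t)" "(g has_vector_derivative g') (at t)"
  shows "f' = g'"
proof (rule vector_derivative_unique_at[OF _ assms(5)])
  show "(g has_vector_derivative f') (at t)"
    using has_vector_derivative_transform_within_open[OF assms(4) assms(1,2)] assms(3) by blast
qed

lemmas hvd_rules = has_vector_derivative_add has_vector_derivative_diff has_vector_derivative_minus
  has_vector_derivative_mmult has_vector_derivative_transpose has_vector_derivative_const

lemmas hvd_eq = has_vector_derivative_eq_rhs

lemma velocityI: "(f has_vector_derivative f') (at t) \<Longrightarrow> velocity f t = f'"
  by (simp add: velocity_def vector_derivative_at)

lemma has_vector_derivative_velocity: "f differentiable (at t) \<Longrightarrow> (f has_vector_derivative velocity f t) (at t)"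
  by (simp add: velocity_def vector_derivative_works)

lemma differentiable_cong_open:
  fixes f g :: "real \<Rightarrow> 'a::real_normed_vector"
  assumes "open T" "t \<in> T" "\<And>s. s \<in> T \<Longrightarrow> f s = g s" "f differentiable (at t)"
  shows "g differentiable (at t)" and "velocity g t = velocity f t"
proof -
  have "(g has_vector_derivative velocity f t) (at t)"
    by (rule has_vector_derivative_transform_within_open[OF has_vector_derivative_velocity[OF assms(4)] assms(1,2,3)])
  thus "g differentiable (at t)" "velocity g t = velocity f t"
    by (auto intro: differentiableI_vector velocityI)
qed

lemma sym_skew_inner:
  fixes M N :: "real^'p^'p"
  assumes "transpose M = M" "transpose N = - N" shows "M \<bullet> N = 0"
  using inner_transpose[of M N] assms by simp

text \<open>The normal space at \<open>Y\<close> consists of the \<open>Y M\<close> with \<open>M\<close> symmetric: for tangent \<open>\<sigma>\<close> the matrix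
  \<open>Y\<^sup>T \<sigma>\<close> is skew, hence orthogonal to \<open>M\<close>.\<close>

lemma stiefel_proj_eq:
  assumes Y: "Y \<in> stiefel"
  shows "stiefel_proj Y \<omega> = \<omega> - (1/2) *\<^sub>R (Y ** (transpose Y ** \<omega> + transpose \<omega> ** Y))"
    (is "_ = ?\<tau>")
  unfolding stiefel_proj_def
proof (rule the_equality)
  have YY: "transpose Y ** Y = mat 1" "\<And>X. transpose Y ** (Y ** X) = X"
    using Y by (simp_all add: stiefel_def matrix_mul_assoc)
  let ?M = "transpose Y ** \<omega> + transpose \<omega> ** Y"
  have t: "?\<tau> \<in> stiefel_tangent Y"
    by (simp add: stiefel_tangent_def matrix_simps YY scaleR_half_double algebra_simps flip: scaleR_left_distrib)
  moreover have "trace_inner (\<omega> - ?\<tau>) \<sigma> = 0" if "\<sigma> \<in> stiefel_tangent Y" for \<sigma>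
  proof -
    have "(Y ** ?M) \<bullet> \<sigma> = ?M \<bullet> (transpose Y ** \<sigma>)" by (rule inner_matrix_mult_left)
    also have "\<dots> = 0"
      using that by (intro sym_skew_inner)
        (auto simp: stiefel_tangent_def matrix_simps eq_neg_iff_add_eq_0 algebra_simps)
    finally show ?thesis by (simp add: trace_inner_eq_inner)
  qed
  ultimately show "?\<tau> \<in> stiefel_tangent Y \<and> (\<forall>\<sigma>\<in>stiefel_tangent Y. trace_inner (\<omega> - ?\<tau>) \<sigma> = 0)"
    by blast
  fix \<tau> assume \<tau>: "\<tau> \<in> stiefel_tangent Y \<and> (\<forall>\<sigma>\<in>stiefel_tangent Y. trace_inner (\<omega> - \<tau>) \<sigma> = 0)"
  have d: "\<tau> - ?\<tau> \<in> stiefel_tangent Y"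
    using \<tau> t unfolding stiefel_tangent_def mem_Collect_eq matrix_simps by (simp add: algebra_simps)
  have "(\<tau> - ?\<tau>) \<bullet> (\<tau> - ?\<tau>) = trace_inner (\<omega> - ?\<tau>) (\<tau> - ?\<tau>) - trace_inner (\<omega> - \<tau>) (\<tau> - ?\<tau>)"
    by (simp add: trace_inner_eq_inner algebra_simps)
  also have "\<dots> = 0"
    using \<tau> d \<open>\<And>\<sigma>. \<sigma> \<in> stiefel_tangent Y \<Longrightarrow> trace_inner (\<omega> - ?\<tau>) \<sigma> = 0\<close> by simp
  finally show "\<tau> = ?\<tau>" by simp
qed

text \<open>This system governs the constraints of a solution of \<open>\<gamma>'' = - \<gamma> S\<close>, with \<open>q = \<gamma>\<^sup>T \<gamma> - 1\<close>, \<open>r = \<gamma>\<^sup>T \<gamma>'\<close>,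
  \<open>w = \<gamma>'\<^sup>T \<gamma>' - S\<close>.  Being linear, it equally governs the linearised constraints along a variation
  of such solutions, and is used for both.\<close>

lemma first_integrals_vanish:
  fixes S :: "real^'p^'p" and q r w :: "real \<Rightarrow> real^'p^'p"
  assumes T: "is_interval T" "0 \<in> T" "t \<in> T" and 0: "q 0 = 0" "r 0 = 0" "w 0 = 0"
    and q: "\<And>s. s \<in> T \<Longrightarrow> (q has_vector_derivative r s + transpose (r s)) (at s)"
    and r: "\<And>s. s \<in> T \<Longrightarrow> (r has_vector_derivative w s - q s ** S) (at s)"
    and w: "\<And>s. s \<in> T \<Longrightarrow> (w has_vector_derivative - (S ** r s) - transpose (r s) ** S) (at s)"
  shows "q t = 0 \<and> r t = 0 \<and> w t = 0"
proof -
  define L where "L = (\<lambda>(q :: real^'p^'p, r :: real^'p^'p, w :: real^'p^'p). (r + transpose r, w - q ** S, - (S ** r) - transpose r ** S))"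
  have "bounded_linear L"
    unfolding linear_conv_bounded_linear[symmetric] L_def
    by (rule linearI) (auto simp: matrix_simps algebra_simps)
  then obtain K where K: "\<And>x. norm (L x) \<le> norm x * K" using bounded_linear.bounded by blast
  have "(q t, r t, w t) = 0"
  proof (rule gronwall_zero[OF T])
    show "((\<lambda>s. (q s, r s, w s)) has_vector_derivative L (q s, r s, w s)) (at s)" if "s \<in> T" for s
      unfolding L_def using q[OF that] r[OF that] w[OF that]
      by (auto intro!: has_vector_derivative_Pair)
    show "norm (L (q s, r s, w s)) \<le> K * norm (q s, r s, w s)" for s
      using K by (simp add: mult.commute)
  qed (simp add: 0 zero_prod_def)
  thus ?thesis by (simp add: zero_prod_def)
qed

lemma second_order_linear_unique:
  fixes S :: "real^'p^'p" and c c\<^sub>1 :: "real \<Rightarrow> real^'p^'n"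
  assumes T: "is_interval T" "0 \<in> T" "t \<in> T" and 0: "c 0 = c\<^sub>1 0" "v 0 = v\<^sub>1 0"
    and c: "\<And>s. s \<in> T \<Longrightarrow> (c has_vector_derivative v s) (at s)"
    and v: "\<And>s. s \<in> T \<Longrightarrow> (v has_vector_derivative - (c s ** S)) (at s)"
    and c1: "\<And>s. s \<in> T \<Longrightarrow> (c\<^sub>1 has_vector_derivative v\<^sub>1 s) (at s)"
    and v1: "\<And>s. s \<in> T \<Longrightarrow> (v\<^sub>1 has_vector_derivative - (c\<^sub>1 s ** S)) (at s)"
  shows "c t = c\<^sub>1 t"
proof -
  define L where "L = (\<lambda>(x :: real^'p^'n, y :: real^'p^'n). (y, - (x ** S)))"
  have "bounded_linear L"
    unfolding linear_conv_bounded_linear[symmetric] L_def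
    by (rule linearI) (auto simp: matrix_simps algebra_simps)
  then obtain K where K: "\<And>x. norm (L x) \<le> norm x * K" using bounded_linear.bounded by blast
  have "(c t - c\<^sub>1 t, v t - v\<^sub>1 t) = 0"
  proof (rule gronwall_zero[OF T])
    show "((\<lambda>s. (c s - c\<^sub>1 s, v s - v\<^sub>1 s)) has_vector_derivative L (c s - c\<^sub>1 s, v s - v\<^sub>1 s)) (at s)"
      if "s \<in> T" for s
      unfolding L_def using has_vector_derivative_diff[OF c[OF that] c1[OF that]]
        has_vector_derivative_diff[OF v[OF that] v1[OF that]]
      by (auto intro!: has_vector_derivative_Pair simp: matrix_simps)
    show "norm (L (c s - c\<^sub>1 s, v s - v\<^sub>1 s)) \<le> K * norm (c s - c\<^sub>1 s, v s - v\<^sub>1 s)" for s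
      using K by (simp add: mult.commute)
  qed (simp add: 0 zero_prod_def)
  thus ?thesis by (simp add: zero_prod_def)
qed

text \<open>The solution of \<open>\<gamma>'' = - \<gamma> \<eta>\<^sup>T \<eta>\<close> with initial data \<open>(Y, \<eta>)\<close>, and its velocity.\<close>

definition hgeo :: "real^'p^'n \<Rightarrow> real^'p^'n \<Rightarrow> real \<Rightarrow> real^'p^'n" where
  "hgeo Y \<eta> t = Y ** cos_sum (matpow (transpose \<eta> ** \<eta>)) t + \<eta> ** sin_sum (matpow (transpose \<eta> ** \<eta>)) t"

definition hgeo_vel :: "real^'p^'n \<Rightarrow> real^'p^'n \<Rightarrow> real \<Rightarrow> real^'p^'n" where
  "hgeo_vel Y \<eta> t = \<eta> ** cos_sum (matpow (transpose \<eta> ** \<eta>)) t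
     - Y ** (sin_sum (matpow (transpose \<eta> ** \<eta>)) t ** (transpose \<eta> ** \<eta>))"

lemma hgeo_0 [simp]: "hgeo Y \<eta> 0 = Y" and hgeo_vel_0 [simp]: "hgeo_vel Y \<eta> 0 = \<eta>"
  by (simp_all add: hgeo_def hgeo_vel_def cos_sum_0 sin_sum_0)

lemma hgeo_derivative: "(hgeo Y \<eta> has_vector_derivative hgeo_vel Y \<eta> t) (at t)"
  and hgeo_vel_derivative:
    "(hgeo_vel Y \<eta> has_vector_derivative - (hgeo Y \<eta> t ** (transpose \<eta> ** \<eta>))) (at t)"
proof -
  let ?S = "transpose \<eta> ** \<eta>"
  show "(hgeo Y \<eta> has_vector_derivative hgeo_vel Y \<eta> t) (at t)"
    unfolding hgeo_def[abs_def] hgeo_vel_def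
    by (rule hvd_eq, (rule hvd_rules matpow_series_derivatives)+) (simp add: matrix_simps algebra_simps)
  show "(hgeo_vel Y \<eta> has_vector_derivative - (hgeo Y \<eta> t ** ?S)) (at t)"
    unfolding hgeo_def hgeo_vel_def[abs_def]
    by (rule hvd_eq, (rule hvd_rules matpow_series_derivatives)+) (simp add: matrix_simps algebra_simps)
qed

lemma velocity_hgeo: "velocity (hgeo Y \<eta>) = hgeo_vel Y \<eta>"
  using velocityI[OF hgeo_derivative] by blast

lemma hgeo_first_integrals:
  assumes "Y \<in> stiefel" "\<eta> \<in> horizontal Y"
  shows "transpose (hgeo Y \<eta> t) ** hgeo Y \<eta> t = mat 1"
    and "transpose (hgeo Y \<eta> t) ** hgeo_vel Y \<eta> t = 0"
    and "transpose (hgeo_vel Y \<eta> t) ** hgeo_vel Y \<eta> t = transpose \<eta> ** \<eta>"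
proof -
  let ?S = "transpose \<eta> ** \<eta>" and ?g = "hgeo Y \<eta>" and ?k = "hgeo_vel Y \<eta>"
  note g = hgeo_derivative[of Y \<eta>] and k = hgeo_vel_derivative[of Y \<eta>]
  have "transpose (?g t) ** ?g t - mat 1 = 0 \<and> transpose (?g t) ** ?k t = 0 \<and> transpose (?k t) ** ?k t - ?S = 0"
  proof (rule first_integrals_vanish[where T = UNIV and S = ?S])
    show "((\<lambda>s. transpose (?g s) ** ?g s - mat 1) has_vector_derivative
        transpose (?g s) ** ?k s + transpose (transpose (?g s) ** ?k s)) (at s)" for s
      by (rule hvd_eq, (rule hvd_rules g k)+) (simp add: matrix_simps)
    show "((\<lambda>s. transpose (?g s) ** ?k s) has_vector_derivative
        (transpose (?k s) ** ?k s - ?S) - (transpose (?g s) ** ?g s - mat 1) ** ?S) (at s)" for s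
      by (rule hvd_eq, (rule hvd_rules g k)+) (simp add: matrix_simps)
    show "((\<lambda>s. transpose (?k s) ** ?k s - ?S) has_vector_derivative
        - (?S ** (transpose (?g s) ** ?k s)) - transpose (transpose (?g s) ** ?k s) ** ?S) (at s)" for s
      by (rule hvd_eq, (rule hvd_rules g k)+) (simp add: matrix_simps)
  qed (use assms in \<open>simp_all add: stiefel_def horizontal_def\<close>)
  thus "transpose (?g t) ** ?g t = mat 1" "transpose (?g t) ** ?k t = 0" "transpose (?k t) ** ?k t = ?S"
    by auto
qed

lemma hgeo_in_stiefel: "Y \<in> stiefel \<Longrightarrow> \<eta> \<in> horizontal Y \<Longrightarrow> hgeo Y \<eta> t \<in> stiefel"
  by (simp add: stiefel_def hgeo_first_integrals)

lemma hgeo_geodesic: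
  assumes "Y \<in> stiefel" "\<eta> \<in> horizontal Y"
  shows "stiefel_geodesic_on UNIV (hgeo Y \<eta>)"
proof -
  let ?S = "transpose \<eta> ** \<eta>"
  have "stiefel_proj (hgeo Y \<eta> t) (- (hgeo Y \<eta> t ** ?S)) = 0" for t
  proof -
    let ?g = "hgeo Y \<eta> t"
    have gg: "transpose ?g ** ?g = mat 1" "\<And>X. transpose ?g ** (?g ** X) = X"
      using hgeo_first_integrals(1)[OF assms] by (simp_all add: matrix_mul_assoc)
    have "stiefel_proj ?g (- (?g ** ?S)) = - (?g ** ?S) - (1/2) *\<^sub>R (?g ** (- ?S - ?S))"
      unfolding stiefel_proj_eq[OF hgeo_in_stiefel[OF assms]] by (simp add: matrix_simps gg)
    also have "- ?S - ?S = (- 2) *\<^sub>R ?S" by (simp add: scaleR_2)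
    finally show ?thesis by (simp add: matrix_simps)
  qed
  thus ?thesis
    unfolding stiefel_geodesic_on_def stiefel_cov_deriv_def velocity_hgeo
    using hgeo_in_stiefel[OF assms] velocityI[OF hgeo_vel_derivative]
      differentiableI_vector[OF hgeo_derivative] differentiableI_vector[OF hgeo_vel_derivative]
    by metis
qed

text \<open>Let \<open>v = c'\<close>.  The geodesic equation says that \<open>c''\<close> is normal, and differentiating \<open>c\<^sup>T c = 1\<close> twice
  identifies it as \<open>- c v\<^sup>T v\<close>.  Then \<open>c\<^sup>T v\<close> is constant, hence 0 by horizontality, and therefore
  \<open>v\<^sup>T v\<close> is constant too.  So \<open>c\<close> solves the linear equation that defines \<open>hgeo\<close>.\<close>

lemma stiefel_geodesic_horizontal_unique:
  assumes T: "open_interval T" "0 \<in> T" "t \<in> T" and c: "stiefel_geodesic_on T c"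
    and 0: "c 0 = Y" "velocity c 0 = \<eta>" and h: "\<eta> \<in> horizontal Y"
  shows "c t = hgeo Y \<eta> t"
proof -
  have T': "open T" "is_interval T" using T by (auto simp: open_interval_def)
  define v where "v = velocity c"
  define a where "a = velocity v"
  have cc: "transpose (c s) ** c s = mat 1"
    and c': "(c has_vector_derivative v s) (at s)" and v': "(v has_vector_derivative a s) (at s)"
    and acc: "a s = (1/2) *\<^sub>R (c s ** (transpose (c s) ** a s + transpose (a s) ** c s))" if "s \<in> T" for s
    using c that stiefel_proj_eq[of "c s"]
    by (auto simp: stiefel_geodesic_on_def v_def a_def stiefel_def stiefel_cov_deriv_def has_vector_derivative_velocity)
  have cv: "transpose (c s) ** v s + transpose (v s) ** c s = 0" if s: "s \<in> T" for s
    by (rule has_vector_derivative_unique_open[OF T'(1) s, where f = "\<lambda>s. transpose (c s) ** c s" and g = "\<lambda>_. mat 1", OF cc])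
       (assumption | rule hvd_rules c' s)+
  \<comment> \<open>The second derivative of \<open>c\<^sup>T c = 1\<close>.\<close>
  have "(transpose (c s) ** a s + transpose (v s) ** v s) + (transpose (v s) ** v s + transpose (a s) ** c s) = 0"
    if s: "s \<in> T" for s
    by (rule has_vector_derivative_unique_open[OF T'(1) s,
          where f = "\<lambda>s. transpose (c s) ** v s + transpose (v s) ** c s" and g = "\<lambda>_. 0", OF cv])
       (assumption | rule hvd_rules c' v' s)+
  hence "transpose (c s) ** a s + transpose (a s) ** c s = - 2 *\<^sub>R (transpose (v s) ** v s)" if "s \<in> T" for s
    using that by (simp add: scaleR_2 eq_neg_iff_add_eq_0 algebra_simps)
  hence a: "a s = - (c s ** (transpose (v s) ** v s))" if "s \<in> T" for s
    using acc[OF that] that by (simp add: matrix_simps)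
  have A: "transpose (c s) ** v s = 0" if "s \<in> T" for s
  proof -
    have "transpose (c s) ** v s = transpose (c 0) ** v 0"
    proof (rule constant_on_interval[OF T'(2) T(2) that])
      fix s assume s: "s \<in> T"
      have "((\<lambda>s. transpose (c s) ** v s) has_vector_derivative transpose (c s) ** a s + transpose (v s) ** v s) (at s)"
        by (rule hvd_rules c' v' s)+
      thus "((\<lambda>s. transpose (c s) ** v s) has_vector_derivative 0) (at s)"
        using cc[OF s] by (simp add: a[OF s] matrix_simps) (simp add: matrix_mul_assoc)
    qed
    thus ?thesis using 0 h by (simp add: v_def horizontal_def)
  qed
  have B: "transpose (v s) ** v s = transpose \<eta> ** \<eta>" if "s \<in> T" for s
  proof -
    have "transpose (v s) ** v s = transpose (v 0) ** v 0"
    proof (rule constant_on_interval[OF T'(2) T(2) that])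
      fix s assume s: "s \<in> T"
      have "((\<lambda>s. transpose (v s) ** v s) has_vector_derivative transpose (v s) ** a s + transpose (a s) ** v s) (at s)"
        by (rule hvd_rules c' v' s)+
      moreover have "transpose (v s) ** (c s ** X) = 0" for X :: "real^'a^'a"
        using arg_cong[OF A[OF s], of "\<lambda>Z. transpose Z ** X"] by (simp add: matrix_simps)
      moreover have "transpose (c s) ** v s = 0" by (rule A[OF s])
      ultimately show "((\<lambda>s. transpose (v s) ** v s) has_vector_derivative 0) (at s)"
        by (simp add: a[OF s] matrix_simps)
    qed
    thus ?thesis using 0 by (simp add: v_def)
  qed
  show ?thesis
    by (rule second_order_linear_unique[OF T'(2) T(2,3), where S = "transpose \<eta> ** \<eta>" and v = v and v\<^sub>1 = "hgeo_vel Y \<eta>"])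
       (use 0 c' v' in \<open>auto simp: v_def[symmetric] a B hgeo_derivative hgeo_vel_derivative\<close>)
qed

lemma stiefel_exp_horizontal:
  assumes "Y \<in> stiefel" "\<eta> \<in> horizontal Y"
  shows "stiefel_exp Y \<eta> = hgeo Y \<eta> 1"
  unfolding stiefel_exp_def
proof (rule the_equality)
  show "\<exists>S c. open_interval S \<and> {0..1} \<subseteq> S \<and> stiefel_geodesic_on S c \<and> c 0 = Y \<and> velocity c 0 = \<eta> \<and> c 1 = hgeo Y \<eta> 1"
    by (intro exI[of _ UNIV] exI[of _ "hgeo Y \<eta>"])
       (use hgeo_geodesic[OF assms] in \<open>simp add: open_interval_def velocity_hgeo\<close>)
  show "Z = hgeo Y \<eta> 1"
    if Z: "\<exists>S c. open_interval S \<and> {0..1} \<subseteq> S \<and> stiefel_geodesic_on S c \<and> c 0 = Y \<and> velocity c 0 = \<eta> \<and> c 1 = Z" for Z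
  proof -
    obtain S c where "open_interval S" "{0..1} \<subseteq> S" "stiefel_geodesic_on S c" "c 0 = Y"
        "velocity c 0 = \<eta>" "c 1 = Z" using Z by blast
    moreover from this have "0 \<in> S" "1 \<in> S" by auto
    ultimately show ?thesis using stiefel_geodesic_horizontal_unique[of S 1 c Y \<eta>] assms(2) by blast
  qed
qed

lemma hgeo_eq_matfun:
  "hgeo Y \<eta> t = Y ** matfun csr (t\<^sup>2 *\<^sub>R (transpose \<eta> ** \<eta>)) + t *\<^sub>R (\<eta> ** matfun ssr (t\<^sup>2 *\<^sub>R (transpose \<eta> ** \<eta>)))"
proof -
  have "\<eta> ** sin_sum (matpow (transpose \<eta> ** \<eta>)) t
      = t *\<^sub>R (\<eta> ** matfun ssr (t\<^sup>2 *\<^sub>R (transpose \<eta> ** \<eta>)))"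
    unfolding matfun_ssr[symmetric] by (rule bounded_bilinear.scaleR_right[OF bounded_bilinear_matrix_mult])
  thus ?thesis by (simp only: hgeo_def matfun_csr)
qed

lemma stiefel_exp_scaleR_horizontal:
  assumes "Y \<in> stiefel" "\<eta> \<in> horizontal Y"
  shows "stiefel_exp Y (t *\<^sub>R \<eta>) = hgeo Y \<eta> t"
proof -
  have "t *\<^sub>R \<eta> \<in> horizontal Y" using assms by (simp add: horizontal_def matrix_simps)
  from stiefel_exp_horizontal[OF assms(1) this]
  have "stiefel_exp Y (t *\<^sub>R \<eta>) = hgeo Y (t *\<^sub>R \<eta>) 1" .
  moreover have "transpose (t *\<^sub>R \<eta>) ** (t *\<^sub>R \<eta>) = t\<^sup>2 *\<^sub>R (transpose \<eta> ** \<eta>)"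
    by (simp add: matrix_simps power2_eq_square)
  ultimately show ?thesis by (simp add: hgeo_eq_matfun) (simp add: matrix_simps)
qed

section \<open>Charts of the Grassmann manifold\<close>

lemma gr_q_mult_orthogonal:
  assumes "orthogonal_matrix Q" shows "gr_q (Z ** Q) = gr_q Z"
proof -
  have "Z ** Q' \<in> gr_q (Z ** Q)" if "orthogonal_matrix Q'" for Q'
  proof -
    have "Z ** Q' = Z ** (Q ** transpose Q) ** Q'"
      using assms by (simp add: orthogonal_matrix_def)
    hence "Z ** Q' = (Z ** Q) ** (transpose Q ** Q')" by (simp only: matrix_mul_assoc)
    thus ?thesis
      unfolding gr_q_def using assms that orthogonal_matrix_mul orthogonal_matrix_transpose by blast
  qed
  moreover have "(Z ** Q) ** Q' \<in> gr_q Z" if "orthogonal_matrix Q'" for Q'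
    unfolding gr_q_def matrix_mul_assoc[symmetric] using assms that orthogonal_matrix_mul by blast
  ultimately show ?thesis by (auto simp: gr_q_def[of "Z ** Q"] gr_q_def[of Z])
qed

lemma gr_q_self: "Z \<in> gr_q Z"
  unfolding gr_q_def using orthogonal_matrix_id by (metis (mono_tags, lifting) matrix_mul_rid mem_Collect_eq)

lemma gr_q_eqD: "gr_q Z' = gr_q Z \<Longrightarrow> \<exists>Q. orthogonal_matrix Q \<and> Z' = Z ** Q"
  using gr_q_self[of Z'] unfolding gr_q_def by auto

lemma invertible_orthogonal: "orthogonal_matrix Q \<Longrightarrow> invertible Q"
  by (auto simp: orthogonal_matrix_def invertible_def)

lemma gr_dom_iff:
  assumes "Z \<in> stiefel" shows "gr_q Z \<in> gr_dom B \<longleftrightarrow> invertible (transpose B ** Z)"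
proof
  assume "gr_q Z \<in> gr_dom B"
  then obtain Z' where "Z' \<in> stiefel" "invertible (transpose B ** Z')" "gr_q Z = gr_q Z'"
    unfolding gr_dom_def by blast
  moreover from this obtain Q where "orthogonal_matrix Q" "Z = Z' ** Q" using gr_q_eqD by blast
  ultimately show "invertible (transpose B ** Z)"
    by (simp add: matrix_mul_assoc invertible_mult invertible_orthogonal)
qed (use assms in \<open>auto simp: gr_dom_def\<close>)

text \<open>Independence of the representative: \<open>Z Q (Y\<^sup>T Z Q)\<^sup>-\<^sup>1 = Z (Y\<^sup>T Z)\<^sup>-\<^sup>1\<close>.\<close>

lemma gr_chart_eq:
  assumes "invertible (transpose B ** Z)"
  shows "gr_chart B (gr_q Z) = Z ** matrix_inv (transpose B ** Z) - B"
proof -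
  let ?a = "transpose B ** Z"
  have "Z ** Q ** matrix_inv (transpose B ** (Z ** Q)) = Z ** matrix_inv ?a" if Q: "orthogonal_matrix Q" for Q
  proof -
    have "(?a ** Q) ** (transpose Q ** matrix_inv ?a) = ?a ** (Q ** transpose Q) ** matrix_inv ?a"
      by (simp only: matrix_mul_assoc)
    also have "\<dots> = mat 1"
      using Q assms by (simp add: orthogonal_matrix_def matrix_inv_right)
    finally have "matrix_inv (?a ** Q) = transpose Q ** matrix_inv ?a"
      by (rule matrix_inv_unique(1))
    hence "matrix_inv (transpose B ** (Z ** Q)) = transpose Q ** matrix_inv ?a"
      by (simp only: matrix_mul_assoc)
    hence "Z ** Q ** matrix_inv (transpose B ** (Z ** Q)) = Z ** (Q ** transpose Q) ** matrix_inv ?a"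
      by (simp only: matrix_mul_assoc)
    thus ?thesis using Q by (simp add: orthogonal_matrix_def)
  qed
  hence e: "X ** matrix_inv (transpose B ** X) - B = Z ** matrix_inv ?a - B" if "X \<in> gr_q Z" for X
    using that unfolding gr_q_def by auto
  show ?thesis
    unfolding gr_chart_def
  proof (rule the_equality)
    show "\<forall>X\<in>gr_q Z. Z ** matrix_inv ?a - B = X ** matrix_inv (transpose B ** X) - B" using e by simp
    show "x = Z ** matrix_inv ?a - B" if "\<forall>X\<in>gr_q Z. x = X ** matrix_inv (transpose B ** X) - B" for x
      using that gr_q_self by blast
  qed
qed

text \<open>\<open>chart_diff B Z\<close> is the differential at \<open>Z\<close> of the quotient map read in the chart centred at \<open>B\<close>.
  It kills the matrices \<open>Z X\<close>, and \<open>chart_lift B Z\<close> inverts it on horizontal vectors.\<close>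

definition chart_diff :: "real^'p^'n \<Rightarrow> real^'p^'n \<Rightarrow> real^'p^'n \<Rightarrow> real^'p^'n" where
  "chart_diff B Z w = (w - Z ** (matrix_inv (transpose B ** Z) ** (transpose B ** w))) ** matrix_inv (transpose B ** Z)"

definition chart_lift :: "real^'p^'n \<Rightarrow> real^'p^'n \<Rightarrow> real^'p^'n \<Rightarrow> real^'p^'n" where
  "chart_lift B Z u = (u - Z ** (transpose Z ** u)) ** (transpose B ** Z)"

lemma has_derivative_gr_chart:
  fixes B Z :: "real^'p^'n"
  assumes i: "invertible (transpose B ** Z)"
  shows "((\<lambda>X. gr_chart B (gr_q X)) has_derivative chart_diff B Z) (at Z)"
proof -
  let ?T = "{X :: real^'p^'n. invertible (transpose B ** X)}"
  have "open ((\<lambda>X :: real^'p^'n. transpose B ** X) -` {A. invertible A})"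
    by (intro open_vimage open_invertible
        linear_continuous_on[OF bounded_bilinear.bounded_linear_right[OF bounded_bilinear_matrix_mult]])
  hence T: "open ?T" by (simp add: vimage_def)
  have l: "((\<lambda>X. transpose B ** X) has_derivative (\<lambda>X. transpose B ** X)) (at Z)"
    by (rule bounded_linear_imp_has_derivative[OF bounded_bilinear.bounded_linear_right[OF bounded_bilinear_matrix_mult]])
  have "((\<lambda>X. X ** matrix_inv (transpose B ** X) - B) has_derivative chart_diff B Z) (at Z)"
    by (rule has_derivative_eq_rhs, rule has_derivative_diff[OF
        bounded_bilinear.FDERIV[OF bounded_bilinear_matrix_mult has_derivative_ident
          has_derivative_compose[OF l has_derivative_matrix_inv[OF i]]] has_derivative_const])
       (auto simp: chart_diff_def matrix_simps fun_eq_iff)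
  from has_derivative_transform_within_open[OF this T] i show ?thesis
    by (simp add: gr_chart_eq)
qed

lemma gr_dq_eq:
  assumes "Z \<in> stiefel"
  shows "gr_dq Z w B = (if B \<in> stiefel \<and> invertible (transpose B ** Z) then chart_diff B Z w else 0)"
  unfolding gr_dq_def gr_dom_iff[OF assms]
  using frechet_derivative_at[OF has_derivative_gr_chart[of B Z]] by auto

text \<open>A point \<open>Z\<close> over the chart domain centred at \<open>B\<close>.  The identity behind all computations is
  \<open>Z = (B + x) a\<close>, which gives \<open>(1 + x\<^sup>T x)\<^sup>-\<^sup>1 = a a\<^sup>T\<close>.\<close>

locale chart_point =
  fixes B Z :: "real^'p^'n" and a b x
  assumes B: "B \<in> stiefel" and Z: "Z \<in> stiefel" and i: "invertible (transpose B ** Z)"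
  defines "a \<equiv> transpose B ** Z" and "b \<equiv> matrix_inv (transpose B ** Z)"
    and "x \<equiv> gr_chart B (gr_q Z)"
begin

lemma ab: "a ** b = mat 1" "b ** a = mat 1" "a ** (b ** X) = X" "b ** (a ** X) = X"
  and ab_transpose: "transpose b ** transpose a = mat 1" "transpose a ** transpose b = mat 1"
    "transpose b ** (transpose a ** X) = X" "transpose a ** (transpose b ** X) = X"
proof -
  show *: "a ** b = mat 1" "b ** a = mat 1"
    using matrix_inv_right[OF i] matrix_inv_left[OF i] by (simp_all add: a_def b_def)
  thus "a ** (b ** X) = X" "b ** (a ** X) = X" by (simp_all add: matrix_mul_assoc)
  show **: "transpose b ** transpose a = mat 1" "transpose a ** transpose b = mat 1"
    by (simp_all add: * flip: matrix_transpose_mul)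
  thus "transpose b ** (transpose a ** X) = X" "transpose a ** (transpose b ** X) = X"
    by (simp_all add: matrix_mul_assoc)
qed

lemma ZZ: "transpose Z ** Z = mat 1" "transpose Z ** (Z ** X) = X"
  and BB: "transpose B ** B = mat 1" "transpose B ** (B ** X) = X"
  using B Z by (simp_all add: stiefel_def matrix_mul_assoc)

lemma BZ: "transpose B ** Z = a" "transpose B ** (Z ** X) = a ** X"
  by (simp_all add: a_def matrix_mul_assoc)

lemma x_eq: "x = Z ** b - B"
  unfolding x_def b_def by (rule gr_chart_eq[OF i])

lemma x_horizontal: "x \<in> horizontal B"
  by (simp add: x_eq horizontal_def matrix_simps BZ ab BB)

lemma chart_diff_eq: "chart_diff B Z w = (w - Z ** (b ** (transpose B ** w))) ** b"
  by (simp add: chart_diff_def b_def)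

lemma chart_lift_eq: "chart_lift B Z w = (w - Z ** (transpose Z ** w)) ** a"
  by (simp add: chart_lift_def a_def)

lemma chart_diff_linear:
  "chart_diff B Z (v + w) = chart_diff B Z v + chart_diff B Z w"
  "chart_diff B Z (v - w) = chart_diff B Z v - chart_diff B Z w"
  "chart_diff B Z (- w) = - chart_diff B Z w"
  "chart_diff B Z (c *\<^sub>R w) = c *\<^sub>R chart_diff B Z w"
  "chart_diff B Z 0 = 0"
  by (simp_all add: chart_diff_eq matrix_simps algebra_simps)

lemma chart_diff_vertical: "chart_diff B Z (Z ** X) = 0"
  by (simp add: chart_diff_eq matrix_simps BZ ab)

lemma chart_diff_in_horizontal: "chart_diff B Z w \<in> horizontal B"
  by (simp add: chart_diff_eq horizontal_def matrix_simps BZ ab)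

lemma chart_lift_in_horizontal: "chart_lift B Z w \<in> horizontal Z"
  by (simp add: chart_lift_eq horizontal_def matrix_simps ZZ)

lemma chart_lift_diff: "w \<in> horizontal Z \<Longrightarrow> chart_lift B Z (chart_diff B Z w) = w"
  by (simp add: chart_diff_eq chart_lift_eq horizontal_def matrix_simps ZZ ab)

lemma chart_diff_lift:
  assumes "u \<in> horizontal B" shows "chart_diff B Z (chart_lift B Z u) = u"
proof -
  have "chart_lift B Z u = u ** a - Z ** (transpose Z ** u ** a)"
    by (simp add: chart_lift_eq matrix_simps)
  moreover have "chart_diff B Z (u ** a) = u"
    using assms by (simp add: chart_diff_eq matrix_simps horizontal_def ab)
  ultimately show ?thesis by (simp add: chart_diff_linear chart_diff_vertical)
qed

lemma gram_inverse: "matrix_inv (mat 1 + transpose x ** x) = a ** transpose a"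
proof (rule matrix_inv_unique)
  have "transpose Z ** B = transpose a" by (simp add: a_def matrix_transpose_mul)
  hence "mat 1 + transpose x ** x = transpose b ** b"
    by (simp add: x_eq matrix_simps ZZ BZ BB ab ab_transpose)
  thus "(mat 1 + transpose x ** x) ** (a ** transpose a) = mat 1"
    by (simp add: matrix_simps ab ab_transpose)
qed

end

lemma invertible_one_plus_gram: "invertible (mat 1 + transpose x ** (x :: real^'p^'n))"
proof -
  have "v = 0" if "(mat 1 + transpose x ** x) *v v = 0" for v
  proof -
    have "v \<bullet> v + (x *v v) \<bullet> (x *v v) = v \<bullet> ((mat 1 + transpose x ** x) *v v)"
      by (simp add: matrix_vector_mult_add_rdistrib inner_add_right dot_lmul_matrix
          flip: matrix_vector_mul_assoc)
         (metis dot_lmul_matrix inner_commute transpose_matrix_vector)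
    hence "v \<bullet> v + (x *v v) \<bullet> (x *v v) = 0" using that by simp
    thus ?thesis by (metis add_nonneg_eq_0_iff inner_eq_zero_iff inner_ge_zero)
  qed
  thus ?thesis by (simp add: invertible_left_inverse matrix_left_invertible_ker)
qed

text \<open>The columns of \<open>G\<close> are independent, so their span has an orthonormal basis indexed by the same
  type; its vectors are the columns of \<open>G a\<close>.\<close>

lemma exists_orthonormal_frame:
  fixes G :: "real^'p^'n"
  assumes "invertible (transpose G ** G)"
  obtains a :: "real^'p^'p" where "G ** a \<in> stiefel"
proof -
  have inj: "inj ((*v) G)"
  proof (rule injI)
    fix v w assume "G *v v = G *v w"
    hence "(transpose G ** G) *v v = (transpose G ** G) *v w"
      by (simp flip: matrix_vector_mul_assoc)
    thus "v = w"
      by (metis assms matrix_inv_left matrix_vector_mul_assoc matrix_vector_mul_lid)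
  qed
  have "subspace (range ((*v) G))"
    by (rule linear_subspace_image[OF matrix_vector_mul_linear subspace_UNIV])
  then obtain C where C: "C \<subseteq> range ((*v) G)" "pairwise orthogonal C" "\<And>v. v \<in> C \<Longrightarrow> norm v = 1"
      "independent C" "card C = dim (range ((*v) G))"
    using orthonormal_basis_subspace by metis
  have "dim (range ((*v) G)) = dim (UNIV :: (real^'p) set)"
    by (rule dim_image_eq) (use inj in \<open>auto intro: inj_on_subset\<close>)
  hence "card C = card (UNIV :: 'p set)" using C(5) by (simp add: dim_UNIV)
  moreover have "finite C" using C(4) by (rule independent_imp_finite)
  ultimately obtain h where h: "bij_betw h (UNIV :: 'p set) C"
    using finite_same_card_bij[of "UNIV :: 'p set" C] by auto
  have hC: "h j \<in> C" for j using h by (auto simp: bij_betw_def)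
  have "\<exists>v. h j = G *v v" for j using hC[of j] C(1) by auto
  then obtain \<alpha> where \<alpha>: "\<And>j. h j = G *v \<alpha> j" by metis
  define a where "a = (\<chi> i j. \<alpha> j $ i)"
  have col: "column j (G ** a) = h j" for j
    by (simp add: \<alpha> a_def column_def matrix_matrix_mult_def matrix_vector_mult_def vec_eq_iff)
  have "h i \<bullet> h j = (if i = j then 1 else 0)" for i j
  proof (cases "i = j")
    case True thus ?thesis using C(3)[OF hC[of j]] by (simp add: norm_eq_1)
  next
    case False
    hence "h i \<noteq> h j" using h by (auto simp: bij_betw_def inj_def)
    thus ?thesis using False C(2) hC by (auto simp: pairwise_def orthogonal_def)
  qed
  hence "transpose (G ** a) ** (G ** a) = mat 1"
    by (simp add: matrix_mult_transpose_dot_column col mat_def vec_eq_iff)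
  thus thesis using that by (simp add: stiefel_def)
qed

text \<open>Over the coordinate point \<open>y\<close> lies any orthonormal frame of the column space of \<open>B + y\<close>.\<close>

lemma chart_surj:
  fixes B :: "real^'p^'n"
  assumes B: "B \<in> stiefel" and y: "y \<in> horizontal B"
  obtains Z where "Z \<in> stiefel" "invertible (transpose B ** Z)" "gr_chart B (gr_q Z) = y"
proof -
  let ?G = "B + y"
  have BB: "transpose B ** B = mat 1" "transpose B ** y = 0" "transpose y ** B = 0"
    using B y transpose_mult_eq_zero_commute[of B y] by (simp_all add: stiefel_def horizontal_def)
  hence "transpose ?G ** ?G = mat 1 + transpose y ** y" by (simp add: matrix_simps)
  hence "invertible (transpose ?G ** ?G)" by (simp add: invertible_one_plus_gram)
  then obtain a :: "real^'p^'p" where a: "?G ** a \<in> stiefel"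
    using exists_orthonormal_frame[of ?G] by blast
  have Ba: "transpose B ** (?G ** a) = a"
    using BB by (simp add: matrix_mul_assoc matrix_simps(2))
  have "(transpose a ** (transpose ?G ** ?G)) ** a = mat 1"
    using a by (simp only: stiefel_def mem_Collect_eq matrix_transpose_mul matrix_mul_assoc)
  hence i: "invertible a" using invertible_left_inverse by blast
  moreover have "gr_chart B (gr_q (?G ** a)) = y"
    using gr_chart_eq[of B "?G ** a"] i Ba matrix_inv_right[OF i] by (simp flip: matrix_mul_assoc)
  ultimately show thesis using that[of "?G ** a"] a Ba by simp
qed

section \<open>Metric, connection and curvature in a chart\<close>

text \<open>With \<open>M = (1 + x\<^sup>T x)\<^sup>-\<^sup>1\<close>, \<open>K = 1 - x M x\<^sup>T = (1 + x x\<^sup>T)\<^sup>-\<^sup>1\<close> and \<open>N = M x\<^sup>T\<close>, the quotient metric at the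
  coordinate point \<open>x\<close> is \<open>Tr (u\<^sup>T K v M)\<close> and its Christoffel symbols are \<open>- (u N v + v N u)\<close>.\<close>

definition Mx :: "real^'p^'n \<Rightarrow> real^'p^'p" where "Mx x = matrix_inv (mat 1 + transpose x ** x)"
definition Kx :: "real^'p^'n \<Rightarrow> real^'n^'n" where "Kx x = mat 1 - x ** (Mx x ** transpose x)"
definition Nx :: "real^'p^'n \<Rightarrow> real^'n^'p" where "Nx x = Mx x ** transpose x"

definition chart_metric :: "real^'p^'n \<Rightarrow> real^'p^'n \<Rightarrow> real^'p^'n \<Rightarrow> real" where
  "chart_metric x u v = u \<bullet> (Kx x ** (v ** Mx x))"

definition chart_gamma :: "real^'p^'n \<Rightarrow> real^'p^'n \<Rightarrow> real^'p^'n \<Rightarrow> real^'p^'n" where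
  "chart_gamma x u v = - (u ** (Nx x ** v) + v ** (Nx x ** u))"

lemma transpose_matrix_inv:
  "invertible A \<Longrightarrow> transpose (matrix_inv A) = matrix_inv (transpose (A :: real^'p^'p))"
  by (rule matrix_inv_unique(1)[symmetric]) (simp add: matrix_inv_left flip: matrix_transpose_mul)

lemma Mx_symmetric: "transpose (Mx x) = Mx x"
  unfolding Mx_def by (simp add: transpose_matrix_inv invertible_one_plus_gram matrix_simps)

lemma Kx_symmetric: "transpose (Kx x) = Kx x"
  by (simp add: Kx_def matrix_simps Mx_symmetric)

lemma Nx_transpose: "transpose (Nx x) = x ** Mx x"
  by (simp add: Nx_def matrix_simps Mx_symmetric)

context chart_point
begin

lemma Mx_eq: "Mx x = a ** transpose a"
  by (simp add: Mx_def gram_inverse)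

text \<open>The lift of \<open>u\<close> is \<open>P u a\<close> with the projection \<open>P = 1 - Z Z\<^sup>T\<close>.  By \<open>Z = (B + x) a\<close> and \<open>M = a a\<^sup>T\<close> one has
  \<open>P = 1 - (B + x) M (B + x)\<^sup>T\<close>, and between vectors orthogonal to \<open>B\<close> this acts like \<open>K\<close>.\<close>

lemma chart_metric_eq_inner:
  assumes u: "u \<in> horizontal B" and v: "v \<in> horizontal B"
  shows "chart_metric x u v = chart_lift B Z u \<bullet> chart_lift B Z v"
proof -
  have ZB: "Z = (B + x) ** a" by (simp add: x_eq matrix_simps ab)
  have uB: "u \<bullet> (B ** X) = 0" for X
    using u inner_matrix_mult_left[of B X u] by (simp add: inner_commute horizontal_def)
  have Bv: "transpose B ** v = 0" "transpose B ** (v ** X) = 0" for X :: "real^'p^'p"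
    using v by (simp_all add: horizontal_def matrix_mul_assoc)
  let ?P = "mat 1 - Z ** transpose Z"
  have P: "transpose ?P = ?P" "?P ** (?P ** X) = ?P ** X" for X :: "real^'p^'n"
    by (simp_all add: matrix_simps ZZ)
  have l: "chart_lift B Z w = ?P ** (w ** a)" for w by (simp add: chart_lift_eq matrix_simps)
  have "chart_lift B Z u \<bullet> chart_lift B Z v = (u ** a) \<bullet> (?P ** (v ** a))"
    unfolding l by (subst inner_matrix_mult_left) (simp only: P)
  also have "\<dots> = u \<bullet> (?P ** (v ** Mx x))"
    by (subst inner_matrix_mult_right) (simp add: Mx_eq matrix_mul_assoc)
  also have "?P ** (v ** Mx x) = Kx x ** (v ** Mx x) - B ** (Mx x ** (transpose x ** (v ** Mx x)))"
  proof -
    have "Z ** transpose Z = (B + x) ** (Mx x ** transpose (B + x))"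
      unfolding Mx_eq by (subst (1 2) ZB) (simp only: matrix_transpose_mul matrix_mul_assoc)
    thus ?thesis by (simp add: Kx_def matrix_simps Bv)
  qed
  finally show ?thesis by (simp add: chart_metric_def inner_diff_right uB)
qed

lemma chart_diff_gram:
  assumes "h \<in> horizontal Z" "k \<in> horizontal Z"
  shows "transpose (chart_diff B Z h) ** (Kx x ** chart_diff B Z k) = transpose b ** (transpose h ** (k ** b))"
proof -
  let ?u = "chart_diff B Z h" and ?v = "chart_diff B Z k"
  have ZB: "Z = (B + x) ** a" by (simp add: x_eq matrix_simps ab)
  have Bv: "transpose B ** ?v = 0" "transpose ?u ** B = 0" "transpose ?u ** (B ** X) = 0" for X :: "real^'p^'p"
    using chart_diff_in_horizontal[of k] transpose_mult_eq_zero_commute[of B ?u] chart_diff_in_horizontal[of h]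
    by (simp_all add: horizontal_def matrix_mul_assoc)
  let ?P = "mat 1 - Z ** transpose Z"
  have "Z ** transpose Z = (B + x) ** (Mx x ** transpose (B + x))"
    unfolding Mx_eq by (subst (1 2) ZB) (simp only: matrix_transpose_mul matrix_mul_assoc)
  hence "transpose ?u ** (Kx x ** ?v) = transpose ?u ** (?P ** ?v)"
    by (simp add: Kx_def matrix_simps Bv)
  also have "\<dots> = transpose (?P ** ?u) ** (?P ** ?v)" by (simp add: matrix_simps ZZ)
  also have "?P ** chart_diff B Z w = w ** b" if "w \<in> horizontal Z" for w
    using arg_cong[OF chart_lift_diff[OF that], of "\<lambda>X. X ** b"]
    by (simp add: chart_lift_eq matrix_simps ab)
  hence "transpose (?P ** ?u) ** (?P ** ?v) = transpose (h ** b) ** (k ** b)" using assms by simp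
  finally show ?thesis by (simp add: matrix_simps)
qed

end

lemma gr_metric_eq:
  fixes B :: "real^'p^'n"
  assumes B: "B \<in> stiefel" and x: "x \<in> horizontal B" and u: "u \<in> horizontal B" and v: "v \<in> horizontal B"
  shows "gr_metric B x u v = chart_metric x u v"
  unfolding gr_metric_def
proof (rule the_equality)
  show "\<forall>Z h k. Z \<in> stiefel \<and> gr_q Z \<in> gr_dom B \<and> gr_chart B (gr_q Z) = x \<and> h \<in> horizontal Z \<and> k \<in> horizontal Z
      \<and> gr_dq Z h B = u \<and> gr_dq Z k B = v \<longrightarrow> chart_metric x u v = trace_inner h k"
  proof (intro allI impI; elim conjE)
    fix Z h k
    assume Z: "Z \<in> stiefel" and dom: "gr_q Z \<in> gr_dom B" and x: "gr_chart B (gr_q Z) = x"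
      and h: "h \<in> horizontal Z" "k \<in> horizontal Z" and uv: "gr_dq Z h B = u" "gr_dq Z k B = v"
    interpret chart_point B Z "transpose B ** Z" "matrix_inv (transpose B ** Z)" "gr_chart B (gr_q Z)"
      using B Z dom gr_dom_iff by unfold_locales auto
    have "u = chart_diff B Z h" "v = chart_diff B Z k" using uv gr_dq_eq[OF Z] B i by auto
    thus "chart_metric x u v = trace_inner h k"
      using chart_metric_eq_inner[OF u v] h chart_lift_diff by (simp add: x trace_inner_eq_inner)
  qed
  fix r
  assume r: "\<forall>Z h k. Z \<in> stiefel \<and> gr_q Z \<in> gr_dom B \<and> gr_chart B (gr_q Z) = x \<and> h \<in> horizontal Z \<and> k \<in> horizontal Z
      \<and> gr_dq Z h B = u \<and> gr_dq Z k B = v \<longrightarrow> r = trace_inner h k"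
  obtain Z where frame: "Z \<in> stiefel" "invertible (transpose B ** Z)" "gr_chart B (gr_q Z) = x"
    using chart_surj[OF B x] by blast
  interpret chart_point B Z "transpose B ** Z" "matrix_inv (transpose B ** Z)" "gr_chart B (gr_q Z)"
    using B frame by unfold_locales auto
  have "gr_dq Z (chart_lift B Z w) B = w" if "w \<in> horizontal B" for w
    using chart_diff_lift[OF that] B i by (simp add: gr_dq_eq[OF frame(1)])
  hence "r = trace_inner (chart_lift B Z u) (chart_lift B Z v)"
    using r[rule_format, of Z] frame u v chart_lift_in_horizontal gr_dom_iff[OF frame(1)] by blast
  thus "r = chart_metric x u v"
    using chart_metric_eq_inner[OF u v] frame(3) by (simp add: trace_inner_eq_inner)
qed

lemma subspace_horizontal: "subspace (horizontal B)"
  by (auto simp: horizontal_def matrix_simps subspace_def)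

lemma horizontal_line: "x \<in> horizontal B \<Longrightarrow> u \<in> horizontal B \<Longrightarrow> x + s *\<^sub>R u \<in> horizontal B"
  by (simp add: horizontal_def matrix_simps)

lemma horizontal_mult: "u \<in> horizontal B \<Longrightarrow> u ** X \<in> horizontal B"
  by (simp add: horizontal_def matrix_mul_assoc)

lemma chart_gamma_horizontal: "u \<in> horizontal B \<Longrightarrow> v \<in> horizontal B \<Longrightarrow> chart_gamma x u v \<in> horizontal B"
  unfolding chart_gamma_def
  by (intro subspace_neg subspace_add subspace_horizontal horizontal_mult)

lemma chart_gamma_commute: "chart_gamma x u v = chart_gamma x v u"
  by (simp add: chart_gamma_def add.commute)

lemma chart_metric_commute: "chart_metric x u v = chart_metric x v u"
proof -
  have "chart_metric x u v = (Kx x ** u) \<bullet> (v ** Mx x)"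
    using inner_matrix_mult_left[of "Kx x" u "v ** Mx x"] by (simp only: chart_metric_def Kx_symmetric)
  also have "\<dots> = ((Kx x ** u) ** Mx x) \<bullet> v"
    using inner_matrix_mult_right[of "Kx x ** u" "Mx x" v] by (simp only: Mx_symmetric)
  finally show ?thesis by (simp only: chart_metric_def inner_commute matrix_mul_assoc)
qed

lemma has_vector_derivative_line: "((\<lambda>s. x + s *\<^sub>R u) has_vector_derivative u) (at s)"
  by (auto intro!: derivative_eq_intros)

lemma has_vector_derivative_Mx:
  assumes "(c has_vector_derivative u) (at t)"
  shows "((\<lambda>s. Mx (c s)) has_vector_derivative
    - (Mx (c t) ** (transpose u ** transpose (Nx (c t))) + Nx (c t) ** (u ** Mx (c t)))) (at t)"
  unfolding Mx_def
  by (rule hvd_eq, rule has_vector_derivative_matrix_inv, (rule hvd_rules assms invertible_one_plus_gram)+)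
     (simp add: Mx_def[symmetric] Nx_transpose matrix_simps, simp add: Nx_def matrix_simps algebra_simps)

lemma has_vector_derivative_Nx:
  assumes "(c has_vector_derivative u) (at t)"
  shows "((\<lambda>s. Nx (c s)) has_vector_derivative
    Mx (c t) ** (transpose u ** Kx (c t)) - Nx (c t) ** (u ** Nx (c t))) (at t)"
  unfolding Nx_def
  by (rule hvd_eq, (rule hvd_rules has_vector_derivative_Mx assms)+)
     (simp add: Nx_transpose matrix_simps Kx_def, simp add: Nx_def matrix_simps algebra_simps)

lemma has_vector_derivative_Kx:
  assumes "(c has_vector_derivative u) (at t)"
  shows "((\<lambda>s. Kx (c s)) has_vector_derivative
    - (Kx (c t) ** (u ** Nx (c t)) + transpose (Nx (c t)) ** (transpose u ** Kx (c t)))) (at t)"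
  unfolding Kx_def
  by (rule hvd_eq, (rule hvd_rules has_vector_derivative_Mx assms)+)
     (simp add: Nx_transpose matrix_simps, simp add: Nx_def matrix_simps algebra_simps)

text \<open>Compatibility of the candidate connection with the metric.\<close>

lemma has_vector_derivative_chart_metric:
  "((\<lambda>s. chart_metric (x + s *\<^sub>R u) v z) has_vector_derivative
     chart_metric x (chart_gamma x u v) z + chart_metric x v (chart_gamma x u z)) (at 0)"
proof -
  note l = has_vector_derivative_line[of x u 0]
  have "((\<lambda>s. v \<bullet> (Kx (x + s *\<^sub>R u) ** (z ** Mx (x + s *\<^sub>R u)))) has_vector_derivative
      v \<bullet> (Kx x ** (z ** - (Mx x ** (transpose u ** transpose (Nx x)) + Nx x ** (u ** Mx x)))
         + - (Kx x ** (u ** Nx x) + transpose (Nx x) ** (transpose u ** Kx x)) ** (z ** Mx x))) (at 0)"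
    by (rule bounded_linear.has_vector_derivative[OF bounded_linear_inner_right], rule hvd_eq,
        (rule hvd_rules has_vector_derivative_Mx[OF l] has_vector_derivative_Kx[OF l])+) simp
  moreover have "(u ** (Nx x ** v)) \<bullet> X = v \<bullet> (transpose (Nx x) ** (transpose u ** X))"
    "(v ** (Nx x ** u)) \<bullet> X = v \<bullet> (X ** (transpose u ** transpose (Nx x)))" for X
    using inner_matrix_mult_left[of "u ** Nx x" v X] inner_matrix_mult_right[of v "Nx x ** u" X]
    by (simp_all only: matrix_mul_assoc matrix_transpose_mul)
  ultimately show ?thesis
    unfolding chart_metric_def chart_gamma_def
    by (simp add: matrix_simps inner_simps algebra_simps)
qed

text \<open>A symmetric connection that is compatible with the metric satisfies the Koszul formula; the
  metric is nondegenerate because \<open>chart_lift\<close> is injective on coordinate vectors.\<close>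

lemma christoffel_eq:
  fixes B :: "real^'p^'n"
  assumes B: "B \<in> stiefel" and x: "x \<in> horizontal B" and u: "u \<in> horizontal B" and v: "v \<in> horizontal B"
  shows "christoffel (horizontal B) (gr_metric B) x u v = chart_gamma x u v"
proof -
  let ?W = "horizontal B"
  have d: "dir_deriv (\<lambda>y. gr_metric B y v z) x u
      = chart_metric x (chart_gamma x u v) z + chart_metric x v (chart_gamma x u z)"
    if "u \<in> ?W" "v \<in> ?W" "z \<in> ?W" for u v z
    unfolding dir_deriv_def using has_vector_derivative_chart_metric[of x u v z] that B
    by (simp add: gr_metric_eq horizontal_line x vector_derivative_at)
  have koszul: "(dir_deriv (\<lambda>y. gr_metric B y v z) x u + dir_deriv (\<lambda>y. gr_metric B y u z) x v
      - dir_deriv (\<lambda>y. gr_metric B y u v) x z) / 2 = chart_metric x (chart_gamma x u v) z" if z: "z \<in> ?W" for z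
    using d[OF u v z] d[OF v u z] d[OF z u v] chart_gamma_commute[of x] chart_metric_commute[of x]
    by (simp add: field_simps)
  show ?thesis
    unfolding christoffel_def
  proof (rule the_equality)
    show "chart_gamma x u v \<in> ?W \<and> (\<forall>z\<in>?W. gr_metric B x (chart_gamma x u v) z =
        (dir_deriv (\<lambda>y. gr_metric B y v z) x u + dir_deriv (\<lambda>y. gr_metric B y u z) x v
        - dir_deriv (\<lambda>y. gr_metric B y u v) x z) / 2)"
      using koszul chart_gamma_horizontal[OF u v] gr_metric_eq[OF B x] by simp
    fix w
    assume w: "w \<in> ?W \<and> (\<forall>z\<in>?W. gr_metric B x w z =
        (dir_deriv (\<lambda>y. gr_metric B y v z) x u + dir_deriv (\<lambda>y. gr_metric B y u z) x v
        - dir_deriv (\<lambda>y. gr_metric B y u v) x z) / 2)"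
    let ?d = "w - chart_gamma x u v"
    have dW: "?d \<in> ?W" using w chart_gamma_horizontal[OF u v] subspace_horizontal subspace_diff by blast
    have "chart_metric x w ?d = chart_metric x (chart_gamma x u v) ?d"
      using w dW koszul[OF dW] gr_metric_eq[OF B x] by auto
    hence 0: "chart_metric x ?d ?d = 0" by (simp add: chart_metric_def inner_diff_left)
    obtain Z where frame: "Z \<in> stiefel" "invertible (transpose B ** Z)" "gr_chart B (gr_q Z) = x"
      using chart_surj[OF B x] by blast
    interpret chart_point B Z "transpose B ** Z" "matrix_inv (transpose B ** Z)" "gr_chart B (gr_q Z)"
      using B frame by unfold_locales auto
    have "chart_lift B Z ?d = 0" using 0 chart_metric_eq_inner[OF dW dW] frame by simp
    hence "?d = chart_diff B Z 0" using chart_diff_lift[OF dW] by simp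
    thus "w = chart_gamma x u v" by (simp add: chart_diff_linear)
  qed
qed

lemma dir_deriv_christoffel:
  fixes B :: "real^'p^'n"
  assumes B: "B \<in> stiefel" and x: "x \<in> horizontal B" and u: "u \<in> horizontal B"
    and v: "v \<in> horizontal B" and w: "w \<in> horizontal B"
  shows "dir_deriv (\<lambda>y. christoffel (horizontal B) (gr_metric B) y v w) x u
    = - (v ** ((Mx x ** (transpose u ** Kx x) - Nx x ** (u ** Nx x)) ** w)
        + w ** ((Mx x ** (transpose u ** Kx x) - Nx x ** (u ** Nx x)) ** v))"
proof -
  have "((\<lambda>s. chart_gamma (x + s *\<^sub>R u) v w) has_vector_derivative
     - (v ** ((Mx x ** (transpose u ** Kx x) - Nx x ** (u ** Nx x)) ** w)
        + w ** ((Mx x ** (transpose u ** Kx x) - Nx x ** (u ** Nx x)) ** v))) (at 0)"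
    unfolding chart_gamma_def
    by (rule hvd_eq, (rule hvd_rules has_vector_derivative_Nx[OF has_vector_derivative_line])+) simp
  thus ?thesis
    unfolding dir_deriv_def using assms by (simp add: christoffel_eq horizontal_line vector_derivative_at)
qed

lemma numeral_mult_matrix: "numeral k * (A :: real^'p^'n) = numeral k *\<^sub>R A"
  by (simp add: vec_eq_iff)

text \<open>The terms that are quadratic in \<open>N\<close>, which come from the derivative of \<open>N\<close> and from the products of
  Christoffel symbols, cancel.\<close>

lemma curvature_eq:
  fixes B :: "real^'p^'n"
  assumes B: "B \<in> stiefel" and x: "x \<in> horizontal B" and u: "u \<in> horizontal B" and v: "v \<in> horizontal B"
  shows "curvature (horizontal B) (gr_metric B) x u v v
    = u ** (Mx x ** (transpose v ** (Kx x ** v))) + v ** (Mx x ** (transpose v ** (Kx x ** u)))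
      - 2 *\<^sub>R (v ** (Mx x ** (transpose u ** (Kx x ** v))))"
  unfolding curvature_def using assms
  by (simp add: dir_deriv_christoffel christoffel_eq chart_gamma_horizontal)
     (simp add: chart_gamma_def matrix_simps numeral_mult_matrix algebra_simps)

text \<open>Read on horizontal vectors this is the curvature \<open>R(h,k)k = h k\<^sup>T k + k k\<^sup>T h - 2 k h\<^sup>T k\<close> of the
  Grassmann manifold.\<close>

lemma (in chart_point) curvature_chart_diff:
  assumes h: "h \<in> horizontal Z" and k: "k \<in> horizontal Z"
  shows "curvature (horizontal B) (gr_metric B) x (chart_diff B Z h) (chart_diff B Z k) (chart_diff B Z k)
    = chart_diff B Z (h ** (transpose k ** k) + k ** (transpose k ** h) - 2 *\<^sub>R (k ** (transpose h ** k)))"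
proof -
  have m: "chart_diff B Z w ** (Mx x ** (transpose b ** (X ** b))) = chart_diff B Z (w ** X)" for w X
    by (simp add: Mx_eq chart_diff_eq matrix_simps ab ab_transpose)
  show ?thesis
    by (simp add: curvature_eq[OF B x_horizontal chart_diff_in_horizontal chart_diff_in_horizontal]
        chart_diff_gram h k chart_diff_linear m[unfolded matrix_mul_assoc[symmetric]])
       (simp add: m[of _ "_ ** _", unfolded matrix_mul_assoc[symmetric]])
qed

section \<open>Geodesics of the Grassmann manifold\<close>

lemma gr_q_eq_iff:
  assumes Z: "Z \<in> stiefel" and Z': "Z' \<in> stiefel"
  shows "gr_q Z = gr_q Z' \<longleftrightarrow> Z ** transpose Z = Z' ** transpose Z'"
proof
  assume "gr_q Z = gr_q Z'"
  then obtain Q where Q: "orthogonal_matrix Q" "Z = Z' ** Q" using gr_q_eqD by blast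
  have "Z ** transpose Z = Z' ** (Q ** transpose Q) ** transpose Z'"
    unfolding Q(2) by (simp only: matrix_transpose_mul matrix_mul_assoc)
  thus "Z ** transpose Z = Z' ** transpose Z'" using Q(1) by (simp add: orthogonal_matrix_def)
next
  assume e: "Z ** transpose Z = Z' ** transpose Z'"
  let ?Q = "transpose Z' ** Z"
  have "Z = (Z ** transpose Z) ** Z" using Z by (simp add: stiefel_def flip: matrix_mul_assoc)
  hence ZQ: "Z = Z' ** ?Q" by (simp add: e matrix_mul_assoc)
  have "transpose ?Q ** ?Q = transpose Z ** (Z' ** transpose Z') ** Z"
    by (simp only: matrix_transpose_mul transpose_transpose matrix_mul_assoc)
  also have "\<dots> = (transpose Z ** Z) ** (transpose Z ** Z)" by (simp only: e[symmetric] matrix_mul_assoc)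
  finally have "orthogonal_matrix ?Q" using Z by (simp add: orthogonal_matrix stiefel_def)
  from gr_q_mult_orthogonal[OF this, of Z'] show "gr_q Z = gr_q Z'" by (simp only: ZQ[symmetric])
qed

text \<open>A point of the Grassmann manifold is determined by its orthogonal projector \<open>Z Z\<^sup>T\<close>.  This turns
  curves in the quotient into curves in one fixed vector space, so that uniqueness of
  geodesics need not be glued together from local statements in charts.\<close>

definition gr_projector :: "(real^'p^'n) set \<Rightarrow> real^'n^'n" where
  "gr_projector m = (THE P. \<exists>Z. Z \<in> stiefel \<and> gr_q Z = m \<and> P = Z ** transpose Z)"

lemma gr_projector_eq: "Z \<in> stiefel \<Longrightarrow> gr_projector (gr_q Z) = Z ** transpose Z"
  unfolding gr_projector_def by (rule the_equality) (auto simp: gr_q_eq_iff)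

lemma gr_projector_inj:
  assumes "m \<in> grassmann" "m' \<in> grassmann" "gr_projector m = gr_projector m'" shows "m = m'"
proof -
  obtain Z Z' where "Z \<in> stiefel" "m = gr_q Z" "Z' \<in> stiefel" "m' = gr_q Z'"
    using assms(1,2) by (auto simp: grassmann_def)
  thus ?thesis using assms(3) by (simp add: gr_projector_eq gr_q_eq_iff)
qed

lemma gr_dom_chart_point:
  assumes B: "B \<in> stiefel" and m: "m \<in> gr_dom B"
  shows "gr_chart B m \<in> horizontal B"
    and "gr_projector m = (B + gr_chart B m) ** (Mx (gr_chart B m) ** transpose (B + gr_chart B m))"
proof -
  obtain Z where Z: "Z \<in> stiefel" "invertible (transpose B ** Z)" "m = gr_q Z"
    using m unfolding gr_dom_def by blast
  interpret cp: chart_point B Z "transpose B ** Z" "matrix_inv (transpose B ** Z)" "gr_chart B (gr_q Z)"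
    using B Z by unfold_locales auto
  show "gr_chart B m \<in> horizontal B" using cp.x_horizontal Z by simp
  let ?a = "transpose B ** Z"
  have "(B + gr_chart B m) ** ?a = Z" using cp.ab(2) by (simp add: Z(3) cp.x_eq flip: matrix_mul_assoc)
  moreover have "(B + gr_chart B m) ** (Mx (gr_chart B m) ** transpose (B + gr_chart B m))
      = ((B + gr_chart B m) ** ?a) ** transpose ((B + gr_chart B m) ** ?a)"
    using cp.Mx_eq by (simp only: Z(3) matrix_transpose_mul matrix_mul_assoc)
  ultimately show "gr_projector m = (B + gr_chart B m) ** (Mx (gr_chart B m) ** transpose (B + gr_chart B m))"
    using Z by (simp add: gr_projector_eq)
qed

lemma stiefel_gr_dom: "B \<in> stiefel \<Longrightarrow> gr_q B \<in> gr_dom B" and stiefel_gr_chart: "B \<in> stiefel \<Longrightarrow> gr_chart B (gr_q B) = 0"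
proof -
  assume B: "B \<in> stiefel"
  have 1: "transpose B ** B ** mat 1 = mat 1" using B by (simp add: stiefel_def)
  show "gr_q B \<in> gr_dom B" using matrix_inv_unique(2)[OF 1] B by (simp add: gr_dom_iff)
  show "gr_chart B (gr_q B) = 0"
    using gr_chart_eq[OF matrix_inv_unique(2)[OF 1]] matrix_inv_unique(1)[OF 1] by simp
qed

lemma Mx_0: "Mx 0 = mat 1" and Nx_0: "Nx 0 = 0" and Kx_0: "Kx 0 = mat 1"
  by (simp_all add: Mx_def Nx_def Kx_def matrix_inv_unique(1)[of "mat 1" "mat 1"])

lemma horizontal_derivative:
  assumes "open T" "t \<in> T" "\<And>s. s \<in> T \<Longrightarrow> x s \<in> horizontal B" "(x has_vector_derivative u) (at t)"
  shows "u \<in> horizontal B"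
proof -
  have "transpose B ** u + 0 ** x t = 0"
    by (rule has_vector_derivative_unique_open[OF assms(1,2), where f = "\<lambda>s. transpose B ** x s" and g = "\<lambda>_. 0"])
       (use assms(3) in \<open>simp add: horizontal_def\<close>, (rule hvd_rules assms(4))+)
  thus ?thesis by (simp add: horizontal_def)
qed

text \<open>The chart is centred at the point \<open>c t\<close> itself: there the Christoffel symbols vanish, so the
  geodesic equation reduces to \<open>x'' = 0\<close>.\<close>

lemma gr_geodesic_projector:
  assumes c: "gr_geodesic_on T c" and t: "t \<in> T" and B: "B \<in> stiefel" and cB: "c t = gr_q B"
  defines "u \<equiv> velocity (\<lambda>s. gr_chart B (c s)) t" and "P \<equiv> \<lambda>s. gr_projector (c s)"
  shows "transpose B ** u = 0"
    and "(P has_vector_derivative u ** transpose B + B ** transpose u) (at t)"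
    and "(velocity P has_vector_derivative
           2 *\<^sub>R (u ** transpose u) - 2 *\<^sub>R (B ** (transpose u ** (u ** transpose B)))) (at t)"
proof -
  define x where "x = (\<lambda>s. gr_chart B (c s))"
  define v where "v = velocity x"
  define I where "I = {s\<in>T. c s \<in> gr_dom B}"
  have I: "open I" and tI: "t \<in> I"
    using c B t stiefel_gr_dom[OF B] cB by (auto simp: gr_geodesic_on_def I_def Let_def)
  have dx: "x differentiable (at s)" and dv: "v differentiable (at s)"
    and cov: "cov_deriv (horizontal B) (gr_metric B) x v s = 0" if "s \<in> I" for s
    using c B that by (auto simp: gr_geodesic_on_def I_def x_def v_def Let_def)
  note x = has_vector_derivative_velocity[OF dx, folded v_def]
  note v = has_vector_derivative_velocity[OF dv]
  have xW: "x s \<in> horizontal B" if "s \<in> I" for s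
    using that gr_dom_chart_point(1)[OF B] by (auto simp: I_def x_def)
  have x0: "x t = 0" using stiefel_gr_chart[OF B] cB by (simp add: x_def)
  have u: "u = v t" by (simp add: u_def v_def x_def)
  have uW: "u \<in> horizontal B" unfolding u by (rule horizontal_derivative[OF I tI xW x[OF tI]])
  show Bu: "transpose B ** u = 0" using uW by (simp add: horizontal_def)
  \<comment> \<open>\<open>Nx 0 = 0\<close>, so the Christoffel symbols vanish at the centre of the chart.\<close>
  have v0: "velocity v t = 0"
    using cov[OF tI] christoffel_eq[OF B xW[OF tI] uW uW]
    by (simp add: cov_deriv_def v_def[symmetric] u x0 chart_gamma_def Nx_0)
  let ?M = "\<lambda>s. Mx (x s)" and ?N = "\<lambda>s. Nx (x s)" and ?G = "\<lambda>s. B + x s"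
  define M' where "M' = (\<lambda>s. - (?M s ** (transpose (v s) ** transpose (?N s)) + ?N s ** (v s ** ?M s)))"
  let ?D = "\<lambda>s. ?G s ** (?M s ** transpose (v s) + M' s ** transpose (?G s)) + v s ** (?M s ** transpose (?G s))"
  have P: "P s = ?G s ** (?M s ** transpose (?G s))" if "s \<in> I" for s
    using that gr_dom_chart_point(2)[OF B] by (simp add: I_def P_def x_def)
  have "((\<lambda>s. ?G s ** (?M s ** transpose (?G s))) has_vector_derivative ?D s) (at s)" if "s \<in> I" for s
    by (rule hvd_eq, (rule hvd_rules has_vector_derivative_Mx x that)+) (simp add: M'_def)
  hence P': "(P has_vector_derivative ?D s) (at s)" if "s \<in> I" for s
    using that P by (metis (no_types, lifting) I has_vector_derivative_transform_within_open)
  show "(P has_vector_derivative u ** transpose B + B ** transpose u) (at t)"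
    using P'[OF tI] by (simp add: M'_def x0 Mx_0 Nx_0 u add.commute)
  have "(?D has_vector_derivative 2 *\<^sub>R (u ** transpose u) - 2 *\<^sub>R (B ** (transpose u ** (u ** transpose B)))) (at t)"
  proof -
    have xt: "(x has_vector_derivative u) (at t)" using x[OF tI] by (simp add: u)
    have vt: "(v has_vector_derivative 0) (at t)" using v[OF tI] v0 by simp
    have Mt: "(?M has_vector_derivative 0) (at t)"
      using has_vector_derivative_Mx[OF xt] by (simp add: x0 Mx_0 Nx_0)
    have Nt: "(?N has_vector_derivative transpose u) (at t)"
      using has_vector_derivative_Nx[OF xt] by (simp add: x0 Mx_0 Nx_0 Kx_0)
    have M't: "(M' has_vector_derivative - (transpose u ** u + transpose u ** u)) (at t)"
      unfolding M'_def by (rule hvd_eq, (rule hvd_rules Mt Nt vt)+) (simp add: x0 Mx_0 Nx_0 u)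
    show ?thesis
      by (rule hvd_eq, (rule hvd_rules Mt M't vt xt)+)
         (simp add: M'_def x0 Mx_0 Nx_0 matrix_simps numeral_mult_matrix flip: u)
  qed
  moreover have "velocity P s = ?D s" if "s \<in> I" for s by (rule velocityI[OF P'[OF that]])
  ultimately show "(velocity P has_vector_derivative
      2 *\<^sub>R (u ** transpose u) - 2 *\<^sub>R (B ** (transpose u ** (u ** transpose B)))) (at t)"
    by (metis (no_types, lifting) I tI has_vector_derivative_transform_within_open)
qed

text \<open>For a curve of projectors \<open>P' = [[P', P], P]\<close>, and along a geodesic the generator \<open>[P', P]\<close> is
  conserved since \<open>P''\<close> commutes with \<open>P\<close>.  So \<open>P\<close> solves a linear equation with constant coefficients.\<close>

lemma gr_geodesic_lax:
  assumes c: "gr_geodesic_on T c" and t: "t \<in> T"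
  defines "P \<equiv> \<lambda>s. gr_projector (c s)"
  defines "\<Omega> \<equiv> \<lambda>s. velocity P s ** P s - P s ** velocity P s"
  shows "(P has_vector_derivative \<Omega> t ** P t - P t ** \<Omega> t) (at t)" and "(\<Omega> has_vector_derivative 0) (at t)"
proof -
  obtain B where B: "B \<in> stiefel" "c t = gr_q B"
    using c t unfolding gr_geodesic_on_def grassmann_def by blast
  define u where "u = velocity (\<lambda>s. gr_chart B (c s)) t"
  note g = gr_geodesic_projector[OF c t B, folded u_def P_def]
  have BB: "transpose B ** B = mat 1" "\<And>X. transpose B ** (B ** X) = X"
    using B(1) by (simp_all add: stiefel_def matrix_mul_assoc)
  have uB: "transpose u ** B = 0" "transpose u ** (B ** X) = 0" "transpose B ** (u ** X) = 0"
    for X :: "real^'b^'a"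
    using g(1) transpose_mult_eq_zero_commute[OF g(1)] by (simp_all add: matrix_mul_assoc)
  have P: "P t = B ** transpose B" using B by (simp add: P_def gr_projector_eq)
  note simps = P velocityI[OF g(2)] matrix_simps BB uB g(1)
  show "(P has_vector_derivative \<Omega> t ** P t - P t ** \<Omega> t) (at t)"
    using g(2) by (simp add: \<Omega>_def simps)
  have P': "(P has_vector_derivative velocity P t) (at t)" using g(2) velocityI by force
  show "(\<Omega> has_vector_derivative 0) (at t)"
    unfolding \<Omega>_def by (rule hvd_eq, (rule hvd_rules P' g(3))+) (simp add: simps)
qed

lemma gr_geodesic_unique:
  fixes c c' :: "real \<Rightarrow> (real^'p^'n) set"
  assumes T: "open_interval T" "0 \<in> T" "t \<in> T"
    and c: "gr_geodesic_on T c" "gr_geodesic_on T c'"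
    and 0: "c 0 = c' 0" "gr_velocity c 0 = gr_velocity c' 0"
  shows "c t = c' t"
proof -
  have T': "is_interval T" using T by (simp add: open_interval_def)
  define P P' where "P = (\<lambda>s. gr_projector (c s))" and "P' = (\<lambda>s. gr_projector (c' s))"
  define W W' where "W = (\<lambda>s. velocity P s ** P s - P s ** velocity P s)"
    and "W' = (\<lambda>s. velocity P' s ** P' s - P' s ** velocity P' s)"
  have l: "(P has_vector_derivative W s ** P s - P s ** W s) (at s)" "(W has_vector_derivative 0) (at s)"
    and l': "(P' has_vector_derivative W' s ** P' s - P' s ** W' s) (at s)" "(W' has_vector_derivative 0) (at s)"
    if "s \<in> T" for s
    using gr_geodesic_lax[OF c(1) that] gr_geodesic_lax[OF c(2) that]
    by (simp_all only: W_def P_def W'_def P'_def)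
  obtain B where B: "B \<in> stiefel" "c 0 = gr_q B"
    using c(1) T(2) unfolding gr_geodesic_on_def grassmann_def by blast
  have "velocity (\<lambda>s. gr_chart B (c s)) 0 = velocity (\<lambda>s. gr_chart B (c' s)) 0"
    using fun_cong[OF 0(2), of B] B 0(1) stiefel_gr_dom[OF B(1)] by (simp add: gr_velocity_def)
  hence "velocity P 0 = velocity P' 0"
    using velocityI[OF gr_geodesic_projector(2)[OF c(1) T(2) B]]
      velocityI[OF gr_geodesic_projector(2)[OF c(2) T(2) B(1)]] B 0(1) by (simp add: P_def P'_def)
  hence W0: "W 0 = W' 0" by (simp add: W_def W'_def P_def P'_def 0(1))
  have W: "W s = W 0" "W' s = W 0" if "s \<in> T" for s
    using constant_on_interval[OF T' T(2) that, of W] constant_on_interval[OF T' T(2) that, of W'] l(2) l'(2) W0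
    by auto
  have "P t - P' t = 0"
  proof (rule gronwall_zero[OF T'(1) T(2,3)])
    fix s assume s: "s \<in> T"
    show "((\<lambda>s. P s - P' s) has_vector_derivative W 0 ** (P s - P' s) - (P s - P' s) ** W 0) (at s)"
      using has_vector_derivative_diff[OF l(1)[OF s] l'(1)[OF s]] W[OF s]
      by (simp add: bounded_bilinear.diff_left[OF bounded_bilinear_matrix_mult]
          bounded_bilinear.diff_right[OF bounded_bilinear_matrix_mult] algebra_simps)
    show "norm (W 0 ** (P s - P' s) - (P s - P' s) ** W 0) \<le> (2 * norm (W 0)) * norm (P s - P' s)"
      using norm_triangle_ineq4[of "W 0 ** (P s - P' s)" "(P s - P' s) ** W 0"]
        norm_matrix_mult_le[of "W 0" "P s - P' s"] norm_matrix_mult_le[of "P s - P' s" "W 0"]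
      by (simp add: algebra_simps)
  qed (simp add: P_def P'_def 0(1))
  moreover have "c t \<in> grassmann" "c' t \<in> grassmann"
    using c T(3) unfolding gr_geodesic_on_def by auto
  ultimately show ?thesis using gr_projector_inj by (simp add: P_def P'_def)
qed

lemma gr_geodesic_on_subset:
  assumes "gr_geodesic_on S c" "T \<subseteq> S" "open T" shows "gr_geodesic_on T c"
proof -
  have "{t\<in>T. c t \<in> gr_dom Y} = T \<inter> {t\<in>S. c t \<in> gr_dom Y}" for Y using assms(2) by blast
  thus ?thesis
    using assms unfolding gr_geodesic_on_def Let_def by (auto simp: subset_iff image_subset_iff)
qed

section \<open>Covariant derivatives along a horizontal curve\<close>

lemma (in chart_point) Nx_chart_diff:
  assumes "w \<in> horizontal Z"
  shows "Nx x ** chart_diff B Z w = - (transpose B ** (w ** b))"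
proof -
  have "transpose x = transpose b ** transpose Z - transpose B" by (simp add: x_eq matrix_simps)
  moreover have "transpose B ** chart_diff B Z w = 0"
    using chart_diff_in_horizontal by (simp add: horizontal_def)
  moreover have "transpose Z ** chart_diff B Z w = - (b ** (transpose B ** (w ** b)))"
    using assms by (simp add: chart_diff_eq matrix_simps ZZ horizontal_def)
      (simp add: matrix_mul_assoc[of "transpose Z" w b])
  ultimately show ?thesis by (simp add: Nx_def Mx_eq matrix_simps ab ab_transpose)
qed

lemma (in chart_point) chart_diff_eq_0_iff:
  "chart_diff B Z w = 0 \<longleftrightarrow> w = Z ** (transpose Z ** w)"
proof
  assume "chart_diff B Z w = 0"
  hence "(w - Z ** (b ** (transpose B ** w))) ** b ** a = 0" by (simp add: chart_diff_eq)
  hence e: "w = Z ** (b ** (transpose B ** w))" by (simp add: ab flip: matrix_mul_assoc)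
  have "transpose Z ** w = b ** (transpose B ** w)" by (subst e) (rule ZZ)
  thus "w = Z ** (transpose Z ** w)" using e by simp
next
  assume "w = Z ** (transpose Z ** w)"
  hence "chart_diff B Z w = chart_diff B Z (Z ** (transpose Z ** w))" by (rule arg_cong)
  thus "chart_diff B Z w = 0" by (simp only: chart_diff_vertical)
qed

locale horizontal_curve =
  fixes \<gamma> k :: "real \<Rightarrow> real^'p^'n"
  assumes in_stiefel: "\<gamma> t \<in> stiefel" and k_horizontal: "k t \<in> horizontal (\<gamma> t)"
    and curve: "(\<gamma> has_vector_derivative k t) (at t)"
begin

lemma gg: "transpose (\<gamma> t) ** \<gamma> t = mat 1" "transpose (\<gamma> t) ** (\<gamma> t ** X) = X"
  using in_stiefel[of t] by (simp_all add: stiefel_def matrix_mul_assoc)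

lemma chart_pointI:
  "B \<in> stiefel \<Longrightarrow> invertible (transpose B ** \<gamma> t) \<Longrightarrow> chart_point B (\<gamma> t)"
  by unfold_locales (auto simp: in_stiefel)

lemma open_chart_times:
  fixes B :: "real^'p^'n"
  assumes "open T" shows "open {t\<in>T. invertible (transpose B ** \<gamma> t)}"
proof -
  have "continuous_on UNIV \<gamma>"
    using curve by (auto intro!: continuous_at_imp_continuous_on has_vector_derivative_continuous)
  hence "continuous_on UNIV (\<lambda>t. transpose B ** \<gamma> t)"
    by (intro bounded_linear.continuous_on[OF bounded_bilinear.bounded_linear_right[OF bounded_bilinear_matrix_mult]])
  hence "open ((\<lambda>t. transpose B ** \<gamma> t) -` {A. invertible A})" by (intro open_vimage open_invertible)
  thus ?thesis using open_Int[OF assms] by (simp add: vimage_def Collect_conj_eq)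
qed

lemma chart_curve_derivative:
  assumes "invertible (transpose B ** \<gamma> t)"
  shows "((\<lambda>s. gr_chart B (gr_q (\<gamma> s))) has_vector_derivative chart_diff B (\<gamma> t) (k t)) (at t)"
  using has_derivative_compose[OF curve[unfolded has_vector_derivative_def, of t] has_derivative_gr_chart[OF assms]]
  by (simp add: has_vector_derivative_def chart_diff_def matrix_simps scaleR_diff_right)

lemma inverse_derivative:
  fixes B :: "real^'p^'n"
  assumes "invertible (transpose B ** \<gamma> t)"
  shows "((\<lambda>s. matrix_inv (transpose B ** \<gamma> s)) has_vector_derivative
    - (matrix_inv (transpose B ** \<gamma> t) ** (transpose B ** (k t ** matrix_inv (transpose B ** \<gamma> t))))) (at t)"
  by (rule hvd_eq, rule has_vector_derivative_matrix_inv, (rule hvd_rules curve assms)+) (simp add: matrix_simps)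

lemma chart_field_derivative:
  assumes "invertible (transpose B ** \<gamma> t)" "h differentiable (at t)"
  shows "(\<lambda>s. chart_diff B (\<gamma> s) (h s)) differentiable (at t)"
  unfolding chart_diff_def
  by (rule differentiableI_vector, (rule hvd_rules curve inverse_derivative[OF assms(1)]
        has_vector_derivative_velocity[OF assms(2)])+)

lemma lifted_field_derivative:
  assumes "V differentiable (at t)"
  shows "(\<lambda>s. chart_lift B (\<gamma> s) (V s)) differentiable (at t)"
  unfolding chart_lift_def
  by (rule differentiableI_vector, (rule hvd_rules curve has_vector_derivative_velocity[OF assms(1)])+)

text \<open>The Christoffel terms cancel exactly those terms of the derivative of \<open>chart_diff B (\<gamma> s) (h s)\<close> that
  come from the motion of \<open>\<gamma>\<close>, because \<open>Nx\<close> sends the image of a horizontal \<open>w\<close> to \<open>- B\<^sup>T w b\<close>.\<close>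

lemma cov_deriv_chart_field:
  assumes B: "B \<in> stiefel" and i: "invertible (transpose B ** \<gamma> t)"
    and T: "open T" "t \<in> T" and V: "\<And>s. s \<in> T \<Longrightarrow> V s = chart_diff B (\<gamma> s) (h s)"
    and h: "h t \<in> horizontal (\<gamma> t)" "(h has_vector_derivative h') (at t)"
  shows "cov_deriv (horizontal B) (gr_metric B) (\<lambda>s. gr_chart B (gr_q (\<gamma> s))) V t = chart_diff B (\<gamma> t) h'"
proof -
  interpret chart_point B "\<gamma> t" "transpose B ** \<gamma> t" "matrix_inv (transpose B ** \<gamma> t)" "gr_chart B (gr_q (\<gamma> t))"
    by (rule chart_pointI[OF B i])
  let ?b = "\<lambda>s. matrix_inv (transpose B ** \<gamma> s)"
  let ?b' = "- (?b t ** (transpose B ** (k t ** ?b t)))"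
  let ?V' = "(h t - \<gamma> t ** (?b t ** (transpose B ** h t))) ** ?b'
    + (h' - (\<gamma> t ** (?b t ** (transpose B ** h') + ?b' ** (transpose B ** h t)) + k t ** (?b t ** (transpose B ** h t)))) ** ?b t"
  have "((\<lambda>s. chart_diff B (\<gamma> s) (h s)) has_vector_derivative ?V') (at t)"
    unfolding chart_diff_def
    by (rule hvd_eq, (rule hvd_rules curve inverse_derivative[OF i] h)+) (simp add: matrix_simps)
  from has_vector_derivative_transform_within_open[OF this T, of V] V
  have V': "velocity V t = ?V'" by (intro velocityI) simp
  have "cov_deriv (horizontal B) (gr_metric B) (\<lambda>s. gr_chart B (gr_q (\<gamma> s))) V t
      = ?V' + chart_gamma (gr_chart B (gr_q (\<gamma> t))) (chart_diff B (\<gamma> t) (k t)) (chart_diff B (\<gamma> t) (h t))"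
    unfolding cov_deriv_def V' velocityI[OF chart_curve_derivative[OF i]] V[OF T(2)]
    by (simp add: christoffel_eq[OF B x_horizontal chart_diff_in_horizontal chart_diff_in_horizontal])
  also have "\<dots> = chart_diff B (\<gamma> t) h'"
    unfolding chart_gamma_def Nx_chart_diff[OF h(1)] Nx_chart_diff[OF k_horizontal]
    by (simp add: chart_diff_def matrix_simps algebra_simps)
  finally show ?thesis .
qed

text \<open>The covariant derivative of the velocity is the image of the acceleration, which has no horizontal
  component.\<close>

lemma gr_geodesic_on_curve:
  assumes k': "\<And>t. (k has_vector_derivative \<gamma> t ** X t) (at t)"
  shows "gr_geodesic_on UNIV (\<lambda>t. gr_q (\<gamma> t))"
  unfolding gr_geodesic_on_def Let_def
proof (intro conjI ballI)
  show "range (\<lambda>t. gr_q (\<gamma> t)) \<subseteq> grassmann" using in_stiefel by (auto simp: grassmann_def)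
  fix B :: "real^'p^'n" assume B: "B \<in> stiefel"
  let ?x = "\<lambda>s. gr_chart B (gr_q (\<gamma> s))"
  let ?I = "{t. invertible (transpose B ** \<gamma> t)}"
  have I: "{t\<in>UNIV. gr_q (\<gamma> t) \<in> gr_dom B} = ?I" by (simp add: gr_dom_iff in_stiefel)
  show oI: "open {t\<in>UNIV. gr_q (\<gamma> t) \<in> gr_dom B}" unfolding I using open_chart_times[of UNIV B] by simp
  fix t assume "t \<in> {t\<in>UNIV. gr_q (\<gamma> t) \<in> gr_dom B}"
  hence t: "t \<in> ?I" unfolding I .
  have v: "velocity ?x s = chart_diff B (\<gamma> s) (k s)" if "s \<in> ?I" for s
    using that by (intro velocityI chart_curve_derivative) simp
  show "?x differentiable (at t)"
    using t by (intro differentiableI_vector[OF chart_curve_derivative]) simp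
  show "velocity ?x differentiable (at t)"
    by (rule differentiable_cong_open(1)[OF oI[unfolded I] t _ chart_field_derivative[OF _ differentiableI_vector[OF k']]])
       (use t v in simp_all)
  interpret cp: chart_point B "\<gamma> t" "transpose B ** \<gamma> t" "matrix_inv (transpose B ** \<gamma> t)" "gr_chart B (gr_q (\<gamma> t))"
    by (rule chart_pointI[OF B t[unfolded mem_Collect_eq]])
  show "cov_deriv (horizontal B) (gr_metric B) ?x (velocity ?x) t = 0"
  proof -
    have "cov_deriv (horizontal B) (gr_metric B) ?x (velocity ?x) t = chart_diff B (\<gamma> t) (\<gamma> t ** X t)"
      by (rule cov_deriv_chart_field[where h = k and T = ?I and V = "velocity ?x", OF B _ oI[unfolded I] t])
         (rule t[unfolded mem_Collect_eq] v k_horizontal k' | assumption)+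
    also have "\<dots> = 0" by (rule cp.chart_diff_vertical)
    finally show ?thesis .
  qed
qed

end

section \<open>Jacobi fields and their horizontal lifts\<close>

text \<open>The horizontal lift of \<open>R(h,k)k\<close>.\<close>

definition gr_curvature_lift :: "real^'p^'n \<Rightarrow> real^'p^'n \<Rightarrow> real^'p^'n" where
  "gr_curvature_lift k h = h ** (transpose k ** k) + k ** (transpose k ** h) - 2 *\<^sub>R (k ** (transpose h ** k))"

lemma norm_gr_curvature_lift:
  fixes k h :: "real^'p^'n"
  shows "norm (gr_curvature_lift k h) \<le> 4 * (norm k)\<^sup>2 * norm h"
proof -
  have le: "norm (a ** (transpose b ** c)) \<le> norm a * norm b * norm c" for a b c :: "real^'p^'n"
    using norm_matrix_mult_le[of a "transpose b ** c"]
      mult_left_mono[OF norm_matrix_mult_le[of "transpose b" c], of "norm a"]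
    by (simp add: norm_transpose mult.assoc)
  have "norm (gr_curvature_lift k h)
      \<le> norm (h ** (transpose k ** k)) + norm (k ** (transpose k ** h)) + 2 * norm (k ** (transpose h ** k))"
    unfolding gr_curvature_lift_def
    by (rule order_trans[OF norm_triangle_ineq4]) (auto intro: norm_triangle_ineq)
  also have "\<dots> \<le> norm h * norm k * norm k + norm k * norm k * norm h + 2 * (norm k * norm h * norm k)"
    by (intro add_mono le mult_left_mono) auto
  finally show ?thesis by (simp add: power2_eq_square ac_simps)
qed

lemma gr_curvature_lift_diff: "gr_curvature_lift k (h - h') = gr_curvature_lift k h - gr_curvature_lift k h'"
  by (simp add: gr_curvature_lift_def matrix_simps algebra_simps)

context horizontal_curve
begin

text \<open>The horizontal part of the derivative of a field, which lifts the covariant derivative.  The Jacobi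
  equation on the quotient then lifts to the statement that \<open>(hor_deriv h)' + R(h,k)k\<close> has no
  horizontal component.\<close>

definition hor_deriv :: "(real \<Rightarrow> real^'p^'n) \<Rightarrow> real \<Rightarrow> real^'p^'n" where
  "hor_deriv h t = velocity h t - \<gamma> t ** (transpose (\<gamma> t) ** velocity h t)"

definition lifted_jacobi_on :: "real set \<Rightarrow> (real \<Rightarrow> real^'p^'n) \<Rightarrow> bool" where
  "lifted_jacobi_on T h \<longleftrightarrow> (\<forall>t\<in>T. h t \<in> horizontal (\<gamma> t) \<and> h differentiable (at t) \<and> hor_deriv h differentiable (at t) \<and>
     (let w = velocity (hor_deriv h) t + gr_curvature_lift (k t) (h t) in w = \<gamma> t ** (transpose (\<gamma> t) ** w)))"

lemma hor_deriv_horizontal: "hor_deriv h t \<in> horizontal (\<gamma> t)"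
  by (simp add: horizontal_def hor_deriv_def matrix_simps gg)

lemma jacobi_equation_chart:
  assumes B: "B \<in> stiefel" and I: "open I" "t \<in> I" and i: "\<And>s. s \<in> I \<Longrightarrow> invertible (transpose B ** \<gamma> s)"
    and V: "\<And>s. s \<in> I \<Longrightarrow> V s = chart_diff B (\<gamma> s) (h s)"
    and h: "\<And>s. s \<in> I \<Longrightarrow> h s \<in> horizontal (\<gamma> s)" "\<And>s. s \<in> I \<Longrightarrow> h differentiable (at s)"
  defines "x \<equiv> \<lambda>s. gr_chart B (gr_q (\<gamma> s))"
  shows "cov_deriv (horizontal B) (gr_metric B) x V t = chart_diff B (\<gamma> t) (hor_deriv h t)"
    and "hor_deriv h differentiable (at t) \<Longrightarrow>
      cov_deriv (horizontal B) (gr_metric B) x (cov_deriv (horizontal B) (gr_metric B) x V) t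
        + curvature (horizontal B) (gr_metric B) (x t) (V t) (velocity x t) (velocity x t)
      = chart_diff B (\<gamma> t) (velocity (hor_deriv h) t + gr_curvature_lift (k t) (h t))"
proof -
  have cov: "cov_deriv (horizontal B) (gr_metric B) x V s = chart_diff B (\<gamma> s) (hor_deriv h s)" if s: "s \<in> I" for s
  proof -
    interpret cp: chart_point B "\<gamma> s" "transpose B ** \<gamma> s" "matrix_inv (transpose B ** \<gamma> s)" "gr_chart B (gr_q (\<gamma> s))"
      by (rule chart_pointI[OF B i[OF s]])
    have "cov_deriv (horizontal B) (gr_metric B) x V s = chart_diff B (\<gamma> s) (velocity h s)"
      unfolding x_def
      by (rule cov_deriv_chart_field[where h = h and T = I and V = V, OF B i[OF s] I(1) s])
         (rule V h s has_vector_derivative_velocity | assumption)+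
    thus ?thesis by (simp add: hor_deriv_def cp.chart_diff_linear cp.chart_diff_vertical)
  qed
  show "cov_deriv (horizontal B) (gr_metric B) x V t = chart_diff B (\<gamma> t) (hor_deriv h t)" by (rule cov[OF I(2)])
  assume d: "hor_deriv h differentiable (at t)"
  interpret cp: chart_point B "\<gamma> t" "transpose B ** \<gamma> t" "matrix_inv (transpose B ** \<gamma> t)" "gr_chart B (gr_q (\<gamma> t))"
    by (rule chart_pointI[OF B i[OF I(2)]])
  have "cov_deriv (horizontal B) (gr_metric B) x (cov_deriv (horizontal B) (gr_metric B) x V) t
      = chart_diff B (\<gamma> t) (velocity (hor_deriv h) t)"
    unfolding x_def
    by (rule cov_deriv_chart_field[where h = "hor_deriv h" and T = I, OF B i[OF I(2)] I])
       (rule cov[unfolded x_def] hor_deriv_horizontal has_vector_derivative_velocity[OF d] | assumption)+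
  moreover have "velocity x t = chart_diff B (\<gamma> t) (k t)"
    unfolding x_def by (rule velocityI[OF chart_curve_derivative[OF i[OF I(2)]]])
  ultimately show "cov_deriv (horizontal B) (gr_metric B) x (cov_deriv (horizontal B) (gr_metric B) x V) t
        + curvature (horizontal B) (gr_metric B) (x t) (V t) (velocity x t) (velocity x t)
      = chart_diff B (\<gamma> t) (velocity (hor_deriv h) t + gr_curvature_lift (k t) (h t))"
    using cp.curvature_chart_diff[OF h(1)[OF I(2)] k_horizontal] V[OF I(2)]
    by (simp add: x_def gr_curvature_lift_def cp.chart_diff_linear)
qed

lemma chart_lift_chart_diff_curve:
  assumes "B \<in> stiefel" "invertible (transpose B ** \<gamma> s)" "h \<in> horizontal (\<gamma> s)"
  shows "chart_lift B (\<gamma> s) (chart_diff B (\<gamma> s) h) = h"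
proof -
  interpret cp: chart_point B "\<gamma> s" "transpose B ** \<gamma> s" "matrix_inv (transpose B ** \<gamma> s)" "gr_chart B (gr_q (\<gamma> s))"
    by (rule chart_pointI[OF assms(1,2)])
  show ?thesis by (rule cp.chart_lift_diff[OF assms(3)])
qed

text \<open>The equation in every chart is the image of the lifted one under \<open>chart_diff\<close>, whose kernel
  consists of the matrices without horizontal component.  Conversely, near time \<open>t\<close> the chart centred at \<open>\<gamma> t\<close> is used; differentiability
  of the lift and of its derivative is recovered by applying \<open>chart_lift\<close> to the coordinate fields.\<close>

lemma gr_jacobi_on_iff:
  assumes T: "open T" and geo: "gr_geodesic_on T (\<lambda>t. gr_q (\<gamma> t))"
    and lift: "gr_horizontal_lift T \<gamma> J h"
  shows "gr_jacobi_on T (\<lambda>t. gr_q (\<gamma> t)) J \<longleftrightarrow> lifted_jacobi_on T h"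
proof
  have h: "h s \<in> horizontal (\<gamma> s)" and J: "J s = gr_dq (\<gamma> s) (h s)" if "s \<in> T" for s
    using lift that by (auto simp: gr_horizontal_lift_def)
  have I: "{t\<in>T. gr_q (\<gamma> t) \<in> gr_dom B} = {t\<in>T. invertible (transpose B ** \<gamma> t)}" for B
    by (simp add: gr_dom_iff in_stiefel)
  have V: "J s B = chart_diff B (\<gamma> s) (h s)" if "B \<in> stiefel" "s \<in> T" "invertible (transpose B ** \<gamma> s)" for B s
    using that J by (simp add: gr_dq_eq in_stiefel)
  show "lifted_jacobi_on T h" if jac: "gr_jacobi_on T (\<lambda>t. gr_q (\<gamma> t)) J"
    unfolding lifted_jacobi_on_def Let_def
  proof
    fix t assume t: "t \<in> T"
    define B where "B = \<gamma> t"
    define D where "D = {s\<in>T. invertible (transpose B ** \<gamma> s)}"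
    define x where "x = (\<lambda>s. gr_chart B (gr_q (\<gamma> s)))"
    define W where "W = (\<lambda>s. J s B)"
    have B: "B \<in> stiefel" by (simp add: B_def in_stiefel)
    have D: "open D" "t \<in> D"
      using open_chart_times[OF T] t by (auto simp: D_def B_def gg invertible_def intro!: exI[of _ "mat 1"])
    have jac': "W differentiable (at s)" "cov_deriv (horizontal B) (gr_metric B) x W differentiable (at s)"
        "cov_deriv (horizontal B) (gr_metric B) x (cov_deriv (horizontal B) (gr_metric B) x W) s
          + curvature (horizontal B) (gr_metric B) (x s) (W s) (velocity x s) (velocity x s) = 0" if "s \<in> D" for s
      using jac B that unfolding gr_jacobi_on_def Let_def I D_def x_def W_def by blast+
    have WD: "W s = chart_diff B (\<gamma> s) (h s)" if "s \<in> D" for s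
      using V[OF B] that by (simp add: W_def D_def)
    have iD: "invertible (transpose B ** \<gamma> s)" and hD: "h s \<in> horizontal (\<gamma> s)" if "s \<in> D" for s
      using that h by (auto simp: D_def)
    have hd: "h differentiable (at s)" if s: "s \<in> D" for s
      by (rule differentiable_cong_open(1)[OF D(1) s _ lifted_field_derivative[OF jac'(1)[OF s], of B]])
         (simp add: WD chart_lift_chart_diff_curve B iD hD)
    have cov: "cov_deriv (horizontal B) (gr_metric B) x W s = chart_diff B (\<gamma> s) (hor_deriv h s)" if s: "s \<in> D" for s
      unfolding x_def by (rule jacobi_equation_chart(1)[OF B D(1) s iD WD hD hd])
    have md: "hor_deriv h differentiable (at t)"
      by (rule differentiable_cong_open(1)[OF D _ lifted_field_derivative[OF jac'(2)[OF D(2)], of B]])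
         (simp add: cov chart_lift_chart_diff_curve B iD hor_deriv_horizontal)
    interpret cp: chart_point B "\<gamma> t" "transpose B ** \<gamma> t" "matrix_inv (transpose B ** \<gamma> t)" "gr_chart B (gr_q (\<gamma> t))"
      by (rule chart_pointI[OF B iD[OF D(2)]])
    have "chart_diff B (\<gamma> t) (velocity (hor_deriv h) t + gr_curvature_lift (k t) (h t)) = 0"
      using jacobi_equation_chart(2)[OF B D iD WD hD hd md] jac'(3)[OF D(2)] by (simp add: x_def)
    thus "h t \<in> horizontal (\<gamma> t) \<and> h differentiable (at t) \<and> hor_deriv h differentiable (at t) \<and>
      velocity (hor_deriv h) t + gr_curvature_lift (k t) (h t)
      = \<gamma> t ** (transpose (\<gamma> t) ** (velocity (hor_deriv h) t + gr_curvature_lift (k t) (h t)))"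
      using cp.chart_diff_eq_0_iff h[OF t] hd[OF D(2)] md by blast
  qed
  show "gr_jacobi_on T (\<lambda>t. gr_q (\<gamma> t)) J" if jac: "lifted_jacobi_on T h"
    unfolding gr_jacobi_on_def Let_def
  proof (intro conjI ballI geo)
    fix t assume t: "t \<in> T"
    have "h t \<in> stiefel_tangent (\<gamma> t)"
      using h[OF t] transpose_mult_eq_zero_commute by (auto simp: horizontal_def stiefel_tangent_def)
    thus "J t \<in> gr_tangent (gr_q (\<gamma> t))" using J[OF t] in_stiefel by (auto simp: gr_tangent_def)
  next
    fix B :: "real^'p^'n" and t assume B: "B \<in> stiefel" and t: "t \<in> {t\<in>T. gr_q (\<gamma> t) \<in> gr_dom B}"
    define D where "D = {s\<in>T. invertible (transpose B ** \<gamma> s)}"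
    have D: "open D" "t \<in> D" using open_chart_times[OF T] t I by (auto simp: D_def)
    have iD: "invertible (transpose B ** \<gamma> s)" and hD: "h s \<in> horizontal (\<gamma> s)" if "s \<in> D" for s
      using that h by (auto simp: D_def)
    have WD: "J s B = chart_diff B (\<gamma> s) (h s)" if "s \<in> D" for s
      using V[OF B] that by (simp add: D_def)
    have hd: "h differentiable (at s)" and md: "hor_deriv h differentiable (at s)" if "s \<in> D" for s
      using jac that by (auto simp: lifted_jacobi_on_def D_def)
    let ?cov = "cov_deriv (horizontal B) (gr_metric B) (\<lambda>t. gr_chart B (gr_q (\<gamma> t)))"
    show "(\<lambda>t. J t B) differentiable (at t)"
      by (rule differentiable_cong_open(1)[OF D _ chart_field_derivative[OF iD[OF D(2)] hd[OF D(2)]]]) (simp add: WD)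
    have cov: "?cov (\<lambda>t. J t B) s = chart_diff B (\<gamma> s) (hor_deriv h s)" if s: "s \<in> D" for s
      by (rule jacobi_equation_chart(1)[OF B D(1) s iD WD hD hd])
    show "?cov (\<lambda>t. J t B) differentiable (at t)"
      by (rule differentiable_cong_open(1)[OF D _ chart_field_derivative[OF iD[OF D(2)] md[OF D(2)]]]) (simp add: cov)
    interpret cp: chart_point B "\<gamma> t" "transpose B ** \<gamma> t" "matrix_inv (transpose B ** \<gamma> t)" "gr_chart B (gr_q (\<gamma> t))"
      by (rule chart_pointI[OF B iD[OF D(2)]])
    have "chart_diff B (\<gamma> t) (velocity (hor_deriv h) t + gr_curvature_lift (k t) (h t)) = 0"
      using jac D(2) unfolding cp.chart_diff_eq_0_iff by (auto simp: lifted_jacobi_on_def D_def Let_def)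
    thus "?cov (?cov (\<lambda>t. J t B)) t + curvature (horizontal B) (gr_metric B) (gr_chart B (gr_q (\<gamma> t))) (J t B)
        (velocity (\<lambda>t. gr_chart B (gr_q (\<gamma> t))) t) (velocity (\<lambda>t. gr_chart B (gr_q (\<gamma> t))) t) = 0"
      using jacobi_equation_chart(2)[OF B D iD WD hD hd md[OF D(2)]] by simp
  qed
qed

text \<open>The vertical components of the derivatives of \<open>h\<close> and \<open>hor_deriv h\<close> follow by differentiating
  \<open>\<gamma>\<^sup>T h = 0\<close>, so the lifted Jacobi equation becomes a linear first-order system.\<close>

lemma lifted_jacobi_first_order:
  assumes jac: "lifted_jacobi_on T h" and T: "open T" "t \<in> T"
  shows "(h has_vector_derivative hor_deriv h t - \<gamma> t ** (transpose (k t) ** h t)) (at t)"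
    and "(hor_deriv h has_vector_derivative
      - gr_curvature_lift (k t) (h t) - \<gamma> t ** (transpose (k t) ** hor_deriv h t)) (at t)"
proof -
  have vert: "transpose (\<gamma> t) ** velocity f t = - (transpose (k t) ** f t)"
    if "\<And>s. s \<in> T \<Longrightarrow> f s \<in> horizontal (\<gamma> s)" "f differentiable (at t)" for f
  proof -
    have "transpose (\<gamma> t) ** velocity f t + transpose (k t) ** f t = 0"
      by (rule has_vector_derivative_unique_open[OF T, where f = "\<lambda>s. transpose (\<gamma> s) ** f s" and g = "\<lambda>_. 0"])
         (use that(1) in \<open>simp add: horizontal_def\<close>,
          (rule hvd_rules curve has_vector_derivative_velocity[OF that(2)])+)
    thus ?thesis by (simp add: eq_neg_iff_add_eq_0)
  qed
  have h: "\<And>s. s \<in> T \<Longrightarrow> h s \<in> horizontal (\<gamma> s)" "h differentiable (at t)" "hor_deriv h differentiable (at t)"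
    and e: "velocity (hor_deriv h) t + gr_curvature_lift (k t) (h t)
      = \<gamma> t ** (transpose (\<gamma> t) ** (velocity (hor_deriv h) t + gr_curvature_lift (k t) (h t)))"
    using jac T(2) by (auto simp: lifted_jacobi_on_def Let_def)
  have "velocity h t = hor_deriv h t + \<gamma> t ** (transpose (\<gamma> t) ** velocity h t)" by (simp add: hor_deriv_def)
  hence "velocity h t = hor_deriv h t - \<gamma> t ** (transpose (k t) ** h t)"
    using vert[OF h(1,2)] by (simp add: matrix_simps)
  thus "(h has_vector_derivative hor_deriv h t - \<gamma> t ** (transpose (k t) ** h t)) (at t)"
    using has_vector_derivative_velocity[OF h(2)] by simp
  have 0: "transpose (\<gamma> t) ** h t = 0" "transpose (\<gamma> t) ** k t = 0"
    using h(1)[OF T(2)] k_horizontal[of t] by (simp_all add: horizontal_def)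
  hence 0: "transpose (\<gamma> t) ** (h t ** X) = 0" "transpose (\<gamma> t) ** (k t ** X) = 0" for X :: "real^'p^'p"
    by (simp_all add: matrix_mul_assoc)
  have "transpose (\<gamma> t) ** (velocity (hor_deriv h) t + gr_curvature_lift (k t) (h t))
      = - (transpose (k t) ** hor_deriv h t)"
    using vert[of "hor_deriv h", OF hor_deriv_horizontal h(3)] 0 by (simp add: gr_curvature_lift_def matrix_simps)
  hence "velocity (hor_deriv h) t + gr_curvature_lift (k t) (h t) = - (\<gamma> t ** (transpose (k t) ** hor_deriv h t))"
    using e by (simp add: matrix_simps)
  hence "velocity (hor_deriv h) t = - (\<gamma> t ** (transpose (k t) ** hor_deriv h t)) - gr_curvature_lift (k t) (h t)"
    by (simp only: eq_diff_eq)
  hence "velocity (hor_deriv h) t = - gr_curvature_lift (k t) (h t) - \<gamma> t ** (transpose (k t) ** hor_deriv h t)"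
    by simp
  thus "(hor_deriv h has_vector_derivative
      - gr_curvature_lift (k t) (h t) - \<gamma> t ** (transpose (k t) ** hor_deriv h t)) (at t)"
    using has_vector_derivative_velocity[OF h(3)] by simp
qed

lemma lifted_jacobi_unique:
  assumes T: "open_interval T" "0 \<in> T" "t \<in> T"
    and jac: "lifted_jacobi_on T h" "lifted_jacobi_on T h\<^sub>1"
    and 0: "h 0 = h\<^sub>1 0" "velocity h 0 = velocity h\<^sub>1 0"
    and speed: "\<And>s. norm (k s) = \<kappa>"
  shows "h t = h\<^sub>1 t"
proof -
  have T': "open T" "is_interval T" using T by (auto simp: open_interval_def)
  have ng: "norm (\<gamma> s) = norm (\<gamma> 0)" for s by (simp add: norm_eq_sqrt_inner inner_matrix_def gg)
  define \<rho> where "\<rho> = norm (\<gamma> 0)"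
  have pos: "\<kappa> \<ge> 0" "\<rho> \<ge> 0" using speed[of 0] by (auto simp: \<rho>_def)
  let ?d = "\<lambda>s. h s - h\<^sub>1 s" and ?e = "\<lambda>s. hor_deriv h s - hor_deriv h\<^sub>1 s"
  let ?d' = "\<lambda>s. ?e s - \<gamma> s ** (transpose (k s) ** ?d s)"
  let ?e' = "\<lambda>s. - gr_curvature_lift (k s) (?d s) - \<gamma> s ** (transpose (k s) ** ?e s)"
  have vert: "norm (\<gamma> s ** (transpose (k s) ** X)) \<le> \<rho> * \<kappa> * norm X" for s and X :: "real^'p^'n"
    using norm_matrix_mult_le[of "\<gamma> s" "transpose (k s) ** X"]
      mult_left_mono[OF norm_matrix_mult_le[of "transpose (k s)" X], of "norm (\<gamma> s)"]
    by (simp add: norm_transpose mult.assoc ng[of s] \<rho>_def speed)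
  have "(?d t, ?e t) = 0"
  proof (rule gronwall_zero[OF T'(2) T(2,3)])
    fix s assume s: "s \<in> T"
    note l = lifted_jacobi_first_order[OF jac(1) T'(1) s] and l1 = lifted_jacobi_first_order[OF jac(2) T'(1) s]
    have "(?d has_vector_derivative ?d' s) (at s)"
      by (rule hvd_eq, (rule hvd_rules l(1) l1(1))+) (simp add: matrix_simps)
    moreover have "(?e has_vector_derivative ?e' s) (at s)"
      by (rule hvd_eq, (rule hvd_rules l(2) l1(2))+) (simp add: matrix_simps gr_curvature_lift_diff)
    ultimately show "((\<lambda>s. (?d s, ?e s)) has_vector_derivative (?d' s, ?e' s)) (at s)"
      by (rule has_vector_derivative_Pair)
    have n: "norm (?d s) \<le> norm (?d s, ?e s)" "norm (?e s) \<le> norm (?d s, ?e s)"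
      by (rule norm_fst_le, rule norm_snd_le)
    have "norm (?d' s, ?e' s) \<le> norm (?d' s) + norm (?e' s)" by (rule norm_Pair_le)
    also have "\<dots> \<le> (norm (?e s) + \<rho> * \<kappa> * norm (?d s)) + (4 * \<kappa>\<^sup>2 * norm (?d s) + \<rho> * \<kappa> * norm (?e s))"
      using norm_triangle_ineq4[of "?e s" "\<gamma> s ** (transpose (k s) ** ?d s)"] vert[of s "?d s"]
        norm_triangle_ineq4[of "- gr_curvature_lift (k s) (?d s)" "\<gamma> s ** (transpose (k s) ** ?e s)"]
        vert[of s "?e s"] norm_gr_curvature_lift[of "k s" "?d s"]
      by (simp add: speed)
    also have "\<dots> \<le> (norm (?d s, ?e s) + \<rho> * \<kappa> * norm (?d s, ?e s))
        + (4 * \<kappa>\<^sup>2 * norm (?d s, ?e s) + \<rho> * \<kappa> * norm (?d s, ?e s))"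
      using n pos by (intro add_mono mult_left_mono) auto
    finally show "norm (?d' s, ?e' s) \<le> (1 + 2 * \<rho> * \<kappa> + 4 * \<kappa>\<^sup>2) * norm (?d s, ?e s)"
      by (simp add: algebra_simps)
  qed (simp add: 0 hor_deriv_def zero_prod_def)
  thus ?thesis by (simp add: zero_prod_def)
qed

end

section \<open>Variations of horizontal geodesics\<close>

text \<open>The derivative at \<open>s = 0\<close> of a family \<open>hgeo Y\<^sub>s \<eta>\<^sub>s\<close> in which \<open>(Y\<^sub>s, \<eta>\<^sub>s)\<close> starts at \<open>(Y, \<eta>)\<close> with velocity
  \<open>(\<nu>, \<delta>)\<close>; \<open>E\<close> is the corresponding variation of \<open>\<eta>\<^sup>T \<eta>\<close>.\<close>

definition geo_var :: "real^'p^'n \<Rightarrow> real^'p^'n \<Rightarrow> real^'p^'n \<Rightarrow> real^'p^'n \<Rightarrow> real \<Rightarrow> real^'p^'n" where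
  "geo_var Y \<eta> \<nu> \<delta> t = (let S = transpose \<eta> ** \<eta>; E = transpose \<eta> ** \<delta> + transpose \<delta> ** \<eta> in
     \<nu> ** cos_sum (matpow S) t + \<delta> ** sin_sum (matpow S) t
     + Y ** cos_sum (dpow S E) t + \<eta> ** sin_sum (dpow S E) t)"

definition geo_var_vel :: "real^'p^'n \<Rightarrow> real^'p^'n \<Rightarrow> real^'p^'n \<Rightarrow> real^'p^'n \<Rightarrow> real \<Rightarrow> real^'p^'n" where
  "geo_var_vel Y \<eta> \<nu> \<delta> t = (let S = transpose \<eta> ** \<eta>; E = transpose \<eta> ** \<delta> + transpose \<delta> ** \<eta> in
     \<delta> ** cos_sum (matpow S) t - \<nu> ** (sin_sum (matpow S) t ** S)
     + \<eta> ** cos_sum (dpow S E) t - Y ** (sin_sum (dpow S E) t ** S + sin_sum (matpow S) t ** E))"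

lemma geo_var_0: "geo_var Y \<eta> \<nu> \<delta> 0 = \<nu>" and geo_var_vel_0: "geo_var_vel Y \<eta> \<nu> \<delta> 0 = \<delta>"
  by (simp_all add: geo_var_def geo_var_vel_def Let_def cos_sum_0 sin_sum_0)

lemma geo_var_derivative: "(geo_var Y \<eta> \<nu> \<delta> has_vector_derivative geo_var_vel Y \<eta> \<nu> \<delta> t) (at t)"
  and geo_var_vel_derivative:
    "(geo_var_vel Y \<eta> \<nu> \<delta> has_vector_derivative
       - (geo_var Y \<eta> \<nu> \<delta> t ** (transpose \<eta> ** \<eta>))
       - hgeo Y \<eta> t ** (transpose \<eta> ** \<delta> + transpose \<delta> ** \<eta>)) (at t)"
proof -
  let ?S = "transpose \<eta> ** \<eta>" and ?E = "transpose \<eta> ** \<delta> + transpose \<delta> ** \<eta>"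
  show "(geo_var Y \<eta> \<nu> \<delta> has_vector_derivative geo_var_vel Y \<eta> \<nu> \<delta> t) (at t)"
    unfolding geo_var_def[abs_def] geo_var_vel_def Let_def
    by (rule hvd_eq, (rule hvd_rules matpow_series_derivatives)+) (simp add: matrix_simps)
  show "(geo_var_vel Y \<eta> \<nu> \<delta> has_vector_derivative - (geo_var Y \<eta> \<nu> \<delta> t ** ?S) - hgeo Y \<eta> t ** ?E) (at t)"
    unfolding geo_var_vel_def[abs_def] geo_var_def Let_def hgeo_def
    by (rule hvd_eq, (rule hvd_rules matpow_series_derivatives)+) (simp add: matrix_simps algebra_simps)
qed

lemma geo_var_eq_matfun:
  fixes \<eta> :: "real^'p^'n"
  defines "A \<equiv> \<lambda>t. t\<^sup>2 *\<^sub>R (transpose \<eta> ** \<eta>)"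
  shows "geo_var Y \<eta> \<nu> \<delta> t = (let E = transpose \<eta> ** \<delta> + transpose \<delta> ** \<eta> in
    \<nu> ** matfun csr (A t) + t *\<^sub>R (\<delta> ** matfun ssr (A t))
    + t\<^sup>2 *\<^sub>R (Y ** frechet_L csr (A t) E) + t ^ 3 *\<^sub>R (\<eta> ** frechet_L ssr (A t) E))"
proof -
  have mult: "c *\<^sub>R (X ** M) = X ** (c *\<^sub>R M)" for c and X :: "real^'p^'n" and M :: "real^'p^'p"
    by (simp add: matrix_simps)
  show ?thesis
    unfolding geo_var_def A_def Let_def mult frechet_L_csr frechet_L_ssr matfun_csr matfun_ssr ..
qed

text \<open>The horizontal part of the variation field.  It differs from the variation field by a vertical field,
  which is invisible in the quotient.\<close>

definition jac_lift :: "real^'p^'n \<Rightarrow> real^'p^'n \<Rightarrow> real^'p^'n \<Rightarrow> real^'p^'n \<Rightarrow> real \<Rightarrow> real^'p^'n" where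
  "jac_lift Y \<eta> \<nu> \<delta> t = (mat 1 - hgeo Y \<eta> t ** transpose (hgeo Y \<eta> t)) ** geo_var Y \<eta> \<nu> \<delta> t"

lemma horizontal_curve_hgeo:
  assumes "Y \<in> stiefel" "\<eta> \<in> horizontal Y"
  shows "horizontal_curve (hgeo Y \<eta>) (hgeo_vel Y \<eta>)"
  using hgeo_in_stiefel[OF assms] hgeo_first_integrals(2)[OF assms] hgeo_derivative[of Y \<eta>]
  by unfold_locales (simp_all add: horizontal_def)

text \<open>The condition on \<open>\<delta>\<close> is the linearisation of horizontality \<open>Y\<^sub>s\<^sup>T \<eta>\<^sub>s = 0\<close>.\<close>

locale geodesic_variation =
  fixes Y \<eta> \<nu> \<delta> :: "real^'p^'n"
  assumes Y: "Y \<in> stiefel" and \<eta>: "\<eta> \<in> horizontal Y" and \<nu>: "\<nu> \<in> horizontal Y"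
    and \<delta>: "transpose Y ** \<delta> = - (transpose \<nu> ** \<eta>)"
begin

sublocale horizontal_curve "hgeo Y \<eta>" "hgeo_vel Y \<eta>"
  by (rule horizontal_curve_hgeo[OF Y \<eta>])

abbreviation "g \<equiv> hgeo Y \<eta>"
abbreviation "k \<equiv> hgeo_vel Y \<eta>"
abbreviation "S \<equiv> transpose \<eta> ** \<eta>"
abbreviation "E \<equiv> transpose \<eta> ** \<delta> + transpose \<delta> ** \<eta>"
abbreviation "U \<equiv> geo_var Y \<eta> \<nu> \<delta>"
abbreviation "U' \<equiv> geo_var_vel Y \<eta> \<nu> \<delta>"

lemmas gk = hgeo_first_integrals(2)[OF Y \<eta>]
lemmas kk = hgeo_first_integrals(3)[OF Y \<eta>]

lemma gk_mult: "transpose (g t) ** (k t ** X) = 0" "transpose (k t) ** (g t ** X) = 0" "transpose (k t) ** g t = 0"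
  using gk[of t] transpose_mult_eq_zero_commute[OF gk[of t]] by (simp_all add: matrix_mul_assoc)

text \<open>The variation preserves the constraints \<open>\<gamma>\<^sup>T \<gamma> = 1\<close>, \<open>\<gamma>\<^sup>T \<gamma>' = 0\<close>, \<open>\<gamma>'\<^sup>T \<gamma>' = S\<close> to first order.
  The three linearised constraints form one coupled linear system, so they persist together.\<close>

lemma variation_first_integral: "transpose (g t) ** U' t + transpose (U t) ** k t = 0"
proof -
  note rules = hvd_rules hgeo_derivative hgeo_vel_derivative geo_var_derivative geo_var_vel_derivative
  have "transpose (g t) ** U t + transpose (U t) ** g t = 0
      \<and> transpose (g t) ** U' t + transpose (U t) ** k t = 0
      \<and> transpose (k t) ** U' t + transpose (U' t) ** k t - E = 0"
  proof (rule first_integrals_vanish[where T = UNIV and S = S])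
    show "((\<lambda>s. transpose (g s) ** U s + transpose (U s) ** g s) has_vector_derivative
        (transpose (g s) ** U' s + transpose (U s) ** k s) + transpose (transpose (g s) ** U' s + transpose (U s) ** k s)) (at s)" for s
      by (rule hvd_eq, (rule rules)+) (simp add: matrix_simps algebra_simps)
    show "((\<lambda>s. transpose (g s) ** U' s + transpose (U s) ** k s) has_vector_derivative
        (transpose (k s) ** U' s + transpose (U' s) ** k s - E) - (transpose (g s) ** U s + transpose (U s) ** g s) ** S) (at s)" for s
      by (rule hvd_eq, (rule rules)+) (simp add: matrix_simps gg algebra_simps)
    show "((\<lambda>s. transpose (k s) ** U' s + transpose (U' s) ** k s - E) has_vector_derivative
        - (S ** (transpose (g s) ** U' s + transpose (U s) ** k s))
        - transpose (transpose (g s) ** U' s + transpose (U s) ** k s) ** S) (at s)" for s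
      by (rule hvd_eq, (rule rules)+) (simp add: matrix_simps gk gk_mult algebra_simps)
  qed (use \<nu> \<delta> transpose_mult_eq_zero_commute[of Y \<nu>] in \<open>simp_all add: geo_var_0 geo_var_vel_0 horizontal_def\<close>)
  thus ?thesis by blast
qed

lemma jac_lift_eq: "jac_lift Y \<eta> \<nu> \<delta> t = U t - g t ** (transpose (g t) ** U t)"
  by (simp add: jac_lift_def matrix_simps)

lemma jac_lift_derivative:
  "(jac_lift Y \<eta> \<nu> \<delta> has_vector_derivative
     U' t - g t ** (transpose (k t) ** U t + transpose (g t) ** U' t) - k t ** (transpose (g t) ** U t)) (at t)"
  unfolding jac_lift_eq[abs_def]
  by (rule hvd_eq, (rule hvd_rules hgeo_derivative geo_var_derivative)+) (simp add: matrix_simps)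

lemma hor_deriv_jac_lift:
  "hor_deriv (jac_lift Y \<eta> \<nu> \<delta>) = (\<lambda>t. U' t - g t ** (transpose (g t) ** U' t) - k t ** (transpose (g t) ** U t))"
  by (rule ext) (simp add: hor_deriv_def velocityI[OF jac_lift_derivative] matrix_simps gg gk gk_mult)

lemma jac_lift_0: "jac_lift Y \<eta> \<nu> \<delta> 0 = \<nu>"
  and velocity_jac_lift_0: "velocity (jac_lift Y \<eta> \<nu> \<delta>) 0 = \<delta> - Y ** (transpose \<eta> ** \<nu> + transpose Y ** \<delta>)"
  using \<nu> by (simp_all add: jac_lift_eq velocityI[OF jac_lift_derivative] geo_var_0 geo_var_vel_0 horizontal_def)

text \<open>Modulo vertical terms \<open>(hor_deriv h)' = - h S - k (k\<^sup>T U + 2 g\<^sup>T U')\<close>; adding the curvature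
  term with \<open>h\<^sup>T k = U\<^sup>T k\<close> leaves \<open>- 2 k (g\<^sup>T U' + U\<^sup>T k)\<close>, which vanishes by the first integral.\<close>

lemma lifted_jacobi_jac_lift: "lifted_jacobi_on UNIV (jac_lift Y \<eta> \<nu> \<delta>)"
  unfolding lifted_jacobi_on_def Let_def
proof (intro ballI conjI)
  fix t
  let ?h = "jac_lift Y \<eta> \<nu> \<delta>"
  show "?h t \<in> horizontal (g t)" by (simp add: horizontal_def jac_lift_eq matrix_simps gg)
  show "?h differentiable (at t)" by (rule differentiableI_vector[OF jac_lift_derivative])
  let ?m' = "(- (U t ** S) - g t ** E)
    - (g t ** (transpose (g t) ** (- (U t ** S) - g t ** E) + transpose (k t) ** U' t) + k t ** (transpose (g t) ** U' t))
    - (k t ** (transpose (g t) ** U' t + transpose (k t) ** U t) - g t ** S ** (transpose (g t) ** U t))"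
  have m: "(hor_deriv ?h has_vector_derivative ?m') (at t)"
    unfolding hor_deriv_jac_lift
    by (rule hvd_eq, (rule hvd_rules hgeo_derivative hgeo_vel_derivative geo_var_derivative geo_var_vel_derivative)+)
       (simp add: matrix_simps)
  show "hor_deriv ?h differentiable (at t)" by (rule differentiableI_vector[OF m])
  have i1: "transpose (g t) ** U' t = - (transpose (U t) ** k t)"
    using variation_first_integral[of t] by (simp add: eq_neg_iff_add_eq_0)
  have "velocity (hor_deriv ?h) t + gr_curvature_lift (k t) (?h t)
      = g t ** (S ** (transpose (g t) ** U t) - transpose (k t) ** U' t)"
    unfolding velocityI[OF m] gr_curvature_lift_def kk jac_lift_eq
    by (simp add: matrix_simps gg gk gk_mult i1 algebra_simps numeral_mult_matrix)
  thus "velocity (hor_deriv ?h) t + gr_curvature_lift (k t) (?h t)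
      = g t ** (transpose (g t) ** (velocity (hor_deriv ?h) t + gr_curvature_lift (k t) (?h t)))"
    by (simp only: gg)
qed

end

section \<open>Geodesics and Jacobi fields of the Grassmann manifold\<close>

text \<open>The correction in \<open>\<delta>t\<close> is the vertical one: \<open>\<nu>t\<close> is the derivative of the projected field
  \<open>jac_lift\<close>, and projecting adds \<open>Y (\<nu>m\<^sup>T \<eta> - \<eta>\<^sup>T \<nu>m)\<close> to the derivative of the variation field.\<close>

theorem proposition13:
  fixes Y \<eta> :: "real^'p::finite^'n::finite"
    and \<gamma> :: "real \<Rightarrow> real^'p^'n"
  assumes "CARD('n) > CARD('p)"
    and "Y \<in> stiefel"
    and "\<eta> \<in> horizontal Y"
    and "\<gamma> = (\<lambda>t. stiefel_exp Y (t *\<^sub>R \<eta>))"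
  shows
    "(stiefel_geodesic_on UNIV \<gamma> \<and> \<gamma> 0 = Y \<and> velocity \<gamma> 0 = \<eta> \<and>
      (\<forall>t. velocity \<gamma> t \<in> horizontal (\<gamma> t)) \<and>
      (\<forall>t. \<gamma> t = Y ** matfun csr (t\<^sup>2 *\<^sub>R (transpose \<eta> ** \<eta>))
                  + t *\<^sub>R (\<eta> ** matfun ssr (t\<^sup>2 *\<^sub>R (transpose \<eta> ** \<eta>)))))
     \<and>
     (gr_geodesic_on UNIV (\<lambda>t. gr_q (\<gamma> t)) \<and> gr_velocity (\<lambda>t. gr_q (\<gamma> t)) 0 = gr_dq Y \<eta> \<and>
      (\<forall>S c. open_interval S \<and> 0 \<in> S \<and> gr_geodesic_on S c \<and>
              c 0 = gr_q Y \<and> gr_velocity c 0 = gr_dq Y \<eta>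
              \<longrightarrow> (\<forall>t\<in>S. c t = gr_q (\<gamma> t))))
     \<and>
     (\<forall>\<nu>m \<nu>t. (Y, \<nu>m, \<eta>, \<nu>t) \<in> QHSt \<longrightarrow>
       (\<exists>JB JH. gr_jacobi_on UNIV (\<lambda>t. gr_q (\<gamma> t)) JB \<and> gr_horizontal_lift UNIV \<gamma> JB JH \<and>
                has_initial_data \<gamma> JH (Y, \<nu>m, \<eta>, \<nu>t)) \<and>
       (\<forall>S JB JH. open_interval S \<and> 0 \<in> S \<and>
          gr_jacobi_on S (\<lambda>t. gr_q (\<gamma> t)) JB \<and> gr_horizontal_lift S \<gamma> JB JH \<and>
          has_initial_data \<gamma> JH (Y, \<nu>m, \<eta>, \<nu>t)
          \<longrightarrow> (\<forall>t\<in>S.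
                let \<delta>t = \<nu>t - Y ** (transpose \<nu>m ** \<eta> - transpose \<eta> ** \<nu>m);
                    A = t\<^sup>2 *\<^sub>R (transpose \<eta> ** \<eta>);
                    E = transpose \<eta> ** \<delta>t + transpose \<delta>t ** \<eta>
                in JH t = (mat 1 - \<gamma> t ** transpose (\<gamma> t)) **
                     (\<nu>m ** matfun csr A + t *\<^sub>R (\<delta>t ** matfun ssr A)
                      + t\<^sup>2 *\<^sub>R (Y ** frechet_L csr A E)
                      + t ^ 3 *\<^sub>R (\<eta> ** frechet_L ssr A E)))))"
proof -
  note Y = assms(2) and \<eta> = assms(3)
  have \<gamma>: "\<gamma> = hgeo Y \<eta>"
    unfolding assms(4) by (rule ext) (rule stiefel_exp_scaleR_horizontal[OF Y \<eta>])
  interpret hc: horizontal_curve "hgeo Y \<eta>" "hgeo_vel Y \<eta>" by (rule horizontal_curve_hgeo[OF Y \<eta>])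
  have geo: "gr_geodesic_on UNIV (\<lambda>t. gr_q (\<gamma> t))"
    unfolding \<gamma> using hgeo_vel_derivative[of Y \<eta>]
    by (intro hc.gr_geodesic_on_curve[of "\<lambda>_. - (transpose \<eta> ** \<eta>)"]) (simp add: matrix_simps)
  have vel: "gr_velocity (\<lambda>t. gr_q (\<gamma> t)) 0 = gr_dq Y \<eta>"
  proof
    fix B :: "real^'p^'n"
    show "gr_velocity (\<lambda>t. gr_q (\<gamma> t)) 0 B = gr_dq Y \<eta> B"
      using velocityI[OF hc.chart_curve_derivative[of B 0]]
      by (simp add: gr_velocity_def gr_dq_eq[OF Y] \<gamma> gr_dom_iff[OF Y])
  qed
  have stiefel_part: "stiefel_geodesic_on UNIV \<gamma> \<and> \<gamma> 0 = Y \<and> velocity \<gamma> 0 = \<eta> \<and>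
      (\<forall>t. velocity \<gamma> t \<in> horizontal (\<gamma> t)) \<and>
      (\<forall>t. \<gamma> t = Y ** matfun csr (t\<^sup>2 *\<^sub>R (transpose \<eta> ** \<eta>))
                  + t *\<^sub>R (\<eta> ** matfun ssr (t\<^sup>2 *\<^sub>R (transpose \<eta> ** \<eta>))))"
    unfolding \<gamma> velocity_hgeo using hgeo_geodesic[OF Y \<eta>] hc.k_horizontal hgeo_eq_matfun[of Y \<eta>] by simp
  have unique: "c t = gr_q (\<gamma> t)" if "open_interval S" "0 \<in> S" "gr_geodesic_on S c"
      "c 0 = gr_q Y" "gr_velocity c 0 = gr_dq Y \<eta>" "t \<in> S" for S c t
  proof (rule gr_geodesic_unique[OF that(1,2,6,3)])
    show "gr_geodesic_on S (\<lambda>t. gr_q (\<gamma> t))"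
      using gr_geodesic_on_subset[OF geo] that(1) by (simp add: open_interval_def)
  qed (use that vel \<gamma> in simp_all)
  have jacobi: "(\<exists>JB JH. gr_jacobi_on UNIV (\<lambda>t. gr_q (\<gamma> t)) JB \<and> gr_horizontal_lift UNIV \<gamma> JB JH \<and>
                has_initial_data \<gamma> JH (Y, \<nu>m, \<eta>, \<nu>t))" (is ?ex)
    "\<lbrakk>open_interval S; 0 \<in> S; gr_jacobi_on S (\<lambda>t. gr_q (\<gamma> t)) JB; gr_horizontal_lift S \<gamma> JB JH;
      has_initial_data \<gamma> JH (Y, \<nu>m, \<eta>, \<nu>t); t \<in> S\<rbrakk>
     \<Longrightarrow> JH t = jac_lift Y \<eta> \<nu>m (\<nu>t - Y ** (transpose \<nu>m ** \<eta> - transpose \<eta> ** \<nu>m)) t"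
    if Q: "(Y, \<nu>m, \<eta>, \<nu>t) \<in> QHSt" for \<nu>m \<nu>t S JB JH t
  proof -
    define \<delta>t where "\<delta>t = \<nu>t - Y ** (transpose \<nu>m ** \<eta> - transpose \<eta> ** \<nu>m)"
    have YY: "transpose Y ** Y = mat 1" "\<And>X. transpose Y ** (Y ** X) = X"
      using Y by (simp_all add: stiefel_def matrix_mul_assoc)
    have q: "transpose Y ** \<nu>m = 0" "transpose Y ** \<nu>t = - (transpose \<eta> ** \<nu>m)"
      using Q by (auto simp: QHSt_def eq_neg_iff_add_eq_0 add.commute)
    interpret geodesic_variation Y \<eta> \<nu>m \<delta>t
      by unfold_locales (use Y \<eta> q in \<open>simp_all add: horizontal_def \<delta>t_def matrix_simps YY\<close>)
    let ?h = "jac_lift Y \<eta> \<nu>m \<delta>t"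
    \<comment> \<open>Membership in \<open>QHSt\<close> is what makes the vertical part of \<open>\<nu>t\<close> match.\<close>
    have v0: "velocity ?h 0 = \<nu>t"
      unfolding velocity_jac_lift_0 by (simp add: \<delta>t_def matrix_simps YY q numeral_mult_matrix)
    let ?J = "\<lambda>t. gr_dq (\<gamma> t) (?h t)"
    have lift: "gr_horizontal_lift UNIV \<gamma> ?J ?h"
      using lifted_jacobi_jac_lift by (simp add: gr_horizontal_lift_def hc.lifted_jacobi_on_def \<gamma>)
    have "gr_jacobi_on UNIV (\<lambda>t. gr_q (\<gamma> t)) ?J"
      using hc.gr_jacobi_on_iff[of UNIV ?J ?h] lifted_jacobi_jac_lift lift geo by (simp add: \<gamma>)
    moreover have "has_initial_data \<gamma> ?h (Y, \<nu>m, \<eta>, \<nu>t)"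
      unfolding has_initial_data_def
      using differentiableI_vector[OF hgeo_derivative] differentiableI_vector[OF jac_lift_derivative] jac_lift_0 v0
      by (simp add: \<gamma> velocity_hgeo)
    ultimately show ?ex using lift by blast
    assume S: "open_interval S" "0 \<in> S" "t \<in> S" and jac: "gr_jacobi_on S (\<lambda>t. gr_q (\<gamma> t)) JB"
      and l: "gr_horizontal_lift S \<gamma> JB JH" and d: "has_initial_data \<gamma> JH (Y, \<nu>m, \<eta>, \<nu>t)"
    show "JH t = jac_lift Y \<eta> \<nu>m (\<nu>t - Y ** (transpose \<nu>m ** \<eta> - transpose \<eta> ** \<nu>m)) t"
      unfolding \<delta>t_def[symmetric]
    proof (rule hc.lifted_jacobi_unique[OF S])
      have "open S" using S by (simp add: open_interval_def)
      thus "hc.lifted_jacobi_on S JH"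
        using hc.gr_jacobi_on_iff[of S JB JH] jac l by (simp add: \<gamma> gr_jacobi_on_def)
      show "hc.lifted_jacobi_on S ?h" using lifted_jacobi_jac_lift by (simp add: hc.lifted_jacobi_on_def)
      show "JH 0 = ?h 0" "velocity JH 0 = velocity ?h 0"
        using d jac_lift_0 v0 by (simp_all add: has_initial_data_def)
      show "norm (hgeo_vel Y \<eta> s) = norm \<eta>" for s
        by (simp add: norm_eq_sqrt_inner inner_matrix_def kk)
    qed
  qed
  show ?thesis
  proof (rule conjI[OF stiefel_part conjI], goal_cases)
    case 1
    show ?case using geo vel unique by blast
  next
    case 2
    show ?case
    proof (intro allI impI conjI, goal_cases)
      case (1 \<nu>m \<nu>t)
      thus ?case by (rule jacobi(1))
    next
      case (2 \<nu>m \<nu>t S JB JH)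
      show ?case
      proof
        fix t assume "t \<in> S"
        with 2 have "JH t = jac_lift Y \<eta> \<nu>m (\<nu>t - Y ** (transpose \<nu>m ** \<eta> - transpose \<eta> ** \<nu>m)) t"
          by (intro jacobi(2)) auto
        thus "let \<delta>t = \<nu>t - Y ** (transpose \<nu>m ** \<eta> - transpose \<eta> ** \<nu>m);
                    A = t\<^sup>2 *\<^sub>R (transpose \<eta> ** \<eta>);
                    E = transpose \<eta> ** \<delta>t + transpose \<delta>t ** \<eta>
                in JH t = (mat 1 - \<gamma> t ** transpose (\<gamma> t)) **
                     (\<nu>m ** matfun csr A + t *\<^sub>R (\<delta>t ** matfun ssr A)
                      + t\<^sup>2 *\<^sub>R (Y ** frechet_L csr A E)
                      + t ^ 3 *\<^sub>R (\<eta> ** frechet_L ssr A E))"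
          unfolding Let_def jac_lift_def geo_var_eq_matfun \<gamma> .
      qed
    qed
  qed
qed

end
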